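(* Let $q\ge2$, let $L(s,F)$ be an $L$-function of degree $d\ge3$ satisfying the framework described in the context, let $0\le\beta<1$, and for each modulus $q$ let $\mathcal{F}_q$ be a subset (possibly the complete set, possibly depending on $F$) of the set of all primitive Dirichlet characters modulo $q$. Assume: (A1) $|\lambda_F(n)|\le \tau_d(n)$ for all integers $n\ge 1$. (A2) For some fixed (but arbitrary) $\varepsilon_0>0$, $\sum_{X\le n\le X+Y}|\lambda_F(n)|^2\ll_F Y$ holds for all large $X\geq 2$ and all $X^{1-\varepsilon_0}\le Y\le X$. (A3) For any $2\le P_1\le P_2\le X$, $\displaystyle\sum_{n\le X,\ (n,\prod_{P_1\le p\le P_2}p)=1}|\lambda_F(n)|^2\ll_F X\frac{\log P_1}{\log P_2}$. (A4) There is a small constant $c_F>0$ depending only on $F$ such that, for any $T$ with $\log^{100}q\ll T\ll q^{o(1)}$, $$\prod_{\chi\in\mathcal{F}_q}L(\sigma+it,F\times\chi)\ne 0\quad\text{for } \sigma>1-\frac{c_F}{\log^{\beta}(qT)},\ |t|\le T.$$ Then for $X\ge q^{1+\varepsilon}$ with $\log X\asymp\log q$, and any $\eta<1-\beta$, $$\sum_{\chi\in\mathcal{F}_q}\Big|\sum_{n\le X}\lambda_F(n)\chi(n)\Big|^2\ll_F\frac{X^2}{\log^{\eta}X}.$$ Moreover, if (A4) holds for all $Q\le q\le2Q$, then for $X\ge Q^{2+\varepsilon}$ with $\log X\asymp\log Q$, and any $\eta<1-\beta$, $$\sum_{Q\le q\le2Q}\ \sum_{\chi\in\mathcal{F}_q}\Big|\sum_{n\le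 X}\lambda_F(n)\chi(n)\Big|^2\ll_F\frac{X^2}{\log^{\eta}X}.$$
   Context: Framework. $L(s,F)=\sum_{n\ge1}\lambda_F(n)n^{-s}=\prod_p\prod_{j=1}^d(1-\alpha_{j,F}(p)p^{-s})^{-1}$ is a Dirichlet series with Euler product of degree $d$, both absolutely convergent for $\Re(s)>1$; $\lambda_F$ is multiplicative with $\lambda_F(p^r)=\sum_{r_1,\dots,r_d\ge0,\ r_1+\cdots+r_d=r}\prod_{j=1}^d\alpha_{j,F}(p)^{r_j}$. For $q\ge2$ and a primitive Dirichlet character $\chi$ modulo $q$, $$L(s,F\times\chi)=\sum_{n\ge1}\frac{\lambda_F(n)\chi(n)}{n^s}=\prod_p\prod_{j=1}^d\Big(1-\frac{\alpha_{j,F}(p)\chi(p)}{p^s}\Big)^{-1},$$ both absolutely convergent for $\Re(s)>1$. Put $L_\infty(s,F\times\chi)=N^{s/2}\prod_{j=1}^d\Gamma_{\mathbb R}(s+\mu_j)$ with $\Gamma_{\mathbb R}(s)=\pi^{-s/2}\Gamma(s/2)$, where the conductor $N$ (a positive integer) depends only on $F$ and $q$, and the $\mu_j\in\mathbb C$ depend only on $F$ and $\chi(-1)$ and satisfy $\Re(\mu_j)\ge-1+\theta_F$ for some fixed $\theta_F$ with $\frac1{2d}<\theta_F<\frac12$. Let $\Lambda(s,F\times\chi)=L(s,F\times\chi)L_\infty(s,F\times\chi)$. It is assumed that: (1) $\Lambda(s,F\times\chi)$ extends to an entire function of order 1; (2) $\Lambda(s,F\times\chi)=\kappa\,\Lambda(1-s,\tilde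 F\times\overline\chi)$ for some $\kappa=\kappa_{F,\chi}$ with $|\kappa|=1$, where $\tilde F$ is the dual form with $\lambda_{\tilde F}(n)=\overline{\lambda_F(n)}$ (its completed $L$-function is formed in the same way, with the same $N$ and with parameters $\overline{\mu_j}$); (3) with the analytic conductor $C(s,F\times\chi)=N\prod_{j=1}^d(|s+\mu_j+3|)$ and $C(F\times\chi)=C(\frac12,F\times\chi)$, one has $C(F\times\chi)\ll_F N\ll_F q^d$ for large $q$. Notation. $\tau_d$ is the $d$-fold divisor function, $p$ denotes a prime, $\log^a x=(\log x)^a$, and $\varepsilon>0$ is an arbitrarily small fixed number. The condition $\log^{100}q\ll T\ll q^{o(1)}$ refers to functions $T=T(q)$ with $T\gg\log^{100}q$ and $\log T\leq o(\log q)$ as $q\to\infty$. $F$ (and $d,\beta,\eta,\varepsilon$) are fixed, all constants in the hypotheses are uniform in $q$, $Q$ and $\chi$, and the implied constants in the conclusions depend on $F$, the fixed parameters and the constants in $\log X\asymp\log q$ (resp. $\log X\asymp\log Q$) but not on $q$, $Q$, $X$. *)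

theory Defs
  imports "HOL-Complex_Analysis.Complex_Analysis" "HOL-Library.Landau_Symbols"
begin

text \<open>
  Characters are functions on the integers, so that the parity is literally the value at
  \<open>-1\<close>.
\<close>

definition dirichlet_char :: "nat \<Rightarrow> (int \<Rightarrow> complex) \<Rightarrow> bool" where
  "dirichlet_char q chi \<longleftrightarrow>
     (\<forall>a b. chi (a * b) = chi a * chi b) \<and>
     (\<forall>a. chi (a + int q) = chi a) \<and>
     (\<forall>a. chi a \<noteq> 0 \<longleftrightarrow> coprime a (int q))"

text \<open>
  Primitive: for no proper divisor \<open>m\<close> of \<open>q\<close> is \<open>chi\<close> trivial on all units that are
  congruent to 1 modulo \<open>m\<close>, i.e. \<open>chi\<close> is not induced from a smaller modulus.
\<close>

definition primitive_dirichlet_char :: "nat \<Rightarrow> (int \<Rightarrow> complex) \<Rightarrow> bool" where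
  "primitive_dirichlet_char q chi \<longleftrightarrow> dirichlet_char q chi \<and>
     (\<forall>m. m dvd q \<and> m < q \<longrightarrow>
        (\<exists>a. coprime a (int q) \<and> a mod int m = 1 mod int m \<and> chi a \<noteq> 1))"

text \<open>For \<open>n \<ge> 1\<close>, the number of ordered factorisations of \<open>n\<close> into \<open>d\<close> positive factors.\<close>

definition divisor_tau :: "nat \<Rightarrow> nat \<Rightarrow> nat" where
  "divisor_tau d n = card {ms :: nat list. length ms = d \<and> prod_list ms = n}"

definition dirichlet_series :: "(nat \<Rightarrow> complex) \<Rightarrow> complex \<Rightarrow> complex" where
  "dirichlet_series a s = (\<Sum>\<^sub>\<infinity>n\<in>{1..}. a n / of_nat n powr s)"

definition local_factor :: "nat \<Rightarrow> (nat \<Rightarrow> nat \<Rightarrow> complex) \<Rightarrow> complex \<Rightarrow> nat \<Rightarrow> complex" where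
  "local_factor d \<alpha> s p =
     (if prime p then (\<Prod>j<d. inverse (1 - \<alpha> j p / of_nat p powr s)) else 1)"

text \<open>
  The Dirichlet series with coefficients \<open>a\<close> and the Euler product with parameters
  \<open>\<alpha> j p\<close> (\<open>j < d\<close>, \<open>p\<close> prime) converge absolutely and agree for \<open>Re s > 1\<close>.
\<close>

definition has_euler_product :: "nat \<Rightarrow> (nat \<Rightarrow> complex) \<Rightarrow> (nat \<Rightarrow> nat \<Rightarrow> complex) \<Rightarrow> bool" where
  "has_euler_product d a \<alpha> \<longleftrightarrow> (\<forall>s. Re s > 1 \<longrightarrow>
     (\<lambda>n. norm (a n / of_nat n powr s)) summable_on {1..} \<and>
     (\<forall>p j. prime p \<and> j < d \<longrightarrow> 1 - \<alpha> j p / of_nat p powr s \<noteq> 0) \<and>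
     abs_convergent_prod (local_factor d \<alpha> s) \<and>
     dirichlet_series a s = prodinf (local_factor d \<alpha> s))"

definition is_entire_extension :: "(complex \<Rightarrow> complex) \<Rightarrow> (complex \<Rightarrow> complex) \<Rightarrow> bool" where
  "is_entire_extension f g \<longleftrightarrow> g holomorphic_on UNIV \<and> (\<forall>s. Re s > 1 \<longrightarrow> g s = f s)"

text \<open>The entire continuation of \<open>f\<close> from \<open>Re s > 1\<close>; unspecified if there is none.\<close>

definition entire_extension :: "(complex \<Rightarrow> complex) \<Rightarrow> complex \<Rightarrow> complex" where
  "entire_extension f = (THE g. is_entire_extension f g)"

lemma is_entire_extension_unique:
  assumes "is_entire_extension f g" "is_entire_extension f h"
  shows "g = h"
proof
  fix z :: complex
  have "2 islimpt {s. Re s > 1}"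
    by (rule interior_limit_point) (simp add: interior_open open_halfspace_Re_gt)
  then have "(\<lambda>s. g s - h s) z = 0"
    using assms unfolding is_entire_extension_def
    by (intro analytic_continuation[of "\<lambda>s. g s - h s" UNIV "{s. Re s > 1}" 2 z])
       (auto intro!: holomorphic_intros)
  then show "g z = h z" by simp
qed

lemma entire_extension_eqI: "is_entire_extension f g \<Longrightarrow> entire_extension f = g"
  unfolding entire_extension_def by (blast intro: is_entire_extension_unique)

text \<open>The order of growth of an entire function (infinite if no exponent is admissible).\<close>

definition entire_order :: "(complex \<Rightarrow> complex) \<Rightarrow> ereal" where
  "entire_order f = Inf {ereal a | a. 0 \<le> a \<and>
     f \<in> O[at_infinity](\<lambda>z. of_real (exp (norm z powr a)))}"

definition Gamma_R :: "complex \<Rightarrow> complex" where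
  "Gamma_R s = of_real pi powr (- s / 2) * Gamma (s / 2)"

definition L_inf :: "nat \<Rightarrow> nat \<Rightarrow> (nat \<Rightarrow> complex) \<Rightarrow> complex \<Rightarrow> complex" where
  "L_inf d N \<mu> s = of_nat N powr (s / 2) * (\<Prod>j<d. Gamma_R (s + \<mu> j))"

definition twist :: "(nat \<Rightarrow> complex) \<Rightarrow> (int \<Rightarrow> complex) \<Rightarrow> nat \<Rightarrow> complex" where
  "twist lam chi n = lam n * chi (int n)"

definition L_twist :: "(nat \<Rightarrow> complex) \<Rightarrow> (int \<Rightarrow> complex) \<Rightarrow> complex \<Rightarrow> complex" where
  "L_twist lam chi = entire_extension (dirichlet_series (twist lam chi))"

definition Lambda_series ::
    "nat \<Rightarrow> nat \<Rightarrow> (nat \<Rightarrow> complex) \<Rightarrow> (nat \<Rightarrow> complex) \<Rightarrow> (int \<Rightarrow> complex) \<Rightarrow> complex \<Rightarrow> complex" where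
  "Lambda_series d N \<mu> lam chi s = dirichlet_series (twist lam chi) s * L_inf d N \<mu> s"

definition Lambda_twist ::
    "nat \<Rightarrow> nat \<Rightarrow> (nat \<Rightarrow> complex) \<Rightarrow> (nat \<Rightarrow> complex) \<Rightarrow> (int \<Rightarrow> complex) \<Rightarrow> complex \<Rightarrow> complex" where
  "Lambda_twist d N \<mu> lam chi = entire_extension (Lambda_series d N \<mu> lam chi)"

definition analytic_conductor :: "nat \<Rightarrow> nat \<Rightarrow> (nat \<Rightarrow> complex) \<Rightarrow> complex \<Rightarrow> real" where
  "analytic_conductor d N \<mu> s = real N * (\<Prod>j<d. cmod (s + \<mu> j + 3))"

text \<open>
  The data of \<open>F\<close>: degree, Dirichlet coefficients, Euler parameters \<open>\<alpha> j p\<close>, the conductor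
  \<open>N q\<close> of the twists modulo \<open>q\<close>, and the parameters \<open>\<mu> (chi (-1)) j\<close> of the gamma factors,
  which depend on \<open>chi\<close> only through its parity.
\<close>

locale twisted_L_framework =
  fixes d :: nat
    and lam :: "nat \<Rightarrow> complex"
    and \<alpha> :: "nat \<Rightarrow> nat \<Rightarrow> complex"
    and N :: "nat \<Rightarrow> nat"
    and \<mu> :: "complex \<Rightarrow> nat \<Rightarrow> complex"
    and \<theta> :: real
  assumes multiplicative:
      "\<And>m n. 1 \<le> m \<Longrightarrow> 1 \<le> n \<Longrightarrow> coprime m n \<Longrightarrow> lam (m * n) = lam m * lam n"
    and prime_powers:
      "\<And>p r. prime p \<Longrightarrow>
         lam (p ^ r) = (\<Sum>rs | length rs = d \<and> sum_list rs = r. \<Prod>j<d. \<alpha> j p ^ (rs ! j))"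
    and euler_product: "has_euler_product d lam \<alpha>"
    and euler_product_twist:
      "\<And>q chi. 2 \<le> q \<Longrightarrow> primitive_dirichlet_char q chi \<Longrightarrow>
         has_euler_product d (twist lam chi) (\<lambda>j p. \<alpha> j p * chi (int p))"
    and conductor_pos: "\<And>q. 2 \<le> q \<Longrightarrow> 1 \<le> N q"
    and theta_bounds: "1 / (2 * real d) < \<theta>" "\<theta> < 1 / 2"
    and mu_bound:
      "\<And>q chi j. 2 \<le> q \<Longrightarrow> primitive_dirichlet_char q chi \<Longrightarrow> j < d \<Longrightarrow>
         Re (\<mu> (chi (-1)) j) \<ge> - 1 + \<theta>"
    and entire:
      "\<And>q chi. 2 \<le> q \<Longrightarrow> primitive_dirichlet_char q chi \<Longrightarrow>
         (\<exists>g. is_entire_extension (Lambda_series d (N q) (\<mu> (chi (-1))) lam chi) g) \<and>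
         entire_order (Lambda_twist d (N q) (\<mu> (chi (-1))) lam chi) = 1"
    and functional_equation:
      "\<And>q chi. 2 \<le> q \<Longrightarrow> primitive_dirichlet_char q chi \<Longrightarrow>
         \<exists>\<kappa>. cmod \<kappa> = 1 \<and> (\<forall>s.
           Lambda_twist d (N q) (\<mu> (chi (-1))) lam chi s =
           \<kappa> * Lambda_twist d (N q) (\<lambda>j. cnj (\<mu> (chi (-1)) j))
                 (\<lambda>n. cnj (lam n)) (\<lambda>a. cnj (chi a)) (1 - s))"
    and conductor_bound:
      "\<exists>A B. \<forall>\<^sub>F q in sequentially. \<forall>chi. primitive_dirichlet_char q chi \<longrightarrow>
         analytic_conductor d (N q) (\<mu> (chi (-1))) (1 / 2) \<le> A * real (N q) \<and>
         real (N q) \<le> B * real q ^ d"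

text \<open>The condition \<open>log^100 q << T << q^o(1)\<close> on a function \<open>T = T(q)\<close>.\<close>

definition admissible_height :: "(nat \<Rightarrow> real) \<Rightarrow> bool" where
  "admissible_height T \<longleftrightarrow>
     (\<forall>\<^sub>F q in sequentially. T q > 0) \<and>
     (\<lambda>q. ln (real q) ^ 100) \<in> O(T) \<and>
     (\<lambda>q. ln (T q)) \<in> o(\<lambda>q. ln (real q))"

text \<open>
  The zero-free region for the moduli in \<open>S\<close>, with one constant \<open>c\<close> for all of them. As the
  condition on \<open>T\<close> is asymptotic in \<open>q\<close>, the region is required for all sufficiently large
  \<open>q \<in> S\<close>, where the threshold may depend on \<open>T\<close>. For functions \<open>T\<close> chosen arbitrarily this
  is uniform in \<open>q\<close>: it amounts to a threshold depending only on the implied constants in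
  the condition on \<open>T\<close>.
\<close>

definition zero_free_hypothesis ::
    "(nat \<Rightarrow> complex) \<Rightarrow> real \<Rightarrow> (nat \<Rightarrow> (int \<Rightarrow> complex) set) \<Rightarrow> nat set \<Rightarrow> bool" where
  "zero_free_hypothesis lam \<beta> Fam S \<longleftrightarrow>
     (\<exists>c>0. \<forall>T. admissible_height T \<longrightarrow>
        (\<forall>\<^sub>F q in sequentially. q \<in> S \<longrightarrow>
           (\<forall>\<sigma> t. \<sigma> > 1 - c / ln (real q * T q) powr \<beta> \<and> \<bar>t\<bar> \<le> T q \<longrightarrow>
              (\<Prod>chi\<in>Fam q. L_twist lam chi (Complex \<sigma> t)) \<noteq> 0)))"

end

theory Submission
  imports Defs "HOL-Number_Theory.Number_Theory" "HOL-Real_Asymp.Real_Asymp"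
begin

text \<open>
  Let \<open>l = ln Q\<close> and \<open>\<beta> < \<gamma> \<le> 1 - \<eta>\<close>. By (A3) the integers without a prime factor in
  \<open>[exp (l powr \<gamma>), Q powr \<epsilon> / 2]\<close> carry a proportion \<open>O(l powr (\<gamma> - 1))\<close> of the mean square of
  \<open>\<lambda>\<^sub>F\<close>. For the others, Ramare's identity extracts such a prime factor \<open>p\<close>. With \<open>p\<close> confined to short
  geometric cells (whose boundary effect is controlled by (A2)), the sum becomes \<open>O(l\<^sup>2)\<close> products of a
  sum over primes and a sum over cofactors. The cofactors are still longer than the conductor, so the
  multiplicative large sieve is sharp for them, while each sum over primes is bounded pointwise.

  That pointwise saving of a power of \<open>l\<close> comes from the zero-free region: the functional equation and
  \<open>\<Gamma>(z + 1) = z \<Gamma>(z)\<close> with Phragmen-Lindelof give a convexity bound, Borel-Caratheodory turns it into a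
  bound for the logarithm of the \<open>L\<close>-function, and Newman's contour argument transfers this bound to
  the partial sums of its coefficients.
\<close>

section \<open>The multiplicative large sieve\<close>

text \<open>A zero-free region of width r0 about \<open>l powr - \<beta>\<close> makes
  \<open>k powr - r0\<close> as small as \<open>exp (- c * l powr (\<gamma> - \<beta>))\<close> once
  k \<ge> \<open>exp (l powr \<gamma>)\<close>, which beats every power of \<open>l\<close>. Hence
  \<open>\<gamma>\<close> has to exceed \<open>\<beta>\<close>, and this is what confines
  \<open>\<eta>\<close> to values below \<open>1 - \<beta>\<close>. The other error of the contour
  argument is about 1/T; with T = log^100 q it is still a large negative power of \<open>l\<close>.
  The cells have ratio \<open>1 + 1 / l\<close>, and Cauchy-Schwarz over them costs
  \<open>l ^ 4\<close>; a saving of \<open>l powr (-10)\<close> in each prime sum leaves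
  \<open>l powr (-16)\<close>.

  Both assertions are instances of one estimate for a finite set of moduli, in which
  \<open>D\<close> bounds all least common multiples: \<open>D\<close> is \<open>q\<close> for a
  single modulus and about \<open>4 * Q\<^sup>2\<close> for a dyadic range, whence the exponents 1
  and 2 in the two ranges of \<open>X\<close>. For bounded moduli \<open>X\<close> is bounded as
  well, and the constant absorbs everything.\<close>

lemma l2_duality:
  fixes x :: "'a \<Rightarrow> 'b \<Rightarrow> complex"
  assumes D: "D \<ge> 0"
    and dual: "\<And>c. (\<Sum>n\<in>B. (cmod (\<Sum>r\<in>A. c r * x r n))\<^sup>2) \<le> D * (\<Sum>r\<in>A. (cmod (c r))\<^sup>2)"
  shows "(\<Sum>r\<in>A. (cmod (\<Sum>n\<in>B. b n * x r n))\<^sup>2) \<le> D * (\<Sum>n\<in>B. (cmod (b n))\<^sup>2)"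
proof -
  define V where "V r = (\<Sum>n\<in>B. b n * x r n)" for r
  \<comment> \<open>The transposed form at the coefficients \<open>cnj (V r)\<close>: the left side
    \<open>s\<close> equals the pairing of \<open>b\<close> with \<open>Y\<close>, so Cauchy-Schwarz
    and the dual bound give s^2 \<le> t * D * s.\<close>
  define Y where "Y n = (\<Sum>r\<in>A. cnj (V r) * x r n)" for n
  define s where "s = (\<Sum>r\<in>A. (cmod (V r))\<^sup>2)"
  define t where "t = (\<Sum>n\<in>B. (cmod (b n))\<^sup>2)"
  have s0: "s \<ge> 0" and t0: "t \<ge> 0" by (auto simp: s_def t_def sum_nonneg)
  have "cnj (V r) * V r = of_real ((cmod (V r))\<^sup>2)" for r
    by (subst mult.commute) (simp add: complex_mult_cnj cmod_power2)
  then have "of_real s = (\<Sum>r\<in>A. cnj (V r) * V r)"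
    by (simp add: s_def)
  also have "\<dots> = (\<Sum>r\<in>A. \<Sum>n\<in>B. b n * (cnj (V r) * x r n))"
    by (intro sum.cong refl, subst (2) V_def, subst sum_distrib_left) (simp add: mult_ac)
  also have "\<dots> = (\<Sum>n\<in>B. b n * Y n)"
    by (subst sum.swap) (simp add: Y_def sum_distrib_left)
  finally have "s = cmod (\<Sum>n\<in>B. b n * Y n)"
    using s0 by (metis abs_of_nonneg norm_of_real)
  also have "\<dots> \<le> (\<Sum>n\<in>B. cmod (b n) * cmod (Y n))"
    using norm_sum[of "\<lambda>n. b n * Y n" B] by (simp add: norm_mult)
  finally have "s\<^sup>2 \<le> (\<Sum>n\<in>B. cmod (b n) * cmod (Y n))\<^sup>2"
    using s0 by (intro power_mono)
  also have "\<dots> \<le> t * (\<Sum>n\<in>B. (cmod (Y n))\<^sup>2)"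
    unfolding t_def by (rule Cauchy_Schwarz_ineq_sum)
  also have "\<dots> \<le> t * (D * s)"
    using dual[of "\<lambda>r. cnj (V r)"] t0 by (intro mult_left_mono) (auto simp: Y_def s_def)
  finally have "s * s \<le> (D * t) * s" by (simp add: power2_eq_square mult_ac)
  then have "s \<le> D * t"
    using s0 t0 D by (cases "s = 0") auto
  then show ?thesis by (simp add: s_def t_def V_def)
qed

section \<open>Exponential sums and the additive large sieve\<close>

lemma abs_sin_pi_ge:
  fixes t :: real
  assumes "\<bar>t\<bar> \<le> 1/2"
  shows "\<bar>sin (pi * t)\<bar> \<ge> 2 * \<bar>t\<bar>"
proof -
  \<comment> \<open>Jordan's inequality: concavity puts the sine above its chord from 0 to pi/2,
    read at the parameter 2|t|.\<close>
  have "concave_on {0..pi} (sin :: real \<Rightarrow> real)"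
    by (rule f''_le0_imp_concave[of _ _ cos "\<lambda>x. - sin x"])
       (auto intro!: derivative_eq_intros sin_ge_zero)
  from concave_onD[OF this, of "2 * \<bar>t\<bar>" 0 "pi/2"] assms
  have "sin (pi * \<bar>t\<bar>) \<ge> 2 * \<bar>t\<bar>" by (simp add: mult_ac)
  then show ?thesis by (cases "t \<ge> 0") auto
qed

lemma cmod_cis_minus_1: "cmod (cis (2 * x) - 1) = 2 * \<bar>sin x\<bar>"
proof -
  have "cis (2 * x) - 1 = 2 * \<i> * of_real (sin x) * cis x"
    by (simp add: complex_eq_iff cos_double_sin sin_double power2_eq_square)
  then show ?thesis by (simp add: norm_mult)
qed

definition exp_sum :: "nat \<Rightarrow> real \<Rightarrow> complex" where
  "exp_sum n t = (\<Sum>u<n. cis (2 * pi * real u * t))"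

lemma exp_sum_periodic: "exp_sum n (t + of_int k) = exp_sum n t"
proof -
  have "cis (2 * pi * real u * (t + of_int k)) = cis (2 * pi * real u * t)" for u
  proof -
    have "cis (2 * pi * real u * (t + of_int k))
        = cis (2 * pi * real u * t) * cis (2 * pi * of_int (int u * k))"
      by (simp add: cis_mult algebra_simps)
    also have "cis (2 * pi * of_int (int u * k)) = 1"
      by (rule cis_multiple_2pi) auto
    finally show ?thesis by simp
  qed
  then show ?thesis by (simp add: exp_sum_def)
qed

lemma cmod_exp_sum_le: "cmod (exp_sum n t) \<le> real n"
  unfolding exp_sum_def using norm_sum[of "\<lambda>u. cis (2 * pi * real u * t)" "{..<n}"] by simp

lemma cmod_exp_sum_minus: "cmod (exp_sum n (- t)) = cmod (exp_sum n t)"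
proof -
  have "exp_sum n (- t) = cnj (exp_sum n t)"
    by (simp add: exp_sum_def cis_cnj)
  then show ?thesis by simp
qed

text \<open>A geometric sum with a ratio z of modulus 1: the numerator is at most 2 in modulus, and
  |z - 1| is at least 4|t|.\<close>

lemma cmod_exp_sum_bound:
  assumes "\<bar>t\<bar> \<le> 1/2" "t \<noteq> 0"
  shows "(cmod (exp_sum n t))\<^sup>2 \<le> 1 / (4 * t\<^sup>2)"
proof -
  let ?z = "cis (2 * (pi * t))"
  have "exp_sum n t = (\<Sum>u<n. ?z ^ u)"
    unfolding exp_sum_def by (intro sum.cong refl) (simp add: Complex.DeMoivre algebra_simps)
  then have "(?z - 1) * exp_sum n t = ?z ^ n - 1"
    using power_diff_1_eq[of ?z n] by simp
  then have "cmod (?z - 1) * cmod (exp_sum n t) = cmod (?z ^ n - 1)"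
    by (metis norm_mult)
  also have "\<dots> \<le> 2"
    using norm_triangle_ineq4[of "?z ^ n" 1] by (simp add: norm_power)
  finally have *: "2 * \<bar>sin (pi * t)\<bar> * cmod (exp_sum n t) \<le> 2"
    by (simp add: cmod_cis_minus_1)
  have "2 * \<bar>t\<bar> * cmod (exp_sum n t) \<le> \<bar>sin (pi * t)\<bar> * cmod (exp_sum n t)"
    using abs_sin_pi_ge[OF assms(1)] by (intro mult_right_mono) auto
  also have "\<dots> \<le> 1" using * by simp
  finally have "(2 * \<bar>t\<bar> * cmod (exp_sum n t))\<^sup>2 \<le> 1\<^sup>2"
    by (intro power_mono) auto
  then show ?thesis using assms by (simp add: power_mult_distrib field_simps)
qed

lemma sum_inverse_squares_le: "(\<Sum>k=1..n. 1 / (real k)\<^sup>2) \<le> 2"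
proof (cases "n = 0")
  case False
  then have "n \<ge> 1" by simp
  \<comment> \<open>The sharper bound 2 - 1/n is what the induction can carry.\<close>
  then have "(\<Sum>k=1..n. 1 / (real k)\<^sup>2) \<le> 2 - 1 / real n"
  proof (induction n rule: nat_induct_at_least)
    case (Suc n)
    have "1 / (real (Suc n))\<^sup>2 \<le> 1 / real n - 1 / real (Suc n)"
      using Suc(1) by (simp add: divide_simps power2_eq_square)
    moreover have "(\<Sum>k=1..Suc n. 1 / (real k)\<^sup>2) = (\<Sum>k=1..n. 1 / (real k)\<^sup>2) + 1 / (real (Suc n))\<^sup>2"
      by simp
    ultimately show ?case using Suc by linarith
  qed auto
  then show ?thesis by (smt (verit) divide_nonneg_nonneg of_nat_0_le_iff)
qed auto

text \<open>Modulo 1 the points are \<delta>-separated, so each cell of length \<delta> holds at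
  most one of them. The two cells that touch 0 get the trivial bound (2N)^2 each, the others the
  geometric-sum bound, whose total is at most 1/\<delta>^2 \<le> N^2. This makes 9 N^2, and 10 is a
  round value.\<close>

lemma sum_exp_sum_squares_le:
  fixes \<alpha> :: "'r \<Rightarrow> real"
  assumes fin: "finite R" and \<delta>: "\<delta> > 0" and N: "real N * \<delta> \<ge> 1"
    and sep: "\<And>r s k. r \<in> R \<Longrightarrow> s \<in> R \<Longrightarrow> r \<noteq> s \<Longrightarrow> \<bar>\<alpha> r - \<alpha> s - of_int k\<bar> \<ge> \<delta>"
  shows "(\<Sum>s\<in>R. (cmod (exp_sum (2 * N) (\<alpha> s - x)))\<^sup>2) \<le> 10 * (real N)\<^sup>2"
proof -
  define t where "t s = \<alpha> s - x - of_int \<lfloor>\<alpha> s - x + 1/2\<rfloor>" for s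
  have t_bd: "\<bar>t s\<bar> \<le> 1/2" for s
    unfolding t_def by linarith
  have exp_t: "exp_sum (2 * N) (\<alpha> s - x) = exp_sum (2 * N) (t s)" for s
    using exp_sum_periodic[of "2 * N" "t s" "\<lfloor>\<alpha> s - x + 1/2\<rfloor>"] by (simp add: t_def)
  define k where "k s = \<lfloor>t s / \<delta>\<rfloor>" for s
  \<comment> \<open>Cell m consists of the t in [m \<delta>, (m + 1) \<delta>); for m \<le> -2 its
    distance from 0 is (- m - 1) \<delta>, which shifts the index by one.\<close>
  define w :: "int \<Rightarrow> real" where
    "w m = (if m = 0 \<or> m = -1 then 4 * (real N)\<^sup>2
            else if m \<ge> 1 then 1 / (4 * \<delta>\<^sup>2 * (of_int m)\<^sup>2) else 1 / (4 * \<delta>\<^sup>2 * (of_int (- m - 1))\<^sup>2))" for m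
  have w0: "w m \<ge> 0" for m by (simp add: w_def)
  have k_le: "of_int (k s) * \<delta> \<le> t s" "t s < (of_int (k s) + 1) * \<delta>" for s
  proof -
    have "of_int (k s) \<le> t s / \<delta>" "t s / \<delta> < of_int (k s) + 1"
      unfolding k_def by linarith+
    then show "of_int (k s) * \<delta> \<le> t s" "t s < (of_int (k s) + 1) * \<delta>"
      using \<delta> by (simp_all only: pos_le_divide_eq pos_divide_less_eq)
  qed
  have inj: "inj_on k R"
  proof (rule inj_onI, rule ccontr)
    fix r s assume rs: "r \<in> R" "s \<in> R" "k r = k s" "r \<noteq> s"
    have "\<bar>t r - t s\<bar> < \<delta>"
      using k_le[of r] k_le[of s] rs(3) by (simp add: algebra_simps abs_less_iff)
    moreover have "t r - t s = \<alpha> r - \<alpha> s - of_int (\<lfloor>\<alpha> r - x + 1/2\<rfloor> - \<lfloor>\<alpha> s - x + 1/2\<rfloor>)"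
      by (simp add: t_def)
    ultimately show False using sep[OF rs(1,2,4)] by (metis not_less)
  qed
  have bound: "(cmod (exp_sum (2 * N) (t s)))\<^sup>2 \<le> w (k s)" for s
  proof -
    consider "k s = 0 \<or> k s = -1" | "k s \<ge> 1" | "k s \<le> -2" by linarith
    then show ?thesis
    proof cases
      case 1
      have "(cmod (exp_sum (2 * N) (t s)))\<^sup>2 \<le> (real (2 * N))\<^sup>2"
        by (intro power_mono cmod_exp_sum_le) auto
      then show ?thesis using 1 by (auto simp: w_def power2_eq_square)
    next
      case 2
      have pos: "0 < of_int (k s) * \<delta>" using 2 \<delta> by simp
      have "(of_int (k s) * \<delta>)\<^sup>2 \<le> (t s)\<^sup>2" using k_le(1)[of s] pos by (intro power_mono) auto
      then have "1 / (4 * (t s)\<^sup>2) \<le> 1 / (4 * (of_int (k s) * \<delta>)\<^sup>2)"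
        using pos by (intro frac_le) auto
      moreover have "t s \<noteq> 0" using k_le(1)[of s] pos by auto
      ultimately show ?thesis using cmod_exp_sum_bound[OF t_bd, of s "2 * N"] 2
        by (simp add: w_def power_mult_distrib mult_ac del: of_int_power)
    next
      case 3
      have pos: "0 < of_int (- k s - 1) * \<delta>" using 3 \<delta> by simp
      have le: "of_int (- k s - 1) * \<delta> \<le> - t s" using k_le(2)[of s] by (simp add: algebra_simps)
      then have "(of_int (- k s - 1) * \<delta>)\<^sup>2 \<le> (- t s)\<^sup>2" using pos by (intro power_mono) auto
      then have "1 / (4 * (t s)\<^sup>2) \<le> 1 / (4 * (of_int (- k s - 1) * \<delta>)\<^sup>2)"
        using pos by (intro frac_le) auto
      moreover have "t s \<noteq> 0" using le pos by auto
      ultimately show ?thesis using cmod_exp_sum_bound[OF t_bd, of s "2 * N"] 3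
        by (simp add: w_def power_mult_distrib mult_ac)
    qed
  qed
  define M where "M = nat (Max ((\<lambda>s. \<bar>k s\<bar>) ` R \<union> {0}))"
  have kM: "k s \<in> {- int M..int M}" if "s \<in> R" for s
  proof -
    have "\<bar>k s\<bar> \<le> Max ((\<lambda>s. \<bar>k s\<bar>) ` R \<union> {0})" using that fin by (intro Max_ge) auto
    then show ?thesis unfolding M_def by auto
  qed
  define c where "c = 1 / (4 * \<delta>\<^sup>2)"
  have c0: "c \<ge> 0" by (simp add: c_def)
  have "(\<Sum>s\<in>R. (cmod (exp_sum (2 * N) (\<alpha> s - x)))\<^sup>2) \<le> (\<Sum>s\<in>R. w (k s))"
    by (intro sum_mono) (simp add: exp_t bound)
  also have "\<dots> = sum w (k ` R)" by (simp add: sum.reindex inj)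
  also have "\<dots> \<le> sum w ({0,-1} \<union> (int ` {1..M}) \<union> ((\<lambda>m. - int m - 1) ` {1..M}))"
  proof (rule sum_mono2)
    show "k ` R \<subseteq> {0,-1} \<union> (int ` {1..M}) \<union> ((\<lambda>m. - int m - 1) ` {1..M})"
    proof
      fix z assume "z \<in> k ` R"
      then have z: "z \<in> {- int M..int M}" using kM by auto
      consider "z = 0 \<or> z = -1" | "z \<ge> 1" | "z \<le> -2" by linarith
      then show "z \<in> {0,-1} \<union> (int ` {1..M}) \<union> ((\<lambda>m. - int m - 1) ` {1..M})"
      proof cases
        case 2
        then have "z = int (nat z)" "nat z \<in> {1..M}" using z by auto
        then show ?thesis by blast
      next
        case 3
        then have "z = - int (nat (- z - 1)) - 1" "nat (- z - 1) \<in> {1..M}" using z by auto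
        then show ?thesis by blast
      qed auto
    qed
  qed (auto simp: w0)
  also have "\<dots> \<le> sum w {0,-1} + sum w (int ` {1..M}) + sum w ((\<lambda>m. - int m - 1) ` {1..M})"
    by (subst sum.union_disjoint, simp, simp, force)+ simp
  also have "sum w {0,-1} = 8 * (real N)\<^sup>2" by (simp add: w_def)
  also have "sum w (int ` {1..M}) = (\<Sum>m=1..M. c * (1 / (real m)\<^sup>2))"
    by (subst sum.reindex) (auto simp: inj_on_def w_def c_def intro!: sum.cong)
  also have "sum w ((\<lambda>m. - int m - 1) ` {1..M}) = (\<Sum>m=1..M. c * (1 / (real m)\<^sup>2))"
    by (subst sum.reindex) (auto simp: inj_on_def w_def c_def intro!: sum.cong)
  also have "8 * (real N)\<^sup>2 + (\<Sum>m=1..M. c * (1 / (real m)\<^sup>2)) + (\<Sum>m=1..M. c * (1 / (real m)\<^sup>2))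
    \<le> 8 * (real N)\<^sup>2 + c * 2 + c * 2"
    unfolding sum_distrib_left[symmetric]
    by (intro add_mono order.refl mult_left_mono sum_inverse_squares_le c0)
  also have "8 * (real N)\<^sup>2 + c * 2 + c * 2 \<le> 10 * (real N)\<^sup>2"
  proof -
    have "1\<^sup>2 \<le> (real N * \<delta>)\<^sup>2" using N by (intro power_mono) auto
    then have "c \<le> (real N)\<^sup>2 / 4" using \<delta> by (simp add: c_def power_mult_distrib field_simps)
    then show ?thesis using zero_le_power2[of "real N"] by linarith
  qed
  finally show ?thesis .
qed

text \<open>By duality it suffices to bound the mean square of \<open>A\<close> over 1..N. Averaging
  over differences u - v replaces the sharp cut-off by a Fejer kernel, the squared exponential sum
  \<open>e r s\<close>, whose rows are summed by \<open>sum_exp_sum_squares_le\<close>.\<close>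

lemma additive_large_sieve:
  fixes \<alpha> :: "'r \<Rightarrow> real"
  assumes fin: "finite R" and \<delta>: "\<delta> > 0" and N: "real N * \<delta> \<ge> 1"
    and sep: "\<And>r s k. r \<in> R \<Longrightarrow> s \<in> R \<Longrightarrow> r \<noteq> s \<Longrightarrow> \<bar>\<alpha> r - \<alpha> s - of_int k\<bar> \<ge> \<delta>"
  shows "(\<Sum>r\<in>R. (cmod (\<Sum>n=1..N. b n * cis (2 * pi * real n * \<alpha> r)))\<^sup>2)
           \<le> 10 * real N * (\<Sum>n=1..N. (cmod (b n))\<^sup>2)"
proof (rule l2_duality)
  fix c :: "'r \<Rightarrow> complex"
  define A where "A z = (\<Sum>r\<in>R. c r * cis (2 * pi * z * \<alpha> r))" for z :: real
  define e where "e r s = (cmod (exp_sum (2 * N) (\<alpha> r - \<alpha> s)))\<^sup>2" for r s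
  have e0: "e r s \<ge> 0" for r s by (simp add: e_def)
  have N0: "N > 0" using N by (cases "N = 0") auto
  \<comment> \<open>Each n in 1..N is the difference u - v of the N pairs (n + v, v) with v < N, all
    of whose entries lie below 2N.\<close>
  have "real N * (\<Sum>n=1..N. (cmod (A (real n)))\<^sup>2)
      = (\<Sum>(n, v)\<in>{1..N} \<times> {..<N}. (cmod (A (real n)))\<^sup>2)"
    by (simp add: sum.cartesian_product[symmetric] sum_distrib_left)
  also have "\<dots> = (\<Sum>(u, v)\<in>(\<lambda>(n, v). (n + v, v)) ` ({1..N} \<times> {..<N}). (cmod (A (real u - real v)))\<^sup>2)"
    by (subst sum.reindex) (auto simp: inj_on_def intro!: sum.cong)
  also have "\<dots> \<le> (\<Sum>(u, v)\<in>{..<2*N} \<times> {..<2*N}. (cmod (A (real u - real v)))\<^sup>2)"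
    by (intro sum_mono2) auto
  finally have 1: "real N * (\<Sum>n=1..N. (cmod (A (real n)))\<^sup>2)
      \<le> (\<Sum>u<2*N. \<Sum>v<2*N. (cmod (A (real u - real v)))\<^sup>2)"
    by (simp add: sum.cartesian_product)
  have A2: "of_real ((cmod (A (real u - real v)))\<^sup>2) = (\<Sum>r\<in>R. \<Sum>s\<in>R. c r * cnj (c s) *
      (cis (2 * pi * real u * (\<alpha> r - \<alpha> s)) * cnj (cis (2 * pi * real v * (\<alpha> r - \<alpha> s)))))" for u v :: nat
  proof -
    have "of_real ((cmod (A (real u - real v)))\<^sup>2) = A (real u - real v) * cnj (A (real u - real v))"
      by (rule complex_norm_square)
    also have "\<dots> = (\<Sum>r\<in>R. \<Sum>s\<in>R. (c r * cis (2 * pi * (real u - real v) * \<alpha> r)) *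
        cnj (c s * cis (2 * pi * (real u - real v) * \<alpha> s)))"
      by (simp only: A_def cnj_sum sum_product)
    also have "\<dots> = (\<Sum>r\<in>R. \<Sum>s\<in>R. c r * cnj (c s) *
      (cis (2 * pi * real u * (\<alpha> r - \<alpha> s)) * cnj (cis (2 * pi * real v * (\<alpha> r - \<alpha> s)))))"
    proof (intro sum.cong refl)
      fix r s
      have "cis (2 * pi * (real u - real v) * \<alpha> r) * cis (- (2 * pi * (real u - real v) * \<alpha> s))
          = cis (2 * pi * real u * (\<alpha> r - \<alpha> s)) * cis (- (2 * pi * real v * (\<alpha> r - \<alpha> s)))"
        unfolding cis_mult by (rule arg_cong[of _ _ cis]) (simp add: algebra_simps)
      then show "(c r * cis (2 * pi * (real u - real v) * \<alpha> r)) *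
        cnj (c s * cis (2 * pi * (real u - real v) * \<alpha> s)) = c r * cnj (c s) *
      (cis (2 * pi * real u * (\<alpha> r - \<alpha> s)) * cnj (cis (2 * pi * real v * (\<alpha> r - \<alpha> s))))"
        by (simp add: cis_cnj mult_ac)
    qed
    finally show ?thesis .
  qed
  have E2: "(\<Sum>u<2*N. \<Sum>v<2*N. cis (2 * pi * real u * x) * cnj (cis (2 * pi * real v * x)))
      = of_real ((cmod (exp_sum (2 * N) x))\<^sup>2)" for x
    by (subst complex_norm_square) (simp only: exp_sum_def cnj_sum sum_product)
  have E2': "(\<Sum>u<2*N. cis (2 * pi * real u * x) * (\<Sum>v<2*N. cnj (cis (2 * pi * real v * x))))
      = of_real ((cmod (exp_sum (2 * N) x))\<^sup>2)" for x
    unfolding sum_distrib_left by (rule E2)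
  have "of_real (\<Sum>u<2*N. \<Sum>v<2*N. (cmod (A (real u - real v)))\<^sup>2)
     = (\<Sum>u<2*N. \<Sum>v<2*N. \<Sum>r\<in>R. \<Sum>s\<in>R. c r * cnj (c s) *
      (cis (2 * pi * real u * (\<alpha> r - \<alpha> s)) * cnj (cis (2 * pi * real v * (\<alpha> r - \<alpha> s)))))"
    by (simp only: of_real_sum A2)
  also have "\<dots> = (\<Sum>u<2*N. \<Sum>r\<in>R. \<Sum>v<2*N. \<Sum>s\<in>R. c r * cnj (c s) *
      (cis (2 * pi * real u * (\<alpha> r - \<alpha> s)) * cnj (cis (2 * pi * real v * (\<alpha> r - \<alpha> s)))))"
    by (intro sum.cong refl sum.swap)
  also have "\<dots> = (\<Sum>r\<in>R. \<Sum>u<2*N. \<Sum>v<2*N. \<Sum>s\<in>R. c r * cnj (c s) *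
      (cis (2 * pi * real u * (\<alpha> r - \<alpha> s)) * cnj (cis (2 * pi * real v * (\<alpha> r - \<alpha> s)))))"
    by (rule sum.swap)
  also have "\<dots> = (\<Sum>r\<in>R. \<Sum>u<2*N. \<Sum>s\<in>R. \<Sum>v<2*N. c r * cnj (c s) *
      (cis (2 * pi * real u * (\<alpha> r - \<alpha> s)) * cnj (cis (2 * pi * real v * (\<alpha> r - \<alpha> s)))))"
    by (intro sum.cong refl sum.swap)
  also have "\<dots> = (\<Sum>r\<in>R. \<Sum>s\<in>R. \<Sum>u<2*N. \<Sum>v<2*N. c r * cnj (c s) *
      (cis (2 * pi * real u * (\<alpha> r - \<alpha> s)) * cnj (cis (2 * pi * real v * (\<alpha> r - \<alpha> s)))))"
    by (intro sum.cong refl sum.swap)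
  also have "\<dots> = (\<Sum>r\<in>R. \<Sum>s\<in>R. c r * cnj (c s) * of_real (e r s))"
    by (simp only: sum_distrib_left[symmetric] E2' e_def)
  finally have "(\<Sum>u<2*N. \<Sum>v<2*N. (cmod (A (real u - real v)))\<^sup>2)
      = cmod (\<Sum>r\<in>R. \<Sum>s\<in>R. c r * cnj (c s) * of_real (e r s))"
    by (metis (mono_tags, lifting) abs_of_nonneg norm_of_real sum_nonneg zero_le_power2)
  also have "\<dots> \<le> (\<Sum>r\<in>R. \<Sum>s\<in>R. cmod (c r * cnj (c s) * of_real (e r s)))"
    by (intro order.trans[OF norm_sum] sum_mono) simp
  \<comment> \<open>Schur test: the product of two coefficients is split by 2xy \<le> x^2 + y^2, so
    that only row sums of the symmetric matrix \<open>e\<close> remain.\<close>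
  also have "\<dots> \<le> (\<Sum>r\<in>R. \<Sum>s\<in>R. (cmod (c r))\<^sup>2 * e r s / 2 + (cmod (c s))\<^sup>2 * e r s / 2)"
  proof (intro sum_mono)
    fix r s
    have "cmod (c r) * cmod (c s) \<le> ((cmod (c r))\<^sup>2 + (cmod (c s))\<^sup>2) / 2"
      using sum_squares_bound[of "cmod (c r)" "cmod (c s)"] by simp
    then have "(cmod (c r) * cmod (c s)) * e r s \<le> ((cmod (c r))\<^sup>2 + (cmod (c s))\<^sup>2) / 2 * e r s"
      by (intro mult_right_mono e0)
    then show "cmod (c r * cnj (c s) * of_real (e r s)) \<le> (cmod (c r))\<^sup>2 * e r s / 2 + (cmod (c s))\<^sup>2 * e r s / 2"
      using e0[of r s] by (simp add: norm_mult algebra_simps add_divide_distrib)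
  qed
  also have "\<dots> = (\<Sum>r\<in>R. (cmod (c r))\<^sup>2 / 2 * (\<Sum>s\<in>R. e r s)) + (\<Sum>s\<in>R. (cmod (c s))\<^sup>2 / 2 * (\<Sum>r\<in>R. e r s))"
    unfolding sum.distrib by (subst (2) sum.swap) (simp add: sum_distrib_left)
  also have "\<dots> \<le> (\<Sum>r\<in>R. (cmod (c r))\<^sup>2 / 2 * (10 * (real N)\<^sup>2)) + (\<Sum>s\<in>R. (cmod (c s))\<^sup>2 / 2 * (10 * (real N)\<^sup>2))"
  proof (intro add_mono sum_mono mult_left_mono)
    fix r
    have "e r s = (cmod (exp_sum (2 * N) (\<alpha> s - \<alpha> r)))\<^sup>2" for s
      unfolding e_def using cmod_exp_sum_minus[of "2 * N" "\<alpha> s - \<alpha> r"] by simp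
    then show "(\<Sum>s\<in>R. e r s) \<le> 10 * (real N)\<^sup>2"
      using sum_exp_sum_squares_le[OF assms, where x = "\<alpha> r"] by simp
    show "(\<Sum>s\<in>R. e s r) \<le> 10 * (real N)\<^sup>2"
      using sum_exp_sum_squares_le[OF assms, where x = "\<alpha> r"] by (simp add: e_def)
  qed auto
  also have "\<dots> = real N * (10 * real N * (\<Sum>r\<in>R. (cmod (c r))\<^sup>2))"
    by (simp add: sum_distrib_left sum_distrib_right power2_eq_square sum.distrib[symmetric] mult_ac)
  finally have "real N * (\<Sum>n=1..N. (cmod (A (real n)))\<^sup>2) \<le> real N * (10 * real N * (\<Sum>r\<in>R. (cmod (c r))\<^sup>2))"
    using 1 by simp
  then show "(\<Sum>n=1..N. (cmod (\<Sum>r\<in>R. c r * cis (2 * pi * real n * \<alpha> r)))\<^sup>2) \<le> 10 * real N * (\<Sum>r\<in>R. (cmod (c r))\<^sup>2)"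
    using N0 by (simp add: A_def)
qed simp

section \<open>Dirichlet characters and their orthogonality\<close>

definition unit_residues :: "nat \<Rightarrow> int set" where
  "unit_residues q = {a. 0 \<le> a \<and> a < int q \<and> coprime a (int q)}"

lemma finite_unit_residues [simp]: "finite (unit_residues q)"
  by (rule finite_subset[of _ "{0..<int q}"]) (auto simp: unit_residues_def)

lemma card_unit_residues_le: "card (unit_residues q) \<le> q"
proof -
  have "card (unit_residues q) \<le> card {0..<int q}"
    by (rule card_mono) (auto simp: unit_residues_def)
  then show ?thesis by simp
qed

locale dirichlet_character =
  fixes q :: nat and chi :: "int \<Rightarrow> complex"
  assumes q_pos: "q > 0" and char: "dirichlet_char q chi"
begin

lemma mult: "chi (a * b) = chi a * chi b"
  and add_modulus: "chi (a + int q) = chi a"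
  and nonzero_iff: "chi a \<noteq> 0 \<longleftrightarrow> coprime a (int q)"
  using char by (auto simp: dirichlet_char_def)

lemma eq_0_iff: "chi a = 0 \<longleftrightarrow> \<not> coprime a (int q)"
  using nonzero_iff by blast

lemma one [simp]: "chi 1 = 1"
  using mult[of 1 1] nonzero_iff[of 1] by simp

lemma power: "chi (a ^ k) = chi a ^ k"
  by (induction k) (auto simp: mult)

lemma add_multiple_nat: "chi (a + int k * int q) = chi a"
proof (induction k)
  case (Suc k)
  have "a + int (Suc k) * int q = (a + int k * int q) + int q" by (simp add: algebra_simps)
  then show ?case using Suc by (simp only: add_modulus)
qed simp

lemma add_multiple: "chi (a + k * int q) = chi a"
proof (cases "k \<ge> 0")
  case True
  then show ?thesis using add_multiple_nat[of a "nat k"] by simp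
next
  case False
  then show ?thesis using add_multiple_nat[of "a + k * int q" "nat (- k)"] by simp
qed

lemma mod: "chi (a mod int q) = chi a"
  using add_multiple[of "a mod int q" "a div int q"] by simp

text \<open>By periodicity only finitely many values occur, while the powers of a value of modulus
  above 1 are again values and unbounded.\<close>

lemma norm_le_1: "cmod (chi a) \<le> 1"
proof (rule ccontr)
  assume "\<not> cmod (chi a) \<le> 1"
  then have gt: "cmod (chi a) > 1" by simp
  define M where "M = Max ((\<lambda>b. cmod (chi b)) ` {0..<int q})"
  have bd: "cmod (chi b) \<le> M" for b
  proof -
    have "cmod (chi (b mod int q)) \<le> M"
      unfolding M_def using q_pos by (intro Max_ge) auto
    then show ?thesis by (simp add: mod)
  qed
  obtain k where "M < cmod (chi a) ^ k" using real_arch_pow[OF gt] by blast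
  then show False using bd[of "a ^ k"] by (simp add: power norm_power)
qed

lemma inverse_exists:
  assumes "coprime a (int q)"
  obtains b where "coprime b (int q)" "(a * b) mod int q = 1 mod int q"
proof -
  from assms obtain b where b: "[a * b = 1] (mod int q)"
    using cong_solve_coprime_int by blast
  then have "coprime (a * b) (int q)"
    using cong_imp_coprime[OF cong_sym[OF b]] by simp
  with b show ?thesis using that by (auto simp: cong_def)
qed

text \<open>A unit has an inverse residue; the two values multiply to 1 and neither exceeds 1 in
  modulus.\<close>

lemma norm_eq_1:
  assumes "coprime a (int q)"
  shows "cmod (chi a) = 1"
proof -
  obtain b where b: "(a * b) mod int q = 1 mod int q" using inverse_exists[OF assms] by blast
  have "chi a * chi b = 1"
    using b mod[of "a * b"] mod[of 1] by (simp add: mult)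
  then have "cmod (chi a) * cmod (chi b) = 1" by (metis norm_mult norm_one)
  then show ?thesis using mult_left_mono[OF norm_le_1[of b], of "cmod (chi a)"] norm_le_1[of a]
    by simp
qed

lemma mult_cnj: "coprime a (int q) \<Longrightarrow> chi a * cnj (chi a) = 1"
  using norm_eq_1[of a] complex_norm_square[of "chi a"] by simp

end

lemma bij_betw_mult_unit:
  assumes "q > 0" "coprime b (int q)"
  shows "bij_betw (\<lambda>a. (a * b) mod int q) (unit_residues q) (unit_residues q)"
proof -
  have inj: "inj_on (\<lambda>a. (a * b) mod int q) (unit_residues q)"
  proof (rule inj_onI)
    fix x y assume xy: "x \<in> unit_residues q" "y \<in> unit_residues q" "(x * b) mod int q = (y * b) mod int q"
    then have "[x = y] (mod int q)"
      using cong_mult_rcancel[OF assms(2)] by (simp add: cong_def)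
    then show "x = y" using xy by (auto simp: unit_residues_def cong_def)
  qed
  moreover have "(\<lambda>a. (a * b) mod int q) ` unit_residues q \<subseteq> unit_residues q"
    using assms by (auto simp: unit_residues_def coprime_mod_left_iff)
  ultimately show ?thesis
    by (simp add: bij_betw_def endo_inj_surj)
qed

lemma sum_unit_residues_mult:
  assumes "q > 0" "coprime b (int q)"
  shows "(\<Sum>a\<in>unit_residues q. f ((a * b) mod int q)) = (\<Sum>a\<in>unit_residues q. f a)"
  using sum.reindex_bij_betw[OF bij_betw_mult_unit[OF assms], of f] by simp

text \<open>Multiplying the variable by a unit \<open>b\<close> at which the characters differ
  permutes the residues and multiplies the sum by a factor other than 1.\<close>

lemma character_orthogonality:
  assumes "q > 0" "dirichlet_char q chi" "dirichlet_char q psi" "chi \<noteq> psi"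
  shows "(\<Sum>a\<in>unit_residues q. chi a * cnj (psi a)) = 0"
proof -
  interpret C: dirichlet_character q chi using assms by unfold_locales
  interpret P: dirichlet_character q psi using assms by unfold_locales
  obtain b where b: "chi b \<noteq> psi b" using assms(4) by blast
  then have cop: "coprime b (int q)" using C.eq_0_iff P.eq_0_iff by metis
  define s where "s = (\<Sum>a\<in>unit_residues q. chi a * cnj (psi a))"
  have "s = (\<Sum>a\<in>unit_residues q. chi ((a * b) mod int q) * cnj (psi ((a * b) mod int q)))"
    unfolding s_def using sum_unit_residues_mult[OF assms(1) cop, of "\<lambda>a. chi a * cnj (psi a)"] by simp
  also have "\<dots> = (chi b * cnj (psi b)) * s"
    by (simp add: C.mod P.mod C.mult P.mult s_def sum_distrib_left mult_ac)
  finally have "s * (1 - chi b * cnj (psi b)) = 0" by (simp add: algebra_simps)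
  moreover have "chi b * cnj (psi b) \<noteq> 1"
  proof
    assume "chi b * cnj (psi b) = 1"
    then have "chi b * (psi b * cnj (psi b)) = psi b" by (simp add: mult_ac)
    then show False using b P.mult_cnj[OF cop] by simp
  qed
  ultimately show ?thesis unfolding s_def by auto
qed

text \<open>Bessel's inequality. Orthogonality makes the dual statement an exact identity for any
  finite set of characters, so \<open>K\<close> may be incomplete.\<close>

lemma character_bessel:
  assumes "q > 0" "finite K" "\<And>chi. chi \<in> K \<Longrightarrow> dirichlet_char q chi"
  shows "(\<Sum>chi\<in>K. (cmod (\<Sum>a\<in>unit_residues q. v a * cnj (chi a)))\<^sup>2)
           \<le> real (card (unit_residues q)) * (\<Sum>a\<in>unit_residues q. (cmod (v a))\<^sup>2)"
proof (rule l2_duality)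
  fix c :: "(int \<Rightarrow> complex) \<Rightarrow> complex"
  let ?U = "unit_residues q"
  have orth: "(\<Sum>a\<in>?U. cnj (chi a) * psi a) = (if chi = psi then of_nat (card ?U) else 0)"
    if "chi \<in> K" "psi \<in> K" for chi psi
  proof (cases "chi = psi")
    case True
    interpret dirichlet_character q chi using that assms by unfold_locales auto
    have "(\<Sum>a\<in>?U. cnj (chi a) * psi a) = (\<Sum>a\<in>?U. 1)"
      using mult_cnj True by (intro sum.cong) (auto simp: unit_residues_def mult.commute)
    then show ?thesis using True by simp
  next
    case False
    then show ?thesis using character_orthogonality[of q psi chi] assms that by (simp add: mult.commute)
  qed
  have "of_real (\<Sum>a\<in>?U. (cmod (\<Sum>chi\<in>K. c chi * cnj (chi a)))\<^sup>2)
      = (\<Sum>a\<in>?U. \<Sum>chi\<in>K. \<Sum>psi\<in>K. (c chi * cnj (c psi)) * (cnj (chi a) * psi a))"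
    by (simp only: of_real_sum complex_norm_square cnj_sum sum_product complex_cnj_mult complex_cnj_cnj)
       (simp only: mult_ac)
  also have "\<dots> = (\<Sum>chi\<in>K. \<Sum>psi\<in>K. (c chi * cnj (c psi)) * (\<Sum>a\<in>?U. cnj (chi a) * psi a))"
    by (subst sum.swap, intro sum.cong refl, subst sum.swap) (simp only: sum_distrib_left)
  also have "\<dots> = (\<Sum>chi\<in>K. \<Sum>psi\<in>K. if chi = psi then (c chi * cnj (c psi)) * of_nat (card ?U) else 0)"
    by (intro sum.cong refl) (simp add: orth)
  also have "\<dots> = (\<Sum>chi\<in>K. (c chi * cnj (c chi)) * of_nat (card ?U))"
    using assms(2) by (simp add: sum.delta)
  also have "\<dots> = of_real (real (card ?U) * (\<Sum>chi\<in>K. (cmod (c chi))\<^sup>2))"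
    by (simp add: complex_norm_square[symmetric] sum_distrib_left mult.commute del: of_real_power)
  finally show "(\<Sum>a\<in>?U. (cmod (\<Sum>chi\<in>K. c chi * cnj (chi a)))\<^sup>2) \<le> real (card ?U) * (\<Sum>chi\<in>K. (cmod (c chi))\<^sup>2)"
    by (simp only: of_real_eq_iff)
qed simp

section \<open>Gauss sums of primitive characters and the multiplicative large sieve\<close>

definition gauss_sum :: "nat \<Rightarrow> (int \<Rightarrow> complex) \<Rightarrow> int \<Rightarrow> complex" where
  "gauss_sum q chi n = (\<Sum>a\<in>unit_residues q. cnj (chi a) * cis (2 * pi * of_int (a * n) / real q))"

lemma cis_cong_mod:
  assumes "q > 0" "[a = b] (mod int q)"
  shows "cis (2 * pi * of_int a / real q) = cis (2 * pi * of_int b / real q)"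
proof -
  obtain k where k: "a = b + k * int q"
    using assms(2) by (metis cong_iff_lin cong_sym mult.commute)
  have "cis (2 * pi * of_int a / real q) = cis (2 * pi * of_int b / real q) * cis (2 * pi * of_int k)"
    using assms(1) by (simp add: k cis_mult field_simps)
  also have "cis (2 * pi * of_int k) = 1" by (rule cis_multiple_2pi) auto
  finally show ?thesis by simp
qed

text \<open>For a unit n, substitute a * n for a; the conjugate inside the sum turns into
  \<open>chi n\<close> outside. Otherwise let m = q / gcd(n, q): primitivity gives b = 1 mod m with
  chi b \<noteq> 1, and multiplying the variable by b leaves the additive phase unchanged because q
  divides n (b - 1). So the sum equals itself times a factor other than 1 and vanishes, as does
  \<open>chi n\<close>.\<close>

lemma gauss_sum_mult:
  assumes q: "q > 0" and prim: "primitive_dirichlet_char q chi"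
  shows "gauss_sum q chi n = chi n * gauss_sum q chi 1"
proof -
  interpret dirichlet_character q chi
    using assms by unfold_locales (auto simp: primitive_dirichlet_char_def)
  show ?thesis
  proof (cases "coprime n (int q)")
    case True
    have "gauss_sum q chi 1 = (\<Sum>a\<in>unit_residues q. cnj (chi ((a * n) mod int q)) * cis (2 * pi * of_int ((a * n) mod int q) / real q))"
      unfolding gauss_sum_def
      using sum_unit_residues_mult[OF q True, of "\<lambda>a. cnj (chi a) * cis (2 * pi * of_int a / real q)"] by simp
    also have "\<dots> = (\<Sum>a\<in>unit_residues q. cnj (chi n) * (cnj (chi a) * cis (2 * pi * of_int (a * n) / real q)))"
    proof (intro sum.cong refl)
      fix a
      have "cis (2 * pi * of_int ((a * n) mod int q) / real q) = cis (2 * pi * of_int (a * n) / real q)"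
        by (rule cis_cong_mod[OF q]) (simp add: cong_def)
      then show "cnj (chi ((a * n) mod int q)) * cis (2 * pi * of_int ((a * n) mod int q) / real q)
          = cnj (chi n) * (cnj (chi a) * cis (2 * pi * of_int (a * n) / real q))"
        by (simp add: mod mult)
    qed
    also have "\<dots> = cnj (chi n) * gauss_sum q chi n"
      by (simp add: gauss_sum_def sum_distrib_left)
    finally have "chi n * gauss_sum q chi 1 = (chi n * cnj (chi n)) * gauss_sum q chi n"
      by (simp add: mult_ac)
    then show ?thesis using mult_cnj[OF True] by simp
  next
    case False
    define g where "g = gcd n (int q)"
    have g: "g > 1" "g dvd int q" "g dvd n"
    proof -
      have "g \<noteq> 1" using False by (simp add: g_def coprime_iff_gcd_eq_1)
      moreover have "g > 0" using q by (simp add: g_def)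
      ultimately show "g > 1" by linarith
    qed (simp_all add: g_def)
    then obtain m where m: "int q = g * m" by (auto elim: dvdE)
    have "g * m > 0" using q m by linarith
    then have m_pos: "m > 0" using g(1) by (simp add: zero_less_mult_iff)
    have "int (nat m) dvd int q" using m_pos by (simp add: m)
    then have "nat m dvd q" by (simp only: int_dvd_int_iff)
    moreover have "nat m < q"
    proof -
      have "m * 1 < m * g" using g(1) m_pos by (intro mult_strict_left_mono) auto
      then have "m < int q" using m by (simp add: mult.commute)
      then show ?thesis using m_pos by linarith
    qed
    ultimately obtain b where b: "coprime b (int q)" "b mod m = 1 mod m" "chi b \<noteq> 1"
      using prim m_pos unfolding primitive_dirichlet_char_def by (metis int_nat_eq less_imp_le)
    have "m dvd b - 1" using b(2) mod_eq_dvd_iff by blast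
    have inv: "[(a * b) mod int q * n = a * n] (mod int q)" for a
    proof -
      have "int q dvd n * (b - 1)" unfolding m using g(3) \<open>m dvd b - 1\<close> by (rule mult_dvd_mono)
      then have "int q dvd a * (n * (b - 1))" by (rule dvd_mult)
      then have "int q dvd (a * b) * n - a * n" by (simp add: algebra_simps)
      then have "[(a * b) * n = a * n] (mod int q)" by (simp add: cong_iff_dvd_diff)
      then show ?thesis by (simp add: cong_def mod_mult_left_eq)
    qed
    have "gauss_sum q chi n = (\<Sum>a\<in>unit_residues q. cnj (chi ((a * b) mod int q)) * cis (2 * pi * of_int ((a * b) mod int q * n) / real q))"
      unfolding gauss_sum_def
      using sum_unit_residues_mult[OF q b(1), of "\<lambda>a. cnj (chi a) * cis (2 * pi * of_int (a * n) / real q)"] by simp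
    also have "\<dots> = (\<Sum>a\<in>unit_residues q. cnj (chi b) * (cnj (chi a) * cis (2 * pi * of_int (a * n) / real q)))"
      by (intro sum.cong refl, subst cis_cong_mod[OF q inv]) (simp add: mod mult)
    also have "\<dots> = cnj (chi b) * gauss_sum q chi n"
      by (simp add: gauss_sum_def sum_distrib_left)
    finally have "(1 - cnj (chi b)) * gauss_sum q chi n = 0" by (simp add: algebra_simps)
    moreover have "cnj (chi b) \<noteq> 1" using b(3) by (simp add: complex_cnj_cancel_iff[of _ 1, simplified])
    ultimately have "gauss_sum q chi n = 0" by auto
    moreover have "chi n = 0" using False eq_0_iff by blast
    ultimately show ?thesis by simp
  qed
qed

lemma exp_sum_root_of_unity:
  assumes "q > 0" "\<not> int q dvd k"
  shows "exp_sum q (of_int k / real q) = 0"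
proof -
  let ?z = "cis (2 * pi * of_int k / real q)"
  have "exp_sum q (of_int k / real q) = (\<Sum>u<q. ?z ^ u)"
    unfolding exp_sum_def by (intro sum.cong refl) (simp add: Complex.DeMoivre algebra_simps)
  then have "(?z - 1) * exp_sum q (of_int k / real q) = ?z ^ q - 1"
    using power_diff_1_eq[of ?z q] by simp
  also have "?z ^ q = cis (2 * pi * of_int k)"
    using assms(1) by (simp add: Complex.DeMoivre)
  also have "cis (2 * pi * of_int k) = 1" by (rule cis_multiple_2pi) auto
  finally have "(?z - 1) * exp_sum q (of_int k / real q) = 0" by simp
  moreover have "?z \<noteq> 1"
  proof
    assume "?z = 1"
    then have "cos (2 * pi * of_int k / real q) = 1" by (metis cis.sel(1) one_complex.sel(1))
    then obtain m :: int where "2 * pi * of_int k / real q = of_int m * (2 * pi)"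
      unfolding cos_one_2pi_int by (auto simp: mult_ac)
    then have "of_int k = real_of_int (m * int q)" using assms(1) by (simp add: field_simps)
    then have "k = m * int q" by (simp only: of_int_eq_iff)
    then show False using assms(2) by simp
  qed
  ultimately show ?thesis by simp
qed

text \<open>The mean square over all frequencies n < q is computed twice: orthogonality of the
  additive phases gives phi(q) q, and \<open>gauss_sum_mult\<close> gives phi(q) times the wanted
  square.\<close>

lemma norm_gauss_sum:
  assumes q: "q > 0" and prim: "primitive_dirichlet_char q chi"
  shows "(cmod (gauss_sum q chi 1))\<^sup>2 = real q"
proof -
  interpret dirichlet_character q chi
    using assms by unfold_locales (auto simp: primitive_dirichlet_char_def)
  let ?U = "unit_residues q"
  let ?e = "\<lambda>a n. cis (2 * pi * of_int (a * int n) / real q)"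
  have cardU: "card ?U > 0"
  proof -
    have "1 mod int q \<in> ?U" using q by (auto simp: unit_residues_def)
    then show ?thesis by (metis card_gt_0_iff empty_iff finite_unit_residues)
  qed
  have orth: "(\<Sum>n<q. ?e a n * cnj (?e a' n)) = (if a = a' then of_nat q else 0)"
    if "a \<in> ?U" "a' \<in> ?U" for a a'
  proof -
    have "(\<Sum>n<q. ?e a n * cnj (?e a' n)) = exp_sum q (of_int (a - a') / real q)"
      unfolding exp_sum_def
      by (intro sum.cong refl) (simp add: cis_cnj cis_mult diff_divide_distrib algebra_simps)
    moreover have "\<not> int q dvd a - a'" if "a \<noteq> a'"
      using that \<open>a \<in> ?U\<close> \<open>a' \<in> ?U\<close> by (auto simp: unit_residues_def dest!: zdvd_imp_le[rotated])
        (metis mod_eq_dvd_iff mod_pos_pos_trivial)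
    ultimately show ?thesis using exp_sum_root_of_unity[OF q, of "a - a'"]
      by (auto simp: exp_sum_def)
  qed
  have "of_real (\<Sum>n<q. (cmod (gauss_sum q chi (int n)))\<^sup>2)
      = (\<Sum>n<q. \<Sum>a\<in>?U. \<Sum>a'\<in>?U. (cnj (chi a) * chi a') * (?e a n * cnj (?e a' n)))"
    by (simp only: of_real_sum complex_norm_square cnj_sum sum_product complex_cnj_mult complex_cnj_cnj gauss_sum_def)
       (simp add: mult_ac)
  also have "\<dots> = (\<Sum>a\<in>?U. \<Sum>a'\<in>?U. (cnj (chi a) * chi a') * (\<Sum>n<q. ?e a n * cnj (?e a' n)))"
    by (subst sum.swap, intro sum.cong refl, subst sum.swap) (simp only: sum_distrib_left)
  also have "\<dots> = (\<Sum>a\<in>?U. \<Sum>a'\<in>?U. if a = a' then (cnj (chi a) * chi a') * of_nat q else 0)"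
    by (intro sum.cong refl, subst orth) auto
  also have "\<dots> = (\<Sum>a\<in>?U. (cnj (chi a) * chi a) * of_nat q)"
    by (simp add: sum.delta)
  also have "\<dots> = (\<Sum>a\<in>?U. of_nat q)"
    using mult_cnj by (intro sum.cong refl) (auto simp: unit_residues_def mult.commute)
  also have "\<dots> = of_real (real (card ?U) * real q)" by simp
  finally have 1: "(\<Sum>n<q. (cmod (gauss_sum q chi (int n)))\<^sup>2) = real (card ?U) * real q"
    by (simp only: of_real_eq_iff)
  have "(\<Sum>n<q. (cmod (gauss_sum q chi (int n)))\<^sup>2) = (\<Sum>n<q. (cmod (chi (int n)))\<^sup>2) * (cmod (gauss_sum q chi 1))\<^sup>2"
    by (simp add: gauss_sum_mult[OF assms, of "int _"] norm_mult power_mult_distrib sum_distrib_right)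
  also have "(\<Sum>n<q. (cmod (chi (int n)))\<^sup>2) = (\<Sum>n\<in>int ` {..<q}. (cmod (chi n))\<^sup>2)"
    by (simp add: sum.reindex)
  also have "\<dots> = (\<Sum>n\<in>?U. (cmod (chi n))\<^sup>2)"
  proof (rule sum.mono_neutral_right)
    show "?U \<subseteq> int ` {..<q}"
    proof
      fix x assume "x \<in> ?U"
      then have "x = int (nat x)" "nat x < q" by (auto simp: unit_residues_def)
      then show "x \<in> int ` {..<q}" by blast
    qed
    show "\<forall>i\<in>int ` {..<q} - ?U. (cmod (chi i))\<^sup>2 = 0"
    proof
      fix i assume "i \<in> int ` {..<q} - ?U"
      then have "\<not> coprime i (int q)" by (auto simp: unit_residues_def)
      then show "(cmod (chi i))\<^sup>2 = 0" by (simp add: eq_0_iff)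
    qed
  qed auto
  also have "\<dots> = (\<Sum>n\<in>?U. 1)"
    by (intro sum.cong refl) (auto simp: unit_residues_def norm_eq_1)
  finally have 2: "(\<Sum>n<q. (cmod (gauss_sum q chi (int n)))\<^sup>2) = (\<Sum>n\<in>?U. 1) * (cmod (gauss_sum q chi 1))\<^sup>2" .
  have "real (card ?U) * (cmod (gauss_sum q chi 1))\<^sup>2 = real (card ?U) * real q"
    unfolding 1[symmetric] 2 by simp
  then show ?thesis using cardU by (auto simp: card_gt_0_iff)
qed

text \<open>Gauss sums convert character sums into values of the exponential sum \<open>S\<close> at
  the fractions a/q, Bessel's inequality removes the characters, and the factor q from the Gauss sum
  outweighs the number of units. Distinct reduced fractions differ modulo 1 by at least 1 / lcm(q,
  q') \<ge> 1/N. Stating the hypothesis through the lcm keeps the single modulus (N \<ge> q) and the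
  dyadic range (N about Q^2) in one theorem.\<close>

theorem multiplicative_large_sieve:
  assumes fin: "finite \<Q>" and pos: "\<And>q. q \<in> \<Q> \<Longrightarrow> q > 0"
    and K: "\<And>q. q \<in> \<Q> \<Longrightarrow> finite (K q) \<and> (\<forall>chi\<in>K q. primitive_dirichlet_char q chi)"
    and N: "\<And>q q'. q \<in> \<Q> \<Longrightarrow> q' \<in> \<Q> \<Longrightarrow> lcm q q' \<le> N"
  shows "(\<Sum>q\<in>\<Q>. \<Sum>chi\<in>K q. (cmod (\<Sum>n=1..N. b n * chi (int n)))\<^sup>2)
           \<le> 10 * real N * (\<Sum>n=1..N. (cmod (b n))\<^sup>2)"
proof (cases "\<Q> = {}")
  case True
  then show ?thesis by (auto intro!: mult_nonneg_nonneg sum_nonneg)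
next
  case False
  define S where "S x = (\<Sum>n=1..N. b n * cis (2 * pi * real n * x))" for x
  have N0: "N > 0"
    using False N pos by (metis all_not_in_conv lcm_eq_0_iff gr0I leD less_imp_neq neq0_conv)
  have one: "(\<Sum>chi\<in>K q. (cmod (\<Sum>n=1..N. b n * chi (int n)))\<^sup>2)
      \<le> (\<Sum>a\<in>unit_residues q. (cmod (S (of_int a / real q)))\<^sup>2)" if q: "q \<in> \<Q>" for q
  proof -
    have tau: "real q * (cmod (\<Sum>n=1..N. b n * chi (int n)))\<^sup>2
        = (cmod (\<Sum>a\<in>unit_residues q. S (of_int a / real q) * cnj (chi a)))\<^sup>2" if chi: "chi \<in> K q" for chi
    proof -
      have prim: "primitive_dirichlet_char q chi" using K[OF q] chi by blast
      have "gauss_sum q chi 1 * (\<Sum>n=1..N. b n * chi (int n)) = (\<Sum>n=1..N. b n * gauss_sum q chi (int n))"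
        by (simp add: sum_distrib_left gauss_sum_mult[OF pos[OF q] prim, of "int _"] mult_ac)
      also have "\<dots> = (\<Sum>n=1..N. \<Sum>a\<in>unit_residues q. b n * cis (2 * pi * real n * (of_int a / real q)) * cnj (chi a))"
        unfolding gauss_sum_def by (simp add: sum_distrib_left mult_ac)
      also have "\<dots> = (\<Sum>a\<in>unit_residues q. S (of_int a / real q) * cnj (chi a))"
        by (subst sum.swap) (simp add: S_def sum_distrib_right)
      finally have "(cmod (gauss_sum q chi 1))\<^sup>2 * (cmod (\<Sum>n=1..N. b n * chi (int n)))\<^sup>2
          = (cmod (\<Sum>a\<in>unit_residues q. S (of_int a / real q) * cnj (chi a)))\<^sup>2"
        by (metis norm_mult power_mult_distrib)
      then show ?thesis by (simp add: norm_gauss_sum[OF pos[OF q] prim])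
    qed
    have "real q * (\<Sum>chi\<in>K q. (cmod (\<Sum>n=1..N. b n * chi (int n)))\<^sup>2)
        = (\<Sum>chi\<in>K q. (cmod (\<Sum>a\<in>unit_residues q. S (of_int a / real q) * cnj (chi a)))\<^sup>2)"
      unfolding sum_distrib_left by (intro sum.cong refl tau)
    also have "\<dots> \<le> real (card (unit_residues q)) * (\<Sum>a\<in>unit_residues q. (cmod (S (of_int a / real q)))\<^sup>2)"
      using K[OF q] by (intro character_bessel pos[OF q]) (auto simp: primitive_dirichlet_char_def)
    also have "\<dots> \<le> real q * (\<Sum>a\<in>unit_residues q. (cmod (S (of_int a / real q)))\<^sup>2)"
      using card_unit_residues_le[of q] by (intro mult_right_mono sum_nonneg) auto
    finally show ?thesis using pos[OF q] by simp
  qed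
  have "(\<Sum>q\<in>\<Q>. \<Sum>chi\<in>K q. (cmod (\<Sum>n=1..N. b n * chi (int n)))\<^sup>2)
      \<le> (\<Sum>q\<in>\<Q>. \<Sum>a\<in>unit_residues q. (cmod (S (of_int a / real q)))\<^sup>2)"
    by (intro sum_mono one)
  also have "\<dots> = (\<Sum>r\<in>Sigma \<Q> unit_residues. (cmod (S (of_int (snd r) / real (fst r))))\<^sup>2)"
    using fin by (subst sum.Sigma) (auto simp: case_prod_unfold)
  also have "\<dots> \<le> 10 * real N * (\<Sum>n=1..N. (cmod (b n))\<^sup>2)"
    unfolding S_def
  proof (rule additive_large_sieve[where \<delta> = "1 / real N"])
    fix r s :: "nat \<times> int" and k :: int
    assume r: "r \<in> Sigma \<Q> unit_residues" and s: "s \<in> Sigma \<Q> unit_residues" and neq: "r \<noteq> s"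
    obtain q a where r_eq: "r = (q, a)" by force
    obtain q' a' where s_eq: "s = (q', a')" by force
    have q: "q \<in> \<Q>" "a \<in> unit_residues q" and q': "q' \<in> \<Q>" "a' \<in> unit_residues q'"
      using r s by (auto simp: r_eq s_eq)
    have qp: "q > 0" "q' > 0" using pos q q' by auto
    define l where "l = lcm q q'"
    obtain u where u: "l = q * u" unfolding l_def by (metis dvd_lcm1 dvdE)
    obtain v where v: "l = q' * v" unfolding l_def by (metis dvd_lcm2 dvdE)
    have l0: "l > 0" using qp by (simp add: l_def lcm_pos_nat)
    define z where "z = a * int u - a' * int v - k * int l"
    have up: "u > 0" "v > 0" using u v l0 by (auto intro: gr0I)
    have ul: "of_int a / real q = of_int (a * int u) / real l"
      unfolding u using qp up by simp
    have vl: "of_int a' / real q' = of_int (a' * int v) / real l"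
      unfolding v using qp up by simp
    have eq: "of_int a / real q - of_int a' / real q' - of_int k = of_int z / real l"
      unfolding ul vl z_def using l0 by (simp add: field_simps)
    \<comment> \<open>Equal fractions in lowest terms have equal denominators: q and q' divide each
      other because the numerators are units. Then a and a' agree modulo q.\<close>
    have "z \<noteq> 0"
    proof
      assume "z = 0"
      then have "of_int a / real q = of_int a' / real q' + of_int k" using eq by simp
      then have "real_of_int (a * int q') = of_int (a' * int q + k * int q * int q')"
        using qp by (simp add: field_simps)
      then have e: "a * int q' = a' * int q + k * int q * int q'" by (simp only: of_int_eq_iff)
      have copr: "coprime (int q) a" "coprime (int q') a'"
        using q(2) q'(2) unfolding unit_residues_def by (simp_all only: mem_Collect_eq coprime_commute)
      have "int q dvd a * int q'" unfolding e by simp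
      then have "int q dvd int q'" using copr(1) by (simp only: coprime_dvd_mult_right_iff)
      have "a' * int q = (a - k * int q) * int q'" using e by (simp add: algebra_simps)
      then have "int q' dvd a' * int q" by simp
      then have "int q' dvd int q" using copr(2) by (simp only: coprime_dvd_mult_right_iff)
      with \<open>int q dvd int q'\<close> have qq: "q = q'" by (simp add: dvd_antisym)
      then have "int q * a = int q * (a' + k * int q)" using e by (simp add: algebra_simps)
      then have "a = a' + k * int q" using qp by simp
      then have "a mod int q = a' mod int q" by simp
      then have "a = a'" using q(2) q'(2) qq by (simp add: unit_residues_def)
      then show False using neq qq by (simp add: r_eq s_eq)
    qed
    then have "1 \<le> \<bar>real_of_int z\<bar>" by linarith
    then have "1 / real l \<le> \<bar>of_int z / real l\<bar>" by (simp add: divide_right_mono)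
    moreover have "1 / real N \<le> 1 / real l"
      using N[OF q(1) q'(1)] l0 by (intro divide_left_mono) (auto simp: l_def N0)
    ultimately show "1 / real N \<le> \<bar>of_int (snd r) / real (fst r) - of_int (snd s) / real (fst s) - of_int k\<bar>"
      using eq by (simp add: r_eq s_eq)
  qed (use fin N0 in auto)
  finally show ?thesis .
qed

section \<open>Ramare's identity\<close>

lemma cmod_sum_squared_le:
  "(cmod (\<Sum>i\<in>A. x i))\<^sup>2 \<le> real (card A) * (\<Sum>i\<in>A. (cmod (x i))\<^sup>2)"
proof -
  have "(cmod (\<Sum>i\<in>A. x i))\<^sup>2 \<le> (\<Sum>i\<in>A. 1 * cmod (x i))\<^sup>2"
    using norm_sum[of x A] by (intro power_mono) auto
  also have "\<dots> \<le> (\<Sum>i\<in>A. 1\<^sup>2) * (\<Sum>i\<in>A. (cmod (x i))\<^sup>2)"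
    by (rule Cauchy_Schwarz_ineq_sum)
  finally show ?thesis by simp
qed

lemma cmod_add_squared_le: "(cmod (a + b))\<^sup>2 \<le> 2 * (cmod a)\<^sup>2 + 2 * (cmod b)\<^sup>2"
proof -
  have "(cmod (a + b))\<^sup>2 \<le> (cmod a + cmod b)\<^sup>2"
    by (intro power_mono norm_triangle_ineq) auto
  also have "\<dots> \<le> 2 * (cmod a)\<^sup>2 + 2 * (cmod b)\<^sup>2"
    using sum_squares_bound[of "cmod a" "cmod b"] by (simp add: power2_sum)
  finally show ?thesis .
qed

lemma cmod_diff_squared_le: "(cmod (a - b))\<^sup>2 \<le> 2 * (cmod a)\<^sup>2 + 2 * (cmod b)\<^sup>2"
  using cmod_add_squared_le[of a "- b"] by simp

definition omega_in :: "nat set \<Rightarrow> nat \<Rightarrow> nat" where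
  "omega_in I n = card {p\<in>I. p dvd n}"

locale ramare =
  fixes f :: "nat \<Rightarrow> complex" and I :: "nat set" and A :: real
  assumes f_mult: "\<And>m n. 1 \<le> m \<Longrightarrow> 1 \<le> n \<Longrightarrow> coprime m n \<Longrightarrow> f (m * n) = f m * f n"
    and finite_I: "finite I" and primes: "\<And>p. p \<in> I \<Longrightarrow> prime p"
    and f_prime: "\<And>p. p \<in> I \<Longrightarrow> cmod (f p) \<le> A"
begin

text \<open>If \<open>p \<in> I\<close> divides \<open>n\<close> exactly once, then \<open>f p * weight (n div p) = f n / omega_in I n\<close>, whence the
  shift by 1; primes whose square divides \<open>n\<close> cause an error.\<close>

definition weight :: "nat \<Rightarrow> complex" where
  "weight m = f m / of_nat (omega_in I m + 1)"

lemma cmod_weight_le: "cmod (weight m) \<le> cmod (f m)"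
proof -
  have "cmod (f m) * 1 \<le> cmod (f m) * real (omega_in I m + 1)"
    by (intro mult_left_mono) auto
  then show ?thesis unfolding weight_def norm_divide norm_of_nat
    by (subst divide_le_eq) auto
qed

lemma exact_divisor:
  assumes "n \<ge> 1" "p \<in> I" "p dvd n" "\<not> p\<^sup>2 dvd n"
  shows "f p * weight (n div p) = f n / of_nat (omega_in I n)"
proof -
  obtain m where m: "n = p * m" using assms(3) by (elim dvdE)
  have p: "prime p" "p > 0" using assms(2) primes prime_gt_0_nat by auto
  have "\<not> p dvd m" using assms(4) p by (auto simp: m power2_eq_square)
  then have cop: "coprime p m" using p by (simp add: prime_imp_coprime)
  have m1: "m \<ge> 1" using assms(1) m by (cases m) auto
  have "{r\<in>I. r dvd n} = insert p {r\<in>I. r dvd m}"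
    using assms(2) p primes by (auto simp: m prime_dvd_mult_iff primes_dvd_imp_eq)
  then have "omega_in I n = omega_in I m + 1"
    using \<open>\<not> p dvd m\<close> finite_I by (simp add: omega_in_def)
  moreover have "f n = f p * f m" unfolding m using p m1 cop by (intro f_mult) auto
  ultimately show ?thesis using p by (simp add: m weight_def)
qed

lemma square_divisor:
  assumes "n \<ge> 1" "p \<in> I" "p\<^sup>2 dvd n"
  shows "omega_in I (n div p) = omega_in I n"
proof -
  obtain m where "n = p * p * m" using assms(3) by (auto simp: dvd_def power2_eq_square)
  then have m: "n = p * (p * m)" by simp
  have p: "prime p" "p > 0" using assms(2) primes prime_gt_0_nat by auto
  have "{r\<in>I. r dvd n} = {r\<in>I. r dvd n div p}"
    using p primes by (auto simp: m prime_dvd_mult_iff)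
  then show ?thesis by (simp add: omega_in_def)
qed

lemma square_divisor_bound:
  assumes "n \<ge> 1" "p \<in> I" "p\<^sup>2 dvd n"
  shows "(cmod (f p * weight (n div p)))\<^sup>2 \<le> A\<^sup>2 * (cmod (f (n div p)))\<^sup>2 / (real (omega_in I n + 1))\<^sup>2"
proof -
  have "cmod (f p * weight (n div p)) = cmod (f p) * (cmod (f (n div p)) / real (omega_in I n + 1))"
    by (simp add: norm_mult weight_def norm_divide square_divisor[OF assms] del: of_nat_Suc of_nat_add)
  also have "\<dots> \<le> A * (cmod (f (n div p)) / real (omega_in I n + 1))"
    by (intro mult_right_mono f_prime assms) auto
  finally have "(cmod (f p * weight (n div p)))\<^sup>2 \<le> (A * (cmod (f (n div p)) / real (omega_in I n + 1)))\<^sup>2"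
    by (intro power_mono) auto
  then show ?thesis by (simp add: power_mult_distrib power_divide)
qed

text \<open>The cost at \<open>n\<close> of the primes whose square divides it. For such p neither
  the value of \<open>f\<close> nor the count \<open>omega_in\<close> splits off p, so the wanted
  term and the actual one are both charged in absolute value.\<close>

definition sq_err :: "nat \<Rightarrow> real" where
  "sq_err n = (\<Sum>p | p \<in> I \<and> p\<^sup>2 dvd n. (cmod (f n))\<^sup>2 + A\<^sup>2 * (cmod (f (n div p)))\<^sup>2)"

lemma sq_err_nonneg: "sq_err n \<ge> 0"
  unfolding sq_err_def by (intro sum_nonneg) auto

lemma card_square_divisors_le: "card {p\<in>I. p\<^sup>2 dvd n} \<le> omega_in I n"
  unfolding omega_in_def using finite_I by (intro card_mono) (auto simp: power2_eq_square dest: dvd_mult_left)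

text \<open>Primes dividing \<open>n\<close> exactly once cancel against their share of
  \<open>f n\<close>. The others number at most \<open>omega_in I n\<close>, and this loss in
  Cauchy-Schwarz is outweighed by the squared denominators of the terms.\<close>

lemma full_divisor_sum_error:
  assumes n: "n \<ge> 1" and w: "omega_in I n > 0"
  shows "(cmod (f n - (\<Sum>p | p \<in> I \<and> p dvd n. f p * weight (n div p))))\<^sup>2 \<le> 2 * sq_err n"
proof -
  let ?w = "omega_in I n" and ?Q = "{p. p \<in> I \<and> p\<^sup>2 dvd n}" and ?D = "{p. p \<in> I \<and> p dvd n}"
  have Q: "?Q \<subseteq> ?D" "finite ?D" using finite_I by (auto simp: power2_eq_square dest: dvd_mult_left)
  have card: "card ?D = ?w" by (simp add: omega_in_def)
  have "f n = (\<Sum>p\<in>?D. f n / of_nat ?w)" using w card by simp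
  then have "f n - (\<Sum>p\<in>?D. f p * weight (n div p)) = (\<Sum>p\<in>?D. f n / of_nat ?w - f p * weight (n div p))"
    by (simp add: sum_subtractf)
  also have "\<dots> = (\<Sum>p\<in>?Q. f n / of_nat ?w - f p * weight (n div p))"
    using Q exact_divisor[OF n] by (intro sum.mono_neutral_right) auto
  finally have "(cmod (f n - (\<Sum>p\<in>?D. f p * weight (n div p))))\<^sup>2
      \<le> real (card ?Q) * (\<Sum>p\<in>?Q. (cmod (f n / of_nat ?w - f p * weight (n div p)))\<^sup>2)"
    using cmod_sum_squared_le by simp
  also have "\<dots> \<le> real ?w * (\<Sum>p\<in>?Q. 2 * ((cmod (f n))\<^sup>2 + A\<^sup>2 * (cmod (f (n div p)))\<^sup>2) / (real ?w)\<^sup>2)"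
  proof (intro mult_mono sum_mono)
    fix p assume p: "p \<in> ?Q"
    have "(cmod (f n / of_nat ?w - f p * weight (n div p)))\<^sup>2
        \<le> 2 * (cmod (f n / of_nat ?w))\<^sup>2 + 2 * (cmod (f p * weight (n div p)))\<^sup>2"
      by (rule cmod_diff_squared_le)
    also have "\<dots> \<le> 2 * ((cmod (f n))\<^sup>2 / (real ?w)\<^sup>2) + 2 * (A\<^sup>2 * (cmod (f (n div p)))\<^sup>2 / (real ?w)\<^sup>2)"
    proof (intro add_mono mult_left_mono)
      have "A\<^sup>2 * (cmod (f (n div p)))\<^sup>2 / (real (?w + 1))\<^sup>2 \<le> A\<^sup>2 * (cmod (f (n div p)))\<^sup>2 / (real ?w)\<^sup>2"
        using w by (intro divide_left_mono power_mono) auto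
      then show "(cmod (f p * weight (n div p)))\<^sup>2 \<le> A\<^sup>2 * (cmod (f (n div p)))\<^sup>2 / (real ?w)\<^sup>2"
        using square_divisor_bound[OF n, of p] p by auto
    qed (auto simp: norm_divide power_divide)
    finally show "(cmod (f n / of_nat ?w - f p * weight (n div p)))\<^sup>2
        \<le> 2 * ((cmod (f n))\<^sup>2 + A\<^sup>2 * (cmod (f (n div p)))\<^sup>2) / (real ?w)\<^sup>2"
      by (simp add: add_divide_distrib algebra_simps)
  qed (use card_square_divisors_le in \<open>auto intro!: sum_nonneg\<close>)
  also have "\<dots> = 2 / real ?w * sq_err n"
  proof -
    have "(\<Sum>p\<in>?Q. 2 * ((cmod (f n))\<^sup>2 + A\<^sup>2 * (cmod (f (n div p)))\<^sup>2) / (real ?w)\<^sup>2) = 2 * sq_err n / (real ?w)\<^sup>2"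
      unfolding sq_err_def sum_distrib_left sum_divide_distrib ..
    then show ?thesis using w by (simp add: power2_eq_square)
  qed
  also have "\<dots> \<le> 2 * sq_err n"
    using w sq_err_nonneg[of n] by (intro mult_right_mono) (auto simp: field_simps)
  finally show ?thesis .
qed

text \<open>Meant for n beyond the cut-off, where only some of the primes of n occur: at most
  \<open>omega_in I n\<close> equal shares of \<open>f n\<close> add up to at most |f n|.\<close>

lemma partial_divisor_sum_bound:
  assumes n: "n \<ge> 1" and P: "P \<subseteq> {p\<in>I. p dvd n}"
  shows "(cmod (\<Sum>p\<in>P. f p * weight (n div p)))\<^sup>2 \<le> 2 * (cmod (f n))\<^sup>2 + 2 * sq_err n"
proof -
  let ?w = "omega_in I n"
  have finP: "finite P" using finite_subset[OF P] finite_I by simp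
  define P1 where "P1 = {p\<in>P. \<not> p\<^sup>2 dvd n}"
  define P2 where "P2 = {p\<in>P. p\<^sup>2 dvd n}"
  have "(\<Sum>p\<in>P. f p * weight (n div p)) = (\<Sum>p\<in>P1. f p * weight (n div p)) + (\<Sum>p\<in>P2. f p * weight (n div p))"
    using finP by (subst sum.union_disjoint[symmetric]) (auto simp: P1_def P2_def intro!: sum.cong)
  then have "(cmod (\<Sum>p\<in>P. f p * weight (n div p)))\<^sup>2
      \<le> 2 * (cmod (\<Sum>p\<in>P1. f p * weight (n div p)))\<^sup>2 + 2 * (cmod (\<Sum>p\<in>P2. f p * weight (n div p)))\<^sup>2"
    using cmod_add_squared_le by simp
  also have "(cmod (\<Sum>p\<in>P1. f p * weight (n div p)))\<^sup>2 \<le> (cmod (f n))\<^sup>2"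
  proof -
    have "(\<Sum>p\<in>P1. f p * weight (n div p)) = (\<Sum>p\<in>P1. f n / of_nat ?w)"
      using P n by (intro sum.cong refl exact_divisor) (auto simp: P1_def)
    also have "cmod \<dots> = real (card P1) / real ?w * cmod (f n)"
      by (simp add: norm_mult norm_divide)
    also have "\<dots> \<le> 1 * cmod (f n)"
    proof (rule mult_right_mono)
      have "card P1 \<le> ?w" unfolding omega_in_def using P finite_I by (intro card_mono) (auto simp: P1_def)
      then show "real (card P1) / real ?w \<le> 1" by (simp add: divide_le_eq)
    qed auto
    finally show ?thesis by (intro power_mono) auto
  qed
  also have "(cmod (\<Sum>p\<in>P2. f p * weight (n div p)))\<^sup>2 \<le> sq_err n"
  proof -
    have P2: "P2 \<subseteq> {p\<in>I. p\<^sup>2 dvd n}" using P by (auto simp: P2_def)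
    have card: "card P2 \<le> ?w"
      using card_square_divisors_le[of n] card_mono[OF _ P2] finite_I by fastforce
    have "(cmod (\<Sum>p\<in>P2. f p * weight (n div p)))\<^sup>2
        \<le> real (card P2) * (\<Sum>p\<in>P2. (cmod (f p * weight (n div p)))\<^sup>2)"
      by (rule cmod_sum_squared_le)
    also have "\<dots> \<le> real (?w + 1) * (\<Sum>p\<in>P2. A\<^sup>2 * (cmod (f (n div p)))\<^sup>2 / (real (?w + 1))\<^sup>2)"
      using card P2 by (intro mult_mono sum_mono square_divisor_bound n sum_nonneg) auto
    also have "\<dots> = 1 / real (?w + 1) * (\<Sum>p\<in>P2. A\<^sup>2 * (cmod (f (n div p)))\<^sup>2)"
      by (simp add: sum_divide_distrib[symmetric] power2_eq_square del: of_nat_Suc of_nat_add)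
    also have "\<dots> \<le> 1 * (\<Sum>p\<in>P2. A\<^sup>2 * (cmod (f (n div p)))\<^sup>2)"
      by (intro mult_right_mono sum_nonneg) (auto simp: divide_le_eq)
    also have "\<dots> \<le> sq_err n"
      unfolding sq_err_def mult_1 using P2 finite_I
      by (intro order.trans[OF sum_mono2[of "{p. p \<in> I \<and> p\<^sup>2 dvd n}"] sum_mono]) auto
    finally show ?thesis .
  qed
  finally show ?thesis by simp
qed

end

section \<open>Mean squares over multiples of prime powers\<close>

lemma summable_poly_geometric:
  fixes r :: real
  assumes r: "0 \<le> r" "r < 1" and c: "c > 0"
  shows "summable (\<lambda>k. real (k + c) ^ m * r ^ k)"
proof -
  have "(\<lambda>k. real (Suc k) / real k) \<longlonglongrightarrow> 1" by real_asymp
  then have "(\<lambda>k. real (Suc k + c) / real (k + c)) \<longlonglongrightarrow> 1"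
    by (drule_tac LIMSEQ_ignore_initial_segment[of _ _ c]) simp
  then have "(\<lambda>k. (real (Suc k + c) / real (k + c)) ^ m * r) \<longlonglongrightarrow> 1 ^ m * r"
    by (intro tendsto_mult tendsto_power tendsto_const)
  then have "eventually (\<lambda>k. (real (Suc k + c) / real (k + c)) ^ m * r < (1 + r) / 2) sequentially"
    using r by (intro order_tendstoD) auto
  then obtain K where K: "\<And>k. k \<ge> K \<Longrightarrow> (real (Suc k + c) / real (k + c)) ^ m * r < (1 + r) / 2"
    by (auto simp: eventually_sequentially)
  show ?thesis
  proof (rule summable_ratio_test[of "(1 + r) / 2" K])
    fix k assume "K \<le> k"
    have "real (Suc k + c) ^ m * r ^ Suc k
        = ((real (Suc k + c) / real (k + c)) ^ m * r) * (real (k + c) ^ m * r ^ k)"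
      using c by (simp add: power_divide)
    also have "\<dots> \<le> ((1 + r) / 2) * (real (k + c) ^ m * r ^ k)"
      using K[OF \<open>K \<le> k\<close>] r by (intro mult_right_mono) auto
    finally show "norm (real (Suc k + c) ^ m * r ^ Suc k) \<le> (1 + r) / 2 * norm (real (k + c) ^ m * r ^ k)"
      using r by simp
  qed (use r in auto)
qed

text \<open>Sort n by the exact power p^(i + j) dividing it. Multiplicativity splits off that power,
  the mean square of the cofactors gains p^(i + j), and p^i \<ge> 2^i dominates the polynomial
  growth at prime powers. As j \<le> 2, the growth (i + j + 1)^d is at most (i + 3)^d, so the
  constant is uniform in p.\<close>

lemma mean_square_multiples_prime_power:
  fixes f :: "nat \<Rightarrow> complex"
  assumes f_mult: "\<And>m n. 1 \<le> m \<Longrightarrow> 1 \<le> n \<Longrightarrow> coprime m n \<Longrightarrow> f (m * n) = f m * f n"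
    and pow: "\<And>p k. prime p \<Longrightarrow> cmod (f (p ^ k)) \<le> real (k + 1) ^ d"
    and mean: "\<And>N. (\<Sum>n=1..N. (cmod (f n))\<^sup>2) \<le> C * real N"
    and p: "prime p" and j: "j \<le> 2" and C: "C \<ge> 0"
  shows "(\<Sum>n | 1 \<le> n \<and> n \<le> N \<and> p ^ j dvd n. (cmod (f n))\<^sup>2)
           \<le> (\<Sum>k. real (k + 3) ^ (2 * d) / 2 ^ k) * C * real N / real p ^ j"
proof -
  let ?S = "{n. 1 \<le> n \<and> n \<le> N \<and> p ^ j dvd n}"
  let ?t = "\<lambda>k. real (k + 3) ^ (2 * d) / 2 ^ k"
  have p2: "p \<ge> 2" using p by (rule prime_ge_2_nat)
  have summ: "summable ?t"
    using summable_poly_geometric[of "1/2" 3 "2 * d"] by (simp add: power_one_over)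
  have finS: "finite ?S" by (rule finite_subset[of _ "{..N}"]) auto
  define v where "v n = multiplicity p n - j" for n
  have mult_ge: "multiplicity p n \<ge> j" if "n \<in> ?S" for n
    using that p2 by (intro multiplicity_geI) auto
  have vS: "v n \<in> {..N}" if "n \<in> ?S" for n
  proof -
    have "p ^ multiplicity p n dvd n" by (rule multiplicity_dvd)
    then have "p ^ multiplicity p n \<le> N" using that by (auto dest!: dvd_imp_le)
    moreover have "multiplicity p n < p ^ multiplicity p n" using p2 by (intro less_exp[THEN less_le_trans] power_mono) auto
    ultimately show ?thesis by (simp add: v_def)
  qed
  have inner: "(\<Sum>n | n \<in> ?S \<and> v n = i. (cmod (f n))\<^sup>2) \<le> ?t i * (C * real N / real p ^ j)" for i
  proof -
    let ?T = "{n. n \<in> ?S \<and> v n = i}"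
    let ?k = "i + j"
    have n_eq: "n = p ^ ?k * (n div p ^ ?k)" "\<not> p dvd n div p ^ ?k" "n div p ^ ?k \<in> {1..N div p ^ ?k}" if "n \<in> ?T" for n
    proof -
      have k: "?k = multiplicity p n" using that mult_ge[of n] by (auto simp: v_def)
      show eq: "n = p ^ ?k * (n div p ^ ?k)" unfolding k by (simp add: multiplicity_dvd)
      show "\<not> p dvd n div p ^ ?k" unfolding k using that p2
        by (intro multiplicity_decompose) (auto)
      have "n div p ^ ?k \<noteq> 0" using eq that by (intro notI) auto
      moreover have "n div p ^ ?k \<le> N div p ^ ?k" using that by (intro div_le_mono) auto
      ultimately show "n div p ^ ?k \<in> {1..N div p ^ ?k}" by auto
    qed
    have inj: "inj_on (\<lambda>n. n div p ^ ?k) ?T"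
    proof (rule inj_onI)
      fix a b assume ab: "a \<in> ?T" "b \<in> ?T" "a div p ^ ?k = b div p ^ ?k"
      have "a = p ^ ?k * (a div p ^ ?k)" by (rule n_eq(1)[OF ab(1)])
      also have "\<dots> = p ^ ?k * (b div p ^ ?k)" by (simp only: ab(3))
      also have "\<dots> = b" by (rule n_eq(1)[OF ab(2), symmetric])
      finally show "a = b" .
    qed
    have fn: "(cmod (f n))\<^sup>2 = (cmod (f (p ^ ?k)))\<^sup>2 * (cmod (f (n div p ^ ?k)))\<^sup>2" if "n \<in> ?T" for n
    proof -
      have "coprime (p ^ ?k) (n div p ^ ?k)"
        unfolding coprime_power_left_iff using prime_imp_coprime[OF p n_eq(2)[OF that]] by blast
      then have "f (p ^ ?k * (n div p ^ ?k)) = f (p ^ ?k) * f (n div p ^ ?k)"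
        using n_eq(3)[OF that] p2 by (intro f_mult) auto
      moreover have "f n = f (p ^ ?k * (n div p ^ ?k))"
        by (rule arg_cong[OF n_eq(1)[OF that]])
      ultimately show ?thesis by (simp only: norm_mult power_mult_distrib)
    qed
    have "(\<Sum>n\<in>?T. (cmod (f n))\<^sup>2) = (cmod (f (p ^ ?k)))\<^sup>2 * (\<Sum>n\<in>?T. (cmod (f (n div p ^ ?k)))\<^sup>2)"
      by (subst sum_distrib_left, rule sum.cong[OF refl], rule fn)
    also have "(\<Sum>n\<in>?T. (cmod (f (n div p ^ ?k)))\<^sup>2) = (\<Sum>m\<in>(\<lambda>n. n div p ^ ?k) ` ?T. (cmod (f m))\<^sup>2)"
      by (rule sum.reindex[OF inj, unfolded o_def, symmetric])
    also have "\<dots> \<le> (\<Sum>m=1..N div p ^ ?k. (cmod (f m))\<^sup>2)"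
      by (rule sum_mono2[OF finite_atLeastAtMost image_subsetI[OF n_eq(3)]]) simp_all
    also have "\<dots> \<le> C * real (N div p ^ ?k)" by (rule mean)
    also have "\<dots> \<le> C * (real N / real (p ^ ?k))"
      using C of_nat_div_le_of_nat[of N "p ^ ?k", where ?'a = real] by (intro mult_left_mono)
    also have "(cmod (f (p ^ ?k)))\<^sup>2 * (C * (real N / real (p ^ ?k)))
        \<le> (real (i + 3) ^ d)\<^sup>2 * (C * (real N / (2 ^ i * real p ^ j)))"
    proof (intro mult_mono power_mono divide_left_mono)
      have "real (?k + 1) ^ d \<le> real (i + 3) ^ d" using j by (intro power_mono) auto
      then show "cmod (f (p ^ ?k)) \<le> real (i + 3) ^ d" using pow[OF p, of ?k] by linarith
      have "(2::real) ^ i \<le> real p ^ i" using p2 by (intro power_mono) auto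
      then show "2 ^ i * real p ^ j \<le> real (p ^ ?k)" by (simp add: power_add mult_right_mono)
    qed (use C p2 in auto)
    also have "(real (i + 3) ^ d)\<^sup>2 * (C * (real N / (2 ^ i * real p ^ j))) = ?t i * (C * real N / real p ^ j)"
      by (simp add: power_even_eq)
    finally show ?thesis by (simp add: mult_left_mono)
  qed
  have "(\<Sum>n\<in>?S. (cmod (f n))\<^sup>2) = (\<Sum>i\<le>N. \<Sum>n | n \<in> ?S \<and> v n = i. (cmod (f n))\<^sup>2)"
    by (rule sum.group[OF finS finite_atMost image_subsetI[OF vS], symmetric])
  also have "\<dots> \<le> (\<Sum>i\<le>N. ?t i * (C * real N / real p ^ j))" by (intro sum_mono inner)
  also have "\<dots> = (\<Sum>i\<le>N. ?t i) * (C * real N / real p ^ j)"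
    by (rule sum_distrib_right[symmetric])
  also have "\<dots> \<le> suminf ?t * (C * real N / real p ^ j)"
    using summ C by (intro mult_right_mono sum_le_suminf) auto
  finally show ?thesis by (simp add: mult_ac)
qed

lemma sum_inverse_squares_tail_le:
  assumes "finite I" "\<And>p. p \<in> I \<Longrightarrow> M \<le> p" "M \<ge> (2::nat)"
  shows "(\<Sum>p\<in>I. 1 / (real p)\<^sup>2) \<le> 2 / real M"
proof -
  define n where "n = Max (insert 0 I)"
  have n: "p \<le> n" if "p \<in> I" for p
    unfolding n_def using assms(1) that by (intro Max_ge) auto
  have *: "(\<Sum>p\<in>{M..n}. 1 / (real p)\<^sup>2) \<le> 2 / real M - 1 / real n" if "M \<le> n" for n
    using that
  proof (induction n rule: dec_induct)
    case base
    have "1 / (real M)\<^sup>2 \<le> 1 / real M"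
      using assms(3) by (intro divide_left_mono self_le_power) auto
    then show ?case by simp
  next
    case (step n)
    have "n > 0" using step(1) assms(3) by linarith
    then have "1 / (real (Suc n))\<^sup>2 \<le> 1 / real n - 1 / real (Suc n)"
      by (simp add: divide_simps power2_eq_square)
    moreover have "(\<Sum>p\<in>{M..Suc n}. 1 / (real p)\<^sup>2) = (\<Sum>p\<in>{M..n}. 1 / (real p)\<^sup>2) + 1 / (real (Suc n))\<^sup>2"
      using step(1) by simp
    ultimately show ?case using step.IH by linarith
  qed
  have "(\<Sum>p\<in>I. 1 / (real p)\<^sup>2) \<le> (\<Sum>p\<in>{M..max M n}. 1 / (real p)\<^sup>2)"
    using assms(2) n by (intro sum_mono2) (auto simp: le_max_iff_disj)
  also have "\<dots> \<le> 2 / real M - 1 / real (max M n)" by (rule *) simp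
  also have "\<dots> \<le> 2 / real M" by simp
  finally show ?thesis .
qed

context ramare
begin

text \<open>Grouping the primes into the cells \<open>\<kappa> ^ j \<le> p < \<kappa> ^ (j + 1)\<close> and letting the cofactor run up to
  \<open>x / \<kappa> ^ j\<close> decouples the two sums, at the price of terms with \<open>x < n \<le> \<kappa> * x\<close>.\<close>

lemma ramare_large_sieve:
  fixes g :: "'k \<Rightarrow> nat \<Rightarrow> complex" and jj :: "nat \<Rightarrow> nat" and x :: nat and \<kappa> :: real
  defines "N \<equiv> \<lambda>j. nat \<lfloor>real x / \<kappa> ^ j\<rfloor>" and "x' \<equiv> nat \<lfloor>\<kappa> * real x\<rfloor>"
  assumes g_mult: "\<And>k m n. k \<in> K \<Longrightarrow> g k (m * n) = g k m * g k n"
    and LS: "\<And>M b. M \<ge> D \<Longrightarrow> (\<Sum>k\<in>K. (cmod (\<Sum>n=1..M. b n * g k n))\<^sup>2) \<le> B * real M * (\<Sum>n=1..M. (cmod (b n))\<^sup>2)"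
    and pow: "\<And>p k. prime p \<Longrightarrow> cmod (f (p ^ k)) \<le> real (k + 1) ^ d"
    and mean: "\<And>N. (\<Sum>n=1..N. (cmod (f n))\<^sup>2) \<le> C * real N"
    and B: "B \<ge> 0" and C: "C \<ge> 0"
    and \<kappa>: "1 < \<kappa>" "\<kappa> \<le> 2"
    and J: "finite J" "\<And>p. p \<in> I \<Longrightarrow> jj p \<in> J" "\<And>j. j \<in> J \<Longrightarrow> D \<le> N j" and D: "D \<le> x"
    and jj: "\<And>p. p \<in> I \<Longrightarrow> \<kappa> ^ jj p \<le> real p \<and> real p < \<kappa> ^ (jj p + 1)"
    and Q: "\<And>k j. k \<in> K \<Longrightarrow> j \<in> J \<Longrightarrow> cmod (\<Sum>p | p \<in> I \<and> jj p = j. f p * g k p) \<le> s * \<kappa> ^ j"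
    and M: "\<And>p. p \<in> I \<Longrightarrow> M \<le> p" "M \<ge> 2"
    and C1: "C1 = (\<Sum>k. real (k + 3) ^ (2 * d) / 2 ^ k)"
  shows "(\<Sum>k\<in>K. (cmod (\<Sum>n=1..x. f n * g k n))\<^sup>2)
      \<le> 2 * (B * (2 * real x) * (2 * (\<Sum>n | 1 \<le> n \<and> n \<le> x \<and> omega_in I n = 0. (cmod (f n))\<^sup>2)
            + 2 * (\<Sum>n | x < n \<and> real n \<le> \<kappa> * real x. (cmod (f n))\<^sup>2)
            + 2 * ((1 + A\<^sup>2) * C1 * C * (2 * real x) * (2 / real M))))
        + 2 * ((real (card J))\<^sup>2 * s\<^sup>2 * B * C * (real x)\<^sup>2)"
proof -
  \<comment> \<open>The primes whose product with the cofactor \<open>n div p\<close> survives the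
    decoupling: all primes of \<open>I\<close> dividing n if n \<le> x, possibly fewer for larger
    n.\<close>
  define P where "P n = {p\<in>I. p dvd n \<and> n div p \<le> N (jj p)}" for n
  define Mc where "Mc n = (\<Sum>p\<in>P n. f p * weight (n div p))" for n
  \<comment> \<open>What the decoupled sum misses or adds. It is small in mean square, so the large
    sieve alone handles it.\<close>
  define \<Delta> where "\<Delta> n = (if n \<le> x then f n else 0) - Mc n" for n
  define QQ where "QQ k j = (\<Sum>p | p \<in> I \<and> jj p = j. f p * g k p)" for k j
  define R where "R k j = (\<Sum>m=1..N j. weight m * g k m)" for k j
  have \<kappa>j: "\<kappa> ^ j \<ge> 1" for j using \<kappa> by (simp add: one_le_power)
  have xx': "x \<le> x'"
  proof -
    have "1 * real x \<le> \<kappa> * real x" using \<kappa> by (intro mult_right_mono) auto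
    then show ?thesis unfolding x'_def by (simp add: le_nat_floor)
  qed
  have x'_iff: "n \<le> x' \<longleftrightarrow> real n \<le> \<kappa> * real x" for n
    unfolding x'_def using \<kappa> by (simp add: le_nat_iff le_floor_iff)
  have x'2: "real x' \<le> 2 * real x"
  proof -
    have "real x' \<le> \<kappa> * real x" using x'_iff[of x'] by simp
    also have "\<dots> \<le> 2 * real x" using \<kappa> by (intro mult_right_mono) auto
    finally show ?thesis .
  qed
  have N_iff: "m \<le> N j \<longleftrightarrow> real m * \<kappa> ^ j \<le> real x" for m j
    unfolding N_def using \<kappa>j[of j] by (simp add: le_nat_iff le_floor_iff pos_le_divide_eq)
  have Nx: "real (N j) * \<kappa> ^ j \<le> real x" for j using N_iff[of "N j" j] by simp

  \<comment> \<open>Reindexing by n = p * m: the bound m \<le> N (jj p) puts n below \<kappa> * x,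
    hence the longer range up to x'.\<close>
  have main: "(\<Sum>j\<in>J. QQ k j * R k j) = (\<Sum>n=1..x'. Mc n * g k n)" if k: "k \<in> K" for k
  proof -
    have "(\<Sum>j\<in>J. QQ k j * R k j) = (\<Sum>j\<in>J. \<Sum>p | p \<in> I \<and> jj p = j. f p * g k p * R k (jj p))"
      by (simp add: QQ_def sum_distrib_right)
    also have "\<dots> = (\<Sum>p\<in>I. f p * g k p * R k (jj p))"
      using J finite_I by (intro sum.group) auto
    also have "\<dots> = (\<Sum>p\<in>I. \<Sum>n | n \<in> {1..x'} \<and> p \<in> P n. f p * weight (n div p) * g k n)"
    proof (intro sum.cong refl)
      fix p assume p: "p \<in> I"
      have p0: "p > 0" using primes[OF p] prime_gt_0_nat by blast
      have "{n. n \<in> {1..x'} \<and> p \<in> P n} = (\<lambda>m. p * m) ` {1..N (jj p)}"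
      proof (intro equalityI subsetI)
        fix n assume n: "n \<in> {n. n \<in> {1..x'} \<and> p \<in> P n}"
        then have "n = p * (n div p)" "n div p \<le> N (jj p)" by (auto simp: P_def)
        moreover have "n div p \<noteq> 0" using n \<open>n = p * (n div p)\<close> by (intro notI) auto
        ultimately show "n \<in> (\<lambda>m. p * m) ` {1..N (jj p)}" by (intro image_eqI[of _ _ "n div p"]) auto
      next
        fix n assume "n \<in> (\<lambda>m. p * m) ` {1..N (jj p)}"
        then obtain m where "m \<in> {1..N (jj p)}" "n = p * m" by blast
        then have m: "n = p * m" "1 \<le> m" "m \<le> N (jj p)" by auto
        have "real n = real p * real m" by (simp add: m)
        also have "\<dots> \<le> \<kappa> ^ (jj p + 1) * real m" using jj[OF p] by (intro mult_right_mono) auto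
        also have "\<dots> = \<kappa> * (real m * \<kappa> ^ jj p)" by simp
        also have "\<dots> \<le> \<kappa> * real x" using m \<kappa> by (intro mult_left_mono) (auto simp: N_iff)
        finally have "n \<le> x'" by (simp add: x'_iff)
        moreover have "n \<ge> 1" using m p0 by simp
        ultimately show "n \<in> {n. n \<in> {1..x'} \<and> p \<in> P n}" using p p0 m by (auto simp: P_def)
      qed
      then have "(\<Sum>n | n \<in> {1..x'} \<and> p \<in> P n. f p * weight (n div p) * g k n)
          = (\<Sum>m=1..N (jj p). f p * weight m * g k (p * m))"
        using p0 by (simp add: sum.reindex inj_on_def)
      also have "\<dots> = f p * g k p * R k (jj p)"
        by (simp add: R_def sum_distrib_left g_mult[OF k] mult_ac)
      finally show "f p * g k p * R k (jj p) = (\<Sum>n | n \<in> {1..x'} \<and> p \<in> P n. f p * weight (n div p) * g k n)" ..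
    qed
    also have "\<dots> = (\<Sum>n=1..x'. \<Sum>p | p \<in> I \<and> p \<in> P n. f p * weight (n div p) * g k n)"
      by (rule sum.swap_restrict[OF finite_I finite_atLeastAtMost])
    also have "\<dots> = (\<Sum>n=1..x'. Mc n * g k n)"
      unfolding Mc_def sum_distrib_right by (intro sum.cong) (auto simp: P_def)
    finally show ?thesis .
  qed
  have split: "(\<Sum>n=1..x. f n * g k n) = (\<Sum>n=1..x'. \<Delta> n * g k n) + (\<Sum>j\<in>J. QQ k j * R k j)" if "k \<in> K" for k
  proof -
    have "(\<Sum>n=1..x. f n * g k n) = (\<Sum>n=1..x'. (if n \<le> x then f n else 0) * g k n)"
      using xx' by (intro sum.mono_neutral_cong_left) auto
    then show ?thesis unfolding main[OF that] \<Delta>_def by (simp add: algebra_simps sum_subtractf)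
  qed

  have \<Delta>_bound: "(cmod (\<Delta> n))\<^sup>2 \<le> 2 * (if n \<le> x \<and> omega_in I n = 0 then (cmod (f n))\<^sup>2 else 0)
      + 2 * (if x < n then (cmod (f n))\<^sup>2 else 0) + 2 * sq_err n" if n: "n \<ge> 1" for n
  proof (cases "n \<le> x")
    case True
    have "P n = {p\<in>I. p dvd n}"
    proof -
      have "n div p \<le> N (jj p)" if p: "p \<in> I" "p dvd n" for p
      proof -
        have "real (n div p) * \<kappa> ^ jj p \<le> real (n div p) * real p"
          using jj[OF p(1)] by (intro mult_left_mono) auto
        also have "\<dots> = real n" using p(2) by (simp flip: of_nat_mult)
        finally show ?thesis using True by (simp add: N_iff)
      qed
      then show ?thesis by (auto simp: P_def)
    qed
    then have \<Delta>: "\<Delta> n = f n - (\<Sum>p | p \<in> I \<and> p dvd n. f p * weight (n div p))"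
      using True by (simp add: \<Delta>_def Mc_def)
    show ?thesis
    proof (cases "omega_in I n = 0")
      case True
      then have "{p\<in>I. p dvd n} = {}" using finite_I by (simp add: omega_in_def)
      then have "\<Delta> n = f n" unfolding \<Delta> by (metis (no_types, lifting) diff_zero sum.empty)
      then show ?thesis using True \<open>n \<le> x\<close> sq_err_nonneg[of n] by simp
    next
      case False
      then show ?thesis using full_divisor_sum_error[OF n] \<open>n \<le> x\<close> unfolding \<Delta> by simp
    qed
  next
    case False
    then have "(cmod (\<Delta> n))\<^sup>2 = (cmod (\<Sum>p\<in>P n. f p * weight (n div p)))\<^sup>2"
      by (simp add: \<Delta>_def Mc_def)
    also have "\<dots> \<le> 2 * (cmod (f n))\<^sup>2 + 2 * sq_err n"
      by (rule partial_divisor_sum_bound[OF n]) (auto simp: P_def)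
    finally show ?thesis using False by simp
  qed

  have C1_0: "C1 \<ge> 0"
    unfolding C1 using summable_poly_geometric[of "1/2" 3 "2 * d"]
    by (intro suminf_nonneg) (auto simp: power_one_over)
  have sq: "(\<Sum>n=1..x'. sq_err n) \<le> (1 + A\<^sup>2) * C1 * C * (2 * real x) * (2 / real M)"
  proof -
    have "(\<Sum>n=1..x'. sq_err n) = (\<Sum>p\<in>I. \<Sum>n | n \<in> {1..x'} \<and> p\<^sup>2 dvd n. (cmod (f n))\<^sup>2 + A\<^sup>2 * (cmod (f (n div p)))\<^sup>2)"
      unfolding sq_err_def by (rule sum.swap_restrict[OF finite_atLeastAtMost finite_I])
    also have "\<dots> \<le> (\<Sum>p\<in>I. (1 + A\<^sup>2) * C1 * C * real x' * (1 / (real p)\<^sup>2))"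
    proof (intro sum_mono)
      fix p assume p: "p \<in> I"
      have pp: "prime p" and p0: "p > 0" using primes[OF p] prime_gt_0_nat by auto
      have a: "(\<Sum>n | n \<in> {1..x'} \<and> p\<^sup>2 dvd n. (cmod (f n))\<^sup>2) \<le> C1 * C * real x' / (real p)\<^sup>2"
        using mean_square_multiples_prime_power[OF f_mult pow mean pp, of 2 x'] C by (simp add: C1)
      \<comment> \<open>As p^2 divides n, the quotient is still a multiple of p and at most x' / p;
        length and divisibility each give one factor 1/p.\<close>
      have "(\<Sum>n | n \<in> {1..x'} \<and> p\<^sup>2 dvd n. (cmod (f (n div p)))\<^sup>2)
          = (\<Sum>m\<in>(\<lambda>n. n div p) ` {n. n \<in> {1..x'} \<and> p\<^sup>2 dvd n}. (cmod (f m))\<^sup>2)"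
      proof (subst sum.reindex)
        show "inj_on (\<lambda>n. n div p) {n. n \<in> {1..x'} \<and> p\<^sup>2 dvd n}"
        proof (rule inj_onI)
          fix a b assume ab: "a \<in> {n. n \<in> {1..x'} \<and> p\<^sup>2 dvd n}" "b \<in> {n. n \<in> {1..x'} \<and> p\<^sup>2 dvd n}" "a div p = b div p"
          then have "p dvd a" "p dvd b" by (auto simp: power2_eq_square dest: dvd_mult_left)
          then show "a = b" using ab(3) dvd_div_eq_cancel by blast
        qed
      qed simp
      also have "\<dots> \<le> (\<Sum>m | 1 \<le> m \<and> m \<le> x' div p \<and> p ^ 1 dvd m. (cmod (f m))\<^sup>2)"
      proof (rule sum_mono2)
        show "(\<lambda>n. n div p) ` {n. n \<in> {1..x'} \<and> p\<^sup>2 dvd n} \<subseteq> {m. 1 \<le> m \<and> m \<le> x' div p \<and> p ^ 1 dvd m}"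
        proof (rule image_subsetI)
          fix n assume "n \<in> {n. n \<in> {1..x'} \<and> p\<^sup>2 dvd n}"
          then obtain k where k: "n = p * (p * k)" "1 \<le> n" "n \<le> x'"
            by (auto simp: power2_eq_square dvd_def mult.assoc)
          have "n div p = p * k" using k p0 by simp
          moreover have "n div p \<le> x' div p" by (rule div_le_mono[OF k(3)])
          moreover have "n div p \<noteq> 0" using k \<open>n div p = p * k\<close> by (intro notI) auto
          ultimately show "n div p \<in> {m. 1 \<le> m \<and> m \<le> x' div p \<and> p ^ 1 dvd m}" by simp
        qed
      qed auto
      also have "\<dots> \<le> C1 * C * real (x' div p) / real p ^ 1"
        using mean_square_multiples_prime_power[OF f_mult pow mean pp, of 1 "x' div p"] C by (simp add: C1)
      also have "\<dots> \<le> C1 * C * (real x' / real p) / real p ^ 1"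
        using C C1_0 of_nat_div_le_of_nat[of x' p, where ?'a = real] by (intro divide_right_mono mult_left_mono) auto
      also have "\<dots> = C1 * C * real x' / (real p)\<^sup>2" by (simp add: power2_eq_square)
      finally have b: "(\<Sum>n | n \<in> {1..x'} \<and> p\<^sup>2 dvd n. (cmod (f (n div p)))\<^sup>2) \<le> C1 * C * real x' / (real p)\<^sup>2" .
      have "(\<Sum>n | n \<in> {1..x'} \<and> p\<^sup>2 dvd n. (cmod (f n))\<^sup>2 + A\<^sup>2 * (cmod (f (n div p)))\<^sup>2)
          \<le> C1 * C * real x' / (real p)\<^sup>2 + A\<^sup>2 * (C1 * C * real x' / (real p)\<^sup>2)"
        unfolding sum.distrib sum_distrib_left[symmetric] using a b by (intro add_mono mult_left_mono) auto
      then show "(\<Sum>n | n \<in> {1..x'} \<and> p\<^sup>2 dvd n. (cmod (f n))\<^sup>2 + A\<^sup>2 * (cmod (f (n div p)))\<^sup>2)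
          \<le> (1 + A\<^sup>2) * C1 * C * real x' * (1 / (real p)\<^sup>2)"
        by (simp add: algebra_simps add_divide_distrib)
    qed
    also have "\<dots> = (1 + A\<^sup>2) * C1 * C * real x' * (\<Sum>p\<in>I. 1 / (real p)\<^sup>2)"
      by (simp only: sum_distrib_left)
    also have "\<dots> \<le> (1 + A\<^sup>2) * C1 * C * (2 * real x) * (2 / real M)"
    proof (rule mult_mono)
      have c0: "0 \<le> (1 + A\<^sup>2) * C1 * C" using C C1_0 by simp
      then show "(1 + A\<^sup>2) * C1 * C * real x' \<le> (1 + A\<^sup>2) * C1 * C * (2 * real x)"
        by (rule mult_left_mono[OF x'2])
      show "(\<Sum>p\<in>I. 1 / (real p)\<^sup>2) \<le> 2 / real M"
        by (rule sum_inverse_squares_tail_le[OF finite_I M(1) M(2)])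
      show "0 \<le> (1 + A\<^sup>2) * C1 * C * (2 * real x)"
        by (rule mult_nonneg_nonneg[OF c0]) simp
      show "0 \<le> (\<Sum>p\<in>I. 1 / (real p)\<^sup>2)" by (simp add: sum_nonneg)
    qed
    finally show ?thesis .
  qed
  have \<Delta>_sum: "(\<Sum>n=1..x'. (cmod (\<Delta> n))\<^sup>2) \<le> 2 * (\<Sum>n | 1 \<le> n \<and> n \<le> x \<and> omega_in I n = 0. (cmod (f n))\<^sup>2)
            + 2 * (\<Sum>n | x < n \<and> real n \<le> \<kappa> * real x. (cmod (f n))\<^sup>2)
            + 2 * ((1 + A\<^sup>2) * C1 * C * (2 * real x) * (2 / real M))" (is "_ \<le> ?E")
  proof -
    have "(\<Sum>n=1..x'. (cmod (\<Delta> n))\<^sup>2) \<le> (\<Sum>n=1..x'. 2 * (if n \<le> x \<and> omega_in I n = 0 then (cmod (f n))\<^sup>2 else 0)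
      + 2 * (if x < n then (cmod (f n))\<^sup>2 else 0) + 2 * sq_err n)"
      by (intro sum_mono \<Delta>_bound) auto
    also have "\<dots> = 2 * (\<Sum>n=1..x'. (if n \<le> x \<and> omega_in I n = 0 then (cmod (f n))\<^sup>2 else 0))
      + 2 * (\<Sum>n=1..x'. (if x < n then (cmod (f n))\<^sup>2 else 0)) + 2 * (\<Sum>n=1..x'. sq_err n)"
      by (simp only: sum.distrib sum_distrib_left)
    also have "(\<Sum>n=1..x'. (if n \<le> x \<and> omega_in I n = 0 then (cmod (f n))\<^sup>2 else 0))
        = (\<Sum>n | 1 \<le> n \<and> n \<le> x \<and> omega_in I n = 0. (cmod (f n))\<^sup>2)"
    proof -
      have "{n. 1 \<le> n \<and> n \<le> x \<and> omega_in I n = 0} = {n\<in>{1..x'}. n \<le> x \<and> omega_in I n = 0}"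
        using xx' by auto
      then show ?thesis by (simp only: sum.inter_filter[OF finite_atLeastAtMost])
    qed
    also have "(\<Sum>n=1..x'. (if x < n then (cmod (f n))\<^sup>2 else 0))
        = (\<Sum>n | x < n \<and> real n \<le> \<kappa> * real x. (cmod (f n))\<^sup>2)"
    proof -
      have "{n. x < n \<and> real n \<le> \<kappa> * real x} = {n\<in>{1..x'}. x < n}"
        unfolding x'_iff[symmetric] by auto
      then show ?thesis by (simp only: sum.inter_filter[OF finite_atLeastAtMost])
    qed
    finally show ?thesis using sq by linarith
  qed

  have part1: "(\<Sum>k\<in>K. (cmod (\<Sum>n=1..x'. \<Delta> n * g k n))\<^sup>2) \<le> B * (2 * real x) * ?E"
  proof -
    have "(\<Sum>k\<in>K. (cmod (\<Sum>n=1..x'. \<Delta> n * g k n))\<^sup>2) \<le> B * real x' * (\<Sum>n=1..x'. (cmod (\<Delta> n))\<^sup>2)"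
      using D xx' by (intro LS) auto
    also have "\<dots> \<le> B * (2 * real x) * ?E"
      using \<Delta>_sum x'2 B by (intro mult_mono sum_nonneg) auto
    finally show ?thesis .
  qed
  \<comment> \<open>Cauchy-Schwarz over the cells, the pointwise bound for the prime factor, the
    large sieve for the cofactor. Since \<open>N j * \<kappa> ^ j\<close> is at most x, every cell
    costs the same.\<close>
  have part2: "(\<Sum>k\<in>K. (cmod (\<Sum>j\<in>J. QQ k j * R k j))\<^sup>2) \<le> (real (card J))\<^sup>2 * s\<^sup>2 * B * C * (real x)\<^sup>2"
  proof -
    have "(\<Sum>k\<in>K. (cmod (\<Sum>j\<in>J. QQ k j * R k j))\<^sup>2)
        \<le> (\<Sum>k\<in>K. real (card J) * (\<Sum>j\<in>J. (s * \<kappa> ^ j)\<^sup>2 * (cmod (R k j))\<^sup>2))"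
    proof (intro sum_mono order.trans[OF cmod_sum_squared_le] mult_left_mono)
      fix k j assume kj: "k \<in> K" "j \<in> J"
      have "(cmod (QQ k j))\<^sup>2 \<le> (s * \<kappa> ^ j)\<^sup>2"
        unfolding QQ_def by (intro power_mono Q kj) auto
      then show "(cmod (QQ k j * R k j))\<^sup>2 \<le> (s * \<kappa> ^ j)\<^sup>2 * (cmod (R k j))\<^sup>2"
        by (simp add: norm_mult power_mult_distrib mult_right_mono)
    qed auto
    also have "\<dots> = real (card J) * (\<Sum>j\<in>J. (s * \<kappa> ^ j)\<^sup>2 * (\<Sum>k\<in>K. (cmod (R k j))\<^sup>2))"
      unfolding sum_distrib_left[symmetric] by (subst sum.swap) (simp only: sum_distrib_left)
    also have "\<dots> \<le> real (card J) * (\<Sum>j\<in>J. s\<^sup>2 * B * C * (real x)\<^sup>2)"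
    proof (intro mult_left_mono sum_mono)
      fix j assume j: "j \<in> J"
      have "(\<Sum>k\<in>K. (cmod (R k j))\<^sup>2) \<le> B * real (N j) * (\<Sum>m=1..N j. (cmod (weight m))\<^sup>2)"
        unfolding R_def by (rule LS[OF J(3)[OF j]])
      also have "\<dots> \<le> B * real (N j) * (C * real (N j))"
        using B by (intro mult_left_mono order.trans[OF sum_mono mean] power_mono cmod_weight_le) auto
      finally have "(s * \<kappa> ^ j)\<^sup>2 * (\<Sum>k\<in>K. (cmod (R k j))\<^sup>2) \<le> (s * \<kappa> ^ j)\<^sup>2 * (B * real (N j) * (C * real (N j)))"
        by (intro mult_left_mono) auto
      also have "\<dots> = s\<^sup>2 * B * C * (real (N j) * \<kappa> ^ j)\<^sup>2"
        by (simp add: power2_eq_square mult_ac)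
      also have "\<dots> \<le> s\<^sup>2 * B * C * (real x)\<^sup>2"
        using B C Nx[of j] \<kappa>j[of j] by (intro mult_left_mono power_mono) auto
      finally show "(s * \<kappa> ^ j)\<^sup>2 * (\<Sum>k\<in>K. (cmod (R k j))\<^sup>2) \<le> s\<^sup>2 * B * C * (real x)\<^sup>2" .
    qed auto
    also have "\<dots> = (real (card J))\<^sup>2 * s\<^sup>2 * B * C * (real x)\<^sup>2"
      by (simp add: power2_eq_square mult_ac)
    finally show ?thesis .
  qed
  have "(\<Sum>k\<in>K. (cmod (\<Sum>n=1..x. f n * g k n))\<^sup>2)
      \<le> (\<Sum>k\<in>K. 2 * (cmod (\<Sum>n=1..x'. \<Delta> n * g k n))\<^sup>2 + 2 * (cmod (\<Sum>j\<in>J. QQ k j * R k j))\<^sup>2)"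
    by (intro sum_mono, subst split) (assumption, rule cmod_add_squared_le)
  also have "\<dots> = 2 * (\<Sum>k\<in>K. (cmod (\<Sum>n=1..x'. \<Delta> n * g k n))\<^sup>2) + 2 * (\<Sum>k\<in>K. (cmod (\<Sum>j\<in>J. QQ k j * R k j))\<^sup>2)"
    by (simp only: sum.distrib sum_distrib_left)
  also have "\<dots> \<le> 2 * (B * (2 * real x) * ?E) + 2 * ((real (card J))\<^sup>2 * s\<^sup>2 * B * C * (real x)\<^sup>2)"
    by (intro add_mono mult_left_mono part1 part2) auto
  finally show ?thesis .
qed

end

section \<open>Euler parameters\<close>

text \<open>The complete homogeneous symmetric polynomial of degree \<open>r\<close> in
  \<open>d\<close> variables, in the form in which the framework gives
  \<open>lam (p ^ r)\<close>.\<close>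

definition complete_hom :: "nat \<Rightarrow> (nat \<Rightarrow> complex) \<Rightarrow> nat \<Rightarrow> complex" where
  "complete_hom d x r = (\<Sum>rs | length rs = d \<and> sum_list rs = r. \<Prod>j<d. x j ^ (rs ! j))"

lemma finite_compositions: "finite {rs :: nat list. length rs = d \<and> sum_list rs = r}"
proof (rule finite_subset)
  show "{rs :: nat list. length rs = d \<and> sum_list rs = r} \<subseteq> {rs. set rs \<subseteq> {..r} \<and> length rs = d}"
    using member_le_sum_list by force
qed (rule finite_lists_length_eq, simp)

lemma complete_hom_0: "complete_hom 0 x r = (if r = 0 then 1 else 0)"
proof -
  have "{rs :: nat list. length rs = 0 \<and> sum_list rs = r} = (if r = 0 then {[]} else {})" by auto
  then show ?thesis by (simp add: complete_hom_def)
qed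

lemma complete_hom_Suc:
  "complete_hom (Suc d) x r = (\<Sum>i\<le>r. x 0 ^ i * complete_hom d (\<lambda>j. x (Suc j)) (r - i))"
proof -
  let ?C = "\<lambda>d r. {rs :: nat list. length rs = d \<and> sum_list rs = r}"
  let ?t = "\<lambda>(i, rs). \<Prod>j<Suc d. x j ^ ((i # rs) ! j)"
  have bij: "bij_betw (\<lambda>(i, rs). i # rs) (Sigma {..r} (\<lambda>i. ?C d (r - i))) (?C (Suc d) r)"
    by (rule bij_betwI[where g = "\<lambda>rs. (hd rs, tl rs)"]) (auto simp: length_Suc_conv)
  have "complete_hom (Suc d) x r = (\<Sum>z\<in>Sigma {..r} (\<lambda>i. ?C d (r - i)). ?t z)"
    unfolding complete_hom_def using sum.reindex_bij_betw[OF bij, of "\<lambda>rs. \<Prod>j<Suc d. x j ^ (rs ! j)"]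
    by (simp add: case_prod_unfold)
  also have "\<dots> = (\<Sum>i\<le>r. \<Sum>rs\<in>?C d (r - i). \<Prod>j<Suc d. x j ^ ((i # rs) ! j))"
    using finite_compositions by (subst sum.Sigma) auto
  also have "\<dots> = (\<Sum>i\<le>r. x 0 ^ i * complete_hom d (\<lambda>j. x (Suc j)) (r - i))"
    by (intro sum.cong refl, simp only: prod.lessThan_Suc_shift complete_hom_def sum_distrib_left) simp
  finally show ?thesis .
qed

lemma complete_hom_at_0: "complete_hom d x 0 = 1"
  by (induction d arbitrary: x) (simp_all add: complete_hom_0 complete_hom_Suc)

lemma complete_hom_at_1: "complete_hom d x 1 = (\<Sum>j<d. x j)"
proof (induction d arbitrary: x)
  case (Suc d)
  then show ?case
    by (simp only: complete_hom_Suc sum.lessThan_Suc_shift) (simp add: complete_hom_at_0 complete_hom_Suc atMost_Suc)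
qed (simp add: complete_hom_0)

lemma complete_hom_rec:
  "complete_hom (Suc d) x (Suc r) = x 0 * complete_hom (Suc d) x r + complete_hom d (\<lambda>j. x (Suc j)) (Suc r)"
  unfolding complete_hom_Suc by (subst sum.atMost_Suc_shift) (simp add: sum_distrib_left mult_ac)

text \<open>Convergence is assumed for the whole series and no bound on the variables enters: by the
  recursion the series without the first variable inherits convergence. So a bound on the variables
  can be deduced from this identity without circularity.\<close>

lemma complete_hom_generating:
  assumes "summable (\<lambda>r. norm (complete_hom d x r * z ^ r))"
  shows "(\<Prod>j<d. 1 - x j * z) * (\<Sum>r. complete_hom d x r * z ^ r) = 1"
  using assms
proof (induction d arbitrary: x)
  case 0
  have "(\<lambda>r. complete_hom 0 x r * z ^ r) = (\<lambda>r. if r = 0 then 1 else 0)"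
    by (auto simp: complete_hom_0)
  then show ?case using sums_unique[OF sums_single[of 0 "\<lambda>_. 1 :: complex"]] by simp
next
  case (Suc d)
  let ?h = "complete_hom (Suc d) x" and ?g = "complete_hom d (\<lambda>j. x (Suc j))"
  let ?f = "\<lambda>r. ?h r * z ^ r"
  have sf: "summable ?f" using Suc.prems by (rule summable_norm_cancel)
  have g0: "?g 0 * z ^ 0 = ?f 0" by (simp add: complete_hom_at_0)
  have gS: "?g (Suc r) * z ^ Suc r = ?f (Suc r) - x 0 * z * ?f r" for r
    by (simp add: complete_hom_rec algebra_simps)
  have "summable (\<lambda>r. norm (?f (Suc r)))"
    using Suc.prems by (subst summable_Suc_iff[of "\<lambda>r. norm (?f r)"])
  then have "summable (\<lambda>r. norm (?f (Suc r)) + norm (x 0 * z) * norm (?f r))"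
    using Suc.prems by (intro summable_add summable_mult)
  then have "summable (\<lambda>r. norm (?g (Suc r) * z ^ Suc r))"
  proof (rule summable_comparison_test'[where N = 0])
    fix r
    show "norm (norm (?g (Suc r) * z ^ Suc r)) \<le> norm (?f (Suc r)) + norm (x 0 * z) * norm (?f r)"
      unfolding gS norm_mult[of "x 0 * z", symmetric] using norm_triangle_ineq4[of "?f (Suc r)" "x 0 * z * ?f r"] by simp
  qed
  then have sg: "summable (\<lambda>r. norm (?g r * z ^ r))"
    by (subst (asm) summable_Suc_iff[of "\<lambda>r. norm (?g r * z ^ r)"])
  have "(\<Sum>r. ?g r * z ^ r) = ?g 0 * z ^ 0 + (\<Sum>r. ?g (Suc r) * z ^ Suc r)"
    using suminf_split_head[OF summable_norm_cancel[OF sg]] by simp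
  also have "(\<Sum>r. ?g (Suc r) * z ^ Suc r) = (\<Sum>r. ?f (Suc r)) - x 0 * z * (\<Sum>r. ?f r)"
  proof -
    have "summable (\<lambda>r. ?f (Suc r))" using sf by (subst summable_Suc_iff[of ?f])
    from suminf_diff[OF this summable_mult[OF sf, of "x 0 * z"]] show ?thesis
      unfolding gS suminf_mult[OF sf] by simp
  qed
  also have "(\<Sum>r. ?f (Suc r)) = (\<Sum>r. ?f r) - ?f 0"
    by (rule suminf_split_head[OF sf])
  finally have "(\<Sum>r. ?g r * z ^ r) = (1 - x 0 * z) * (\<Sum>r. ?f r)"
    unfolding g0 by (simp add: algebra_simps)
  then show ?case using Suc.IH[OF sg]
    by (simp only: prod.lessThan_Suc_shift o_def) (simp add: mult_ac)
qed

text \<open>By polynomial growth the generating series converges in the open unit disc, so the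
  product of the 1 - x j * z has no zero there; a variable of modulus above 1 would produce the zero
  1 / x j.\<close>

lemma parameters_norm_le_1:
  assumes bd: "\<And>r. cmod (complete_hom d x r) \<le> real (r + 1) ^ m" and j: "j < d"
  shows "cmod (x j) \<le> 1"
proof (rule ccontr)
  assume "\<not> cmod (x j) \<le> 1"
  then have gt: "cmod (x j) > 1" by simp
  define z where "z = 1 / x j"
  have z: "cmod z < 1" using gt by (simp add: z_def norm_divide divide_less_eq)
  have "summable (\<lambda>r. real (r + 1) ^ m * cmod z ^ r)"
    using z by (intro summable_poly_geometric) auto
  then have "summable (\<lambda>r. norm (complete_hom d x r * z ^ r))"
  proof (rule summable_comparison_test'[where N = 0])
    fix r
    show "norm (norm (complete_hom d x r * z ^ r)) \<le> real (r + 1) ^ m * cmod z ^ r"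
      using mult_right_mono[OF bd[of r], of "cmod z ^ r"] by (simp add: norm_mult norm_power)
  qed
  from complete_hom_generating[OF this] have "(\<Prod>j<d. 1 - x j * z) \<noteq> 0"
    by (metis mult_zero_left zero_neq_one)
  moreover have "1 - x j * z = 0" using gt by (auto simp: z_def)
  ultimately show False using j by (metis finite_lessThan lessThan_iff prod_zero)
qed

text \<open>A crude count: each of the \<open>d\<close> factors is one of the r + 1 powers of p up
  to p^r.\<close>

lemma divisor_tau_prime_power_le:
  assumes p: "prime p"
  shows "divisor_tau d (p ^ r) \<le> (r + 1) ^ d"
proof -
  have "{ms. length ms = d \<and> prod_list ms = p ^ r} \<subseteq> {ms. set ms \<subseteq> (\<lambda>i. p ^ i) ` {..r} \<and> length ms = d}"
  proof
    fix ms assume ms: "ms \<in> {ms. length ms = d \<and> prod_list ms = p ^ r}"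
    have "m \<in> (\<lambda>i. p ^ i) ` {..r}" if "m \<in> set ms" for m
    proof -
      have "m dvd p ^ r" using ms prod_list_dvd[OF that] by auto
      then show ?thesis using p by (auto simp: divides_primepow_nat)
    qed
    then show "ms \<in> {ms. set ms \<subseteq> (\<lambda>i. p ^ i) ` {..r} \<and> length ms = d}" using ms by auto
  qed
  then have "divisor_tau d (p ^ r) \<le> card {ms. set ms \<subseteq> (\<lambda>i. p ^ i) ` {..r} \<and> length ms = d}"
    unfolding divisor_tau_def by (intro card_mono finite_lists_length_eq) auto
  also have "\<dots> = card ((\<lambda>i. p ^ i) ` {..r}) ^ d"
    by (rule card_lists_length_eq) auto
  also have "\<dots> \<le> (r + 1) ^ d"
    using card_image_le[of "{..r}" "\<lambda>i. p ^ i"] by (intro power_mono) auto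
  finally show ?thesis .
qed

section \<open>Newman's contour argument\<close>

lemma powr_increment:
  fixes y s :: real
  assumes "y > 0"
  obtains \<xi> where "y < \<xi>" "\<xi> < y + 1" "(y + 1) powr s - y powr s = s * \<xi> powr (s - 1)"
proof -
  have "\<exists>z. y < z \<and> z < y + 1 \<and> (y + 1) powr s - y powr s = (y + 1 - y) * (s * z powr (s - 1))"
    using assms by (intro MVT2) (auto intro!: has_real_derivative_powr[THEN DERIV_cong] simp: powr_diff)
  then show ?thesis using that by auto
qed

text \<open>The mean value theorem gives the comparison with the integral in a form that
  telescopes.\<close>

lemma powr_tail_term_le:
  assumes x: "x > 0" and n: "n \<ge> 1"
  shows "real (Suc n) powr (-1 - x) \<le> real n powr (-x) / x - real (Suc n) powr (-x) / x"
proof -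
  obtain \<xi> where \<xi>: "real n < \<xi>" "\<xi> < real n + 1" "(real n + 1) powr (-x) - real n powr (-x) = (-x) * \<xi> powr (-x - 1)"
  proof -
    have "real n > 0" using n by simp
    then show ?thesis using that by (rule powr_increment)
  qed
  have "(real n + 1) powr (-x - 1) \<le> \<xi> powr (-x - 1)"
    using \<xi> x n by (intro powr_mono2') auto
  then have "x * (real n + 1) powr (-x - 1) \<le> x * \<xi> powr (-x - 1)"
    using x by (intro mult_left_mono) auto
  then have "x * (real n + 1) powr (-x - 1) \<le> real n powr (-x) - (real n + 1) powr (-x)"
    using \<xi>(3) by linarith
  then have "(real n + 1) powr (-x - 1) \<le> (real n powr (-x) - (real n + 1) powr (-x)) / x"
    using x by (simp add: pos_le_divide_eq mult.commute)
  moreover have "-x - 1 = -1 - x" by simp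
  ultimately show ?thesis by (simp add: diff_divide_distrib add.commute)
qed

lemma powr_tail_telescope:
  assumes x: "x > 0"
  shows "(\<lambda>n. real (n + N) powr (-x) / x - real (Suc (n + N)) powr (-x) / x) sums (real N powr (-x) / x)"
proof -
  have "((\<lambda>y. y powr (-x)) \<longlongrightarrow> 0) at_top" using x by (intro tendsto_neg_powr filterlim_ident) auto
  then have "(\<lambda>n. real n powr (-x) / x) \<longlonglongrightarrow> 0 / x"
    by (intro tendsto_divide tendsto_const filterlim_compose[OF _ filterlim_real_sequentially]) (use x in auto)
  then have "(\<lambda>n. real (n + N) powr (-x) / x) \<longlonglongrightarrow> 0"
    using LIMSEQ_ignore_initial_segment[of _ _ N] by fastforce
  from telescope_sums'[OF this] show ?thesis by simp
qed

text \<open>The estimate for the part of the contour to the right of the imaginary axis; there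
  \<open>real N powr (- Re z)\<close> cancels against the growth of the kernel.\<close>

lemma norm_dirichlet_tail_le:
  fixes a :: "nat \<Rightarrow> complex"
  assumes x: "Re z > 0" and N: "N \<ge> 1" and a: "\<And>n. n \<ge> 1 \<Longrightarrow> cmod (a n) \<le> A"
    and F: "(\<lambda>n. a n * of_nat n powr (-1 - z)) sums F"
  shows "cmod (F - (\<Sum>n\<le>N. a n * of_nat n powr (-1 - z))) \<le> A * (real N powr (- Re z) / Re z)"
proof -
  let ?t = "\<lambda>n. a (n + Suc N) * of_nat (n + Suc N) powr (-1 - z)"
  let ?b = "\<lambda>n. A * (real (n + N) powr (- Re z) / Re z - real (Suc (n + N)) powr (- Re z) / Re z)"
  have "A \<ge> 0" using a[of 1] norm_ge_zero[of "a 1"] by linarith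
  have t: "?t sums (F - (\<Sum>n\<le>N. a n * of_nat n powr (-1 - z)))"
    using sums_split_initial_segment[OF F, of "Suc N"] by (simp add: lessThan_Suc_atMost)
  have b: "?b sums (A * (real N powr (- Re z) / Re z))"
    by (intro sums_mult powr_tail_telescope x)
  have tb: "cmod (?t n) \<le> ?b n" for n
  proof -
    have "cmod (?t n) = cmod (a (n + Suc N)) * real (Suc (n + N)) powr (-1 - Re z)"
      by (simp add: norm_mult norm_powr_real_powr del: of_nat_Suc of_nat_add)
    also have "\<dots> \<le> A * (real (n + N) powr (- Re z) / Re z - real (Suc (n + N)) powr (- Re z) / Re z)"
      using \<open>A \<ge> 0\<close> N by (intro mult_mono a powr_tail_term_le x) auto
    finally show ?thesis .
  qed
  show ?thesis
    using norm_suminf_le[of ?t ?b, OF tb sums_summable[OF b]]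
    unfolding sums_unique[OF t, symmetric] sums_unique[OF b, symmetric] .
qed

text \<open>For s \<ge> 1 the summand increases and the integral misses the last term, which is the
  origin of 1/N; for s < 1 the integral alone is enough.\<close>

lemma sum_powr_le:
  assumes s: "s > 0" and N: "N \<ge> 1"
  shows "(\<Sum>n=1..N. real n powr (s - 1)) \<le> real N powr s * (1 / s + 1 / real N)"
proof -
  have last: "real N powr (s - 1) = real N powr s * (1 / real N)" using N by (simp add: powr_diff)
  show ?thesis
  proof (cases "s \<ge> 1")
    case True
    have "(\<Sum>n=1..N. real n powr (s - 1)) \<le> real N powr s / s + real N powr (s - 1)"
      using N
    proof (induction N rule: nat_induct_at_least)
      case (Suc n)
      obtain \<xi> where \<xi>: "real n < \<xi>" "\<xi> < real n + 1" "(real n + 1) powr s - real n powr s = s * \<xi> powr (s - 1)"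
      proof -
        have "real n > 0" using Suc(1) by simp
        then show ?thesis using that by (rule powr_increment)
      qed
      have "real n powr (s - 1) \<le> \<xi> powr (s - 1)" using \<xi> True by (intro powr_mono2) auto
      then have "s * real n powr (s - 1) \<le> (real n + 1) powr s - real n powr s"
        using s unfolding \<xi>(3) by (intro mult_left_mono) auto
      then have "real n powr (s - 1) \<le> ((real n + 1) powr s - real n powr s) / s"
        using s by (simp add: pos_le_divide_eq mult.commute)
      then have "real n powr (s - 1) + real n powr s / s \<le> real (Suc n) powr s / s"
        by (simp add: diff_divide_distrib add.commute)
      then show ?case using Suc.IH by simp
    qed (use s in auto)
    then show ?thesis unfolding last by (simp add: algebra_simps)
  next
    case False
    have "(\<Sum>n=1..N. real n powr (s - 1)) \<le> real N powr s / s"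
      using N
    proof (induction N rule: nat_induct_at_least)
      case base
      then show ?case using s False by simp
    next
      case (Suc n)
      obtain \<xi> where \<xi>: "real n < \<xi>" "\<xi> < real n + 1" "(real n + 1) powr s - real n powr s = s * \<xi> powr (s - 1)"
      proof -
        have "real n > 0" using Suc(1) by simp
        then show ?thesis using that by (rule powr_increment)
      qed
      have "(real n + 1) powr (s - 1) \<le> \<xi> powr (s - 1)" using \<xi> False by (intro powr_mono2') auto
      then have "s * (real n + 1) powr (s - 1) \<le> (real n + 1) powr s - real n powr s"
        using s unfolding \<xi>(3) by (intro mult_left_mono) auto
      then have "(real n + 1) powr (s - 1) \<le> ((real n + 1) powr s - real n powr s) / s"
        using s by (simp add: pos_le_divide_eq mult.commute)
      then have "real (Suc n) powr (s - 1) + real n powr s / s \<le> real (Suc n) powr s / s"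
        by (simp add: diff_divide_distrib add.commute)
      then show ?case using Suc.IH by simp
    qed
    also have "\<dots> \<le> real N powr s * (1 / s + 1 / real N)"
      by (simp add: algebra_simps)
    finally show ?thesis .
  qed
qed

lemma norm_dirichlet_poly_le:
  fixes a :: "nat \<Rightarrow> complex"
  assumes x: "Re z < 0" and N: "N \<ge> 1" and a: "\<And>n. n \<ge> 1 \<Longrightarrow> cmod (a n) \<le> A"
  shows "cmod (\<Sum>n\<le>N. a n * of_nat n powr (-1 - z)) \<le> A * (real N powr (- Re z) * (1 / (- Re z) + 1 / real N))"
proof -
  have "A \<ge> 0" using a[of 1] norm_ge_zero[of "a 1"] by linarith
  have "(\<Sum>n\<le>N. a n * of_nat n powr (-1 - z)) = (\<Sum>n=1..N. a n * of_nat n powr (-1 - z))"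
  proof -
    have eq: "{..N} = insert 0 {1..N}" by auto
    show ?thesis unfolding eq by (subst sum.insert) simp_all
  qed
  also have "cmod \<dots> \<le> (\<Sum>n=1..N. A * real n powr (- Re z - 1))"
  proof (intro order.trans[OF norm_sum] sum_mono)
    fix n assume n: "n \<in> {1..N}"
    have "cmod (a n * of_nat n powr (-1 - z)) = cmod (a n) * real n powr (-1 - Re z)"
      by (simp add: norm_mult norm_powr_real_powr)
    also have "-1 - Re z = - Re z - 1" by simp
    also have "cmod (a n) * real n powr (- Re z - 1) \<le> A * real n powr (- Re z - 1)" using n by (intro mult_right_mono a) auto
    finally show "cmod (a n * of_nat n powr (-1 - z)) \<le> A * real n powr (- Re z - 1)" .
  qed
  also have "\<dots> \<le> A * (real N powr (- Re z) * (1 / (- Re z) + 1 / real N))"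
    unfolding sum_distrib_left[symmetric] using x N \<open>A \<ge> 0\<close> by (intro mult_left_mono sum_powr_le) auto
  finally show ?thesis .
qed

text \<open>Newman's kernel; the factor \<open>1 + z\<^sup>2 / R\<^sup>2\<close> vanishes at \<open>\<plusminus>\<i>R\<close>, where the estimates
  for the tail and for the partial sum blow up.\<close>

definition newman_kernel :: "real \<Rightarrow> nat \<Rightarrow> complex \<Rightarrow> complex" where
  "newman_kernel R N z = of_nat N powr z * (1 + z\<^sup>2 / of_real (R\<^sup>2)) / z"

text \<open>On these lines (Im z)^2 = R^2, so 1 + z^2/R^2 equals Re z times (Re z + 2 i Im z) / R^2.
  The factor |Re z| is what cancels a blow-up like 1 / |Re z|.\<close>

lemma norm_newman_kernel_horizontal:
  assumes R: "R > 0" and z: "\<bar>Im z\<bar> = R" "\<bar>Re z\<bar> \<le> R"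
  shows "cmod (newman_kernel R N z) \<le> real N powr Re z * (3 * \<bar>Re z\<bar> / R\<^sup>2)"
proof -
  have Im2: "(Im z)\<^sup>2 = R\<^sup>2" using z(1) by (metis power2_abs)
  have "z\<^sup>2 = Complex ((Re z)\<^sup>2 - R\<^sup>2) (2 * Re z * Im z)"
    by (simp add: complex_eq_iff power2_eq_square Im2[unfolded power2_eq_square])
  then have "1 + z\<^sup>2 / of_real (R\<^sup>2) = Complex ((Re z)\<^sup>2 / R\<^sup>2) (2 * Re z * Im z / R\<^sup>2)"
    using R by (simp add: complex_eq_iff field_simps)
  then have "cmod (1 + z\<^sup>2 / of_real (R\<^sup>2)) \<le> \<bar>(Re z)\<^sup>2 / R\<^sup>2\<bar> + \<bar>2 * Re z * Im z / R\<^sup>2\<bar>"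
    using cmod_le[of "1 + z\<^sup>2 / of_real (R\<^sup>2)"] by simp
  also have "\<dots> = \<bar>Re z\<bar> * (\<bar>Re z\<bar> + 2 * R) / R\<^sup>2"
    by (simp add: abs_mult z(1) power2_eq_square algebra_simps add_divide_distrib)
  also have "\<dots> \<le> \<bar>Re z\<bar> * (3 * R) / R\<^sup>2"
    using z(2) by (intro divide_right_mono mult_left_mono) auto
  finally have 1: "cmod (1 + z\<^sup>2 / of_real (R\<^sup>2)) \<le> \<bar>Re z\<bar> * (3 * R) / R\<^sup>2" .
  have "cmod z \<ge> R" using abs_Im_le_cmod[of z] z(1) by simp
  then have "cmod (1 + z\<^sup>2 / of_real (R\<^sup>2)) / cmod z \<le> (\<bar>Re z\<bar> * (3 * R) / R\<^sup>2) / R"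
    using 1 R by (intro frac_le) auto
  also have "\<dots> = 3 * \<bar>Re z\<bar> / R\<^sup>2" using R by simp
  finally have "real N powr Re z * (cmod (1 + z\<^sup>2 / of_real (R\<^sup>2)) / cmod z) \<le> real N powr Re z * (3 * \<bar>Re z\<bar> / R\<^sup>2)"
    by (intro mult_left_mono) auto
  then show ?thesis
    by (simp add: newman_kernel_def norm_mult norm_divide norm_powr_real_powr)
qed

lemma norm_newman_kernel_vertical:
  assumes r: "0 < r" "r \<le> R" and z: "\<bar>Re z\<bar> = r" "\<bar>Im z\<bar> \<le> R"
  shows "cmod (newman_kernel R N z) \<le> real N powr Re z * (3 / r)"
proof -
  have "(Re z)\<^sup>2 \<le> R\<^sup>2" "(Im z)\<^sup>2 \<le> R\<^sup>2" using r z by (metis power2_abs power_mono abs_ge_zero)+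
  then have "cmod (z\<^sup>2) \<le> 2 * R\<^sup>2" by (simp add: norm_power cmod_power2)
  then have "cmod (z\<^sup>2 / of_real (R\<^sup>2)) \<le> 2"
    using r by (simp add: norm_divide norm_power divide_le_eq)
  then have 1: "cmod (1 + z\<^sup>2 / of_real (R\<^sup>2)) \<le> 3"
    using norm_triangle_ineq[of 1 "z\<^sup>2 / of_real (R\<^sup>2)"] by simp
  have "cmod z \<ge> r" using abs_Re_le_cmod[of z] z(1) by simp
  then have "cmod (1 + z\<^sup>2 / of_real (R\<^sup>2)) / cmod z \<le> 3 / r"
    using 1 r by (intro frac_le) auto
  then have "real N powr Re z * (cmod (1 + z\<^sup>2 / of_real (R\<^sup>2)) / cmod z) \<le> real N powr Re z * (3 / r)"
    by (intro mult_left_mono) auto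
  then show ?thesis
    by (simp add: newman_kernel_def norm_mult norm_divide norm_powr_real_powr)
qed

text \<open>Cauchy's formula, since the kernel has a simple pole with residue 1 at 0. The left edge
  \<open>x0\<close> is free because the continued function is available only to a small depth, while
  the partial sum is entire and can be moved further. The horizontal sides are split at the
  imaginary axis, where the estimates change.\<close>

lemma newman_rectangle:
  assumes R: "R > 0" and x0: "x0 < 0" and N: "N \<ge> 1"
    and h: "h holomorphic_on cbox (Complex x0 (-R)) (Complex R R)"
  defines "G \<equiv> \<lambda>z. h z * newman_kernel R N z"
  shows "2 * of_real pi * \<i> * h 0 =
      contour_integral (linepath (Complex x0 (-R)) (Complex 0 (-R))) G
    + contour_integral (linepath (Complex 0 (-R)) (Complex R (-R))) G
    + contour_integral (linepath (Complex R (-R)) (Complex R R)) G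
    + contour_integral (linepath (Complex R R) (Complex 0 R)) G
    + contour_integral (linepath (Complex 0 R) (Complex x0 R)) G
    + contour_integral (linepath (Complex x0 R) (Complex x0 (-R))) G"
    and "continuous_on (cbox (Complex x0 (-R)) (Complex R R) - {0}) G"
proof -
  let ?a = "Complex x0 (-R)" and ?b = "Complex R R"
  let ?S = "cbox ?a ?b"
  define g where "g z = h z * of_nat N powr z * (1 + z\<^sup>2 / of_real (R\<^sup>2))" for z
  have G: "G = (\<lambda>z. g z / (z - 0))" by (simp add: G_def g_def newman_kernel_def mult_ac)
  have g: "g holomorphic_on ?S"
    unfolding g_def using N R by (intro holomorphic_intros h) auto
  have inbox: "0 \<in> box ?a ?b" using R x0 by (auto simp: in_box_complex_iff)
  have cont: "continuous_on (?S - {0}) G"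
    unfolding G using holomorphic_on_imp_continuous_on[OF g]
    by (intro continuous_intros) (auto intro: continuous_on_subset)
  then show "continuous_on (cbox (Complex x0 (-R)) (Complex R R) - {0}) G" .
  have img: "path_image (rectpath ?a ?b) \<subseteq> ?S - {0}"
    using path_image_rectpath_subset_cbox[of ?a ?b] path_image_rectpath_inter_box[of ?a ?b] inbox R x0 by auto
  have "0 \<in> interior ?S" using inbox by (simp add: interior_cbox)
  then have "(G has_contour_integral (2 * pi * \<i> * winding_number (rectpath ?a ?b) 0 * g 0)) (rectpath ?a ?b)"
    unfolding G
    by (rule Cauchy_integral_formula_convex_simple[OF convex_box(1) g _ valid_path_rectpath img]) simp
  then have I: "(G has_contour_integral (2 * of_real pi * \<i> * h 0)) (rectpath ?a ?b)"
    using winding_number_rectpath[OF inbox] N by (simp add: g_def)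
  have seg: "closed_segment u v \<subseteq> ?S - {0}"
    if "u \<in> ?S" "v \<in> ?S" "(Re u = Re v \<and> Re u \<noteq> 0) \<or> (Im u = Im v \<and> Im u \<noteq> 0)" for u v
  proof -
    have "closed_segment u v \<subseteq> ?S" using that by (intro closed_segment_subset) (auto simp: convex_box)
    moreover have "0 \<notin> closed_segment u v"
      using that by (auto simp: closed_segment_same_Re closed_segment_same_Im)
    ultimately show ?thesis by auto
  qed
  have ci: "G contour_integrable_on linepath u v"
    if "u \<in> ?S" "v \<in> ?S" "(Re u = Re v \<and> Re u \<noteq> 0) \<or> (Im u = Im v \<and> Im u \<noteq> 0)" for u v
    by (rule contour_integrable_continuous_linepath[OF continuous_on_subset[OF cont seg[OF that]]])
  note mem = in_cbox_complex_iff
  have "2 * of_real pi * \<i> * h 0 = contour_integral (rectpath ?a ?b) G"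
    using I by (simp add: contour_integral_unique)
  also have "\<dots> = contour_integral (linepath ?a (Complex R (-R))) G + (contour_integral (linepath (Complex R (-R)) ?b) G
      + (contour_integral (linepath ?b (Complex x0 R)) G + contour_integral (linepath (Complex x0 R) ?a) G))"
    unfolding rectpath_def Let_def using R x0
    by (simp add: contour_integral_join contour_integrable_join ci mem)
  also have "contour_integral (linepath ?a (Complex R (-R))) G
      = contour_integral (linepath ?a (Complex 0 (-R))) G + contour_integral (linepath (Complex 0 (-R)) (Complex R (-R))) G"
    using R x0 by (intro contour_integral_split_linepath continuous_on_subset[OF cont] seg)
      (auto simp: mem closed_segment_same_Im closed_segment_eq_real_ivl)
  also have "contour_integral (linepath ?b (Complex x0 R)) G
      = contour_integral (linepath ?b (Complex 0 R)) G + contour_integral (linepath (Complex 0 R) (Complex x0 R)) G"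
    using R x0 by (intro contour_integral_split_linepath continuous_on_subset[OF cont] seg)
      (auto simp: mem closed_segment_same_Im closed_segment_eq_real_ivl)
  finally show "2 * of_real pi * \<i> * h 0 =
      contour_integral (linepath (Complex x0 (-R)) (Complex 0 (-R))) G
    + contour_integral (linepath (Complex 0 (-R)) (Complex R (-R))) G
    + contour_integral (linepath (Complex R (-R)) (Complex R R)) G
    + contour_integral (linepath (Complex R R) (Complex 0 R)) G
    + contour_integral (linepath (Complex 0 R) (Complex x0 R)) G
    + contour_integral (linepath (Complex x0 R) (Complex x0 (-R))) G" by (simp add: add_ac)
qed

text \<open>The exponent -1 - z makes the value of the series at z = 0 the sum of a n / n. On the
  right half of the contour \<open>F\<close> minus the partial sum is a tail. On the left half the
  two are separated: \<open>F\<close> is bounded by \<open>K\<close> on a rectangle of depth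
  \<delta>, whose far side profits from \<open>N powr (-\<delta>)\<close> and whose other sides have
  length \<delta>, while the contour of the partial sum is moved out to depth R. The terms in
  \<open>A\<close> total 36 A / R, and division by 2 pi > 6 leaves 6 A / R.\<close>

lemma newman_estimate:
  fixes a :: "nat \<Rightarrow> complex"
  assumes a: "\<And>n. n \<ge> 1 \<Longrightarrow> cmod (a n) \<le> A"
    and \<delta>: "0 < \<delta>" "\<delta> \<le> R" and RN: "R \<le> real N"
    and hol: "F holomorphic_on cbox (Complex (-\<delta>) (-R)) (Complex R R)"
    and F: "\<And>z. Re z > 0 \<Longrightarrow> Re z \<le> R \<Longrightarrow> \<bar>Im z\<bar> \<le> R \<Longrightarrow> (\<lambda>n. a n * of_nat n powr (-1 - z)) sums F z"
    and K: "\<And>z. -\<delta> \<le> Re z \<Longrightarrow> Re z \<le> 0 \<Longrightarrow> \<bar>Im z\<bar> \<le> R \<Longrightarrow> cmod (F z) \<le> K"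
  shows "cmod (F 0 - (\<Sum>n\<le>N. a n / of_nat n)) \<le> 6 * A / R + K * \<delta>\<^sup>2 / R\<^sup>2 + K * R * real N powr (-\<delta>) / \<delta>"
proof -
  have R: "R > 0" using \<delta> by linarith
  have N: "N \<ge> 1" using R RN by (cases N) auto
  have A0: "A \<ge> 0" using a[of 1] norm_ge_zero[of "a 1"] by linarith
  have K0: "K \<ge> 0" using order.trans[OF norm_ge_zero K[of 0]] \<delta> by simp
  define S where "S z = (\<Sum>n\<le>N. a n * of_nat n powr (-1 - z))" for z
  have "(\<lambda>z. of_nat n powr (-1 - z)) holomorphic_on X" for n X
    by (cases "n = 0") (auto intro!: holomorphic_intros)
  then have S_hol: "S holomorphic_on X" for X
    unfolding S_def by (intro holomorphic_on_sum holomorphic_on_mult holomorphic_on_const)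
  define GF where "GF = (\<lambda>z. F z * newman_kernel R N z)"
  define GS where "GS = (\<lambda>z. S z * newman_kernel R N z)"
  let ?L = "\<lambda>u v. linepath u v"
  note rF = newman_rectangle[OF R _ N hol, folded GF_def]
  note rS = newman_rectangle[OF R _ N S_hol[of "cbox (Complex (-R) (-R)) (Complex R R)"], folded GS_def]
  let ?p1 = "Complex 0 (-R)" and ?p2 = "Complex R (-R)" and ?p3 = "Complex R R" and ?p4 = "Complex 0 R"
  note mem = in_cbox_complex_iff
  have segF: "closed_segment u v \<subseteq> cbox (Complex (-\<delta>) (-R)) (Complex R R) - {0}"
    if "u \<in> cbox (Complex (-\<delta>) (-R)) (Complex R R)" "v \<in> cbox (Complex (-\<delta>) (-R)) (Complex R R)"
      "(Re u = Re v \<and> Re u \<noteq> 0) \<or> (Im u = Im v \<and> Im u \<noteq> 0)" for u v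
  proof -
    have "closed_segment u v \<subseteq> cbox (Complex (-\<delta>) (-R)) (Complex R R)"
      using that by (intro closed_segment_subset) (auto simp: convex_box)
    moreover have "0 \<notin> closed_segment u v"
      using that by (auto simp: closed_segment_same_Re closed_segment_same_Im)
    ultimately show ?thesis by auto
  qed
  have segS: "closed_segment u v \<subseteq> cbox (Complex (-R) (-R)) (Complex R R) - {0}"
    if "u \<in> cbox (Complex (-R) (-R)) (Complex R R)" "v \<in> cbox (Complex (-R) (-R)) (Complex R R)"
      "(Re u = Re v \<and> Re u \<noteq> 0) \<or> (Im u = Im v \<and> Im u \<noteq> 0)" for u v
  proof -
    have "closed_segment u v \<subseteq> cbox (Complex (-R) (-R)) (Complex R R)"
      using that by (intro closed_segment_subset) (auto simp: convex_box)
    moreover have "0 \<notin> closed_segment u v"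
      using that by (auto simp: closed_segment_same_Re closed_segment_same_Im)
    ultimately show ?thesis by auto
  qed
  have ciF: "GF contour_integrable_on ?L u v"
    if "u \<in> cbox (Complex (-\<delta>) (-R)) (Complex R R)" "v \<in> cbox (Complex (-\<delta>) (-R)) (Complex R R)"
      "(Re u = Re v \<and> Re u \<noteq> 0) \<or> (Im u = Im v \<and> Im u \<noteq> 0)" for u v
    using rF(2) segF[OF that] \<delta>
    by (intro contour_integrable_continuous_linepath) (auto intro: continuous_on_subset)
  have ciS: "GS contour_integrable_on ?L u v"
    if "u \<in> cbox (Complex (-R) (-R)) (Complex R R)" "v \<in> cbox (Complex (-R) (-R)) (Complex R R)"
      "(Re u = Re v \<and> Re u \<noteq> 0) \<or> (Im u = Im v \<and> Im u \<noteq> 0)" for u v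
    using rS(2) segS[OF that] R
    by (intro contour_integrable_continuous_linepath) (auto intro: continuous_on_subset)

  have hor: "Im z = Im u \<and> \<bar>Im z\<bar> = R \<and> min (Re u) (Re v) \<le> Re z \<and> Re z \<le> max (Re u) (Re v)"
    if "z \<in> closed_segment u v" "Im u = Im v" "\<bar>Im u\<bar> = R" for u v z
    using that by (auto simp: closed_segment_same_Im closed_segment_eq_real_ivl split: if_splits)
  have ver: "Re z = Re u \<and> \<bar>Im z\<bar> \<le> R"
    if "z \<in> closed_segment u v" "Re u = Re v" "\<bar>Im u\<bar> \<le> R" "\<bar>Im v\<bar> \<le> R" for u v z
    using that by (auto simp: closed_segment_same_Re closed_segment_eq_real_ivl split: if_splits)

  \<comment> \<open>At the points with Re z = 0 the tail bound is void, but the kernel vanishes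
    there.\<close>
  have tail_h: "cmod (GF z - GS z) \<le> 3 * A / R\<^sup>2" if z: "\<bar>Im z\<bar> = R" "0 \<le> Re z" "Re z \<le> R" for z
  proof (cases "Re z = 0")
    case True
    have "cmod (newman_kernel R N z) \<le> 0"
      using norm_newman_kernel_horizontal[OF R z(1), of N] True z R by simp
    then have "newman_kernel R N z = 0" by simp
    then show ?thesis using A0 by (simp add: GF_def GS_def)
  next
    case False
    then have x: "Re z > 0" using z by simp
    have "cmod (GF z - GS z) = cmod (F z - S z) * cmod (newman_kernel R N z)"
      by (simp add: GF_def GS_def left_diff_distrib[symmetric] norm_mult)
    also have "\<dots> \<le> (A * (real N powr (- Re z) / Re z)) * (real N powr Re z * (3 * \<bar>Re z\<bar> / R\<^sup>2))"
      unfolding S_def using x z R A0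
      by (intro mult_mono norm_dirichlet_tail_le norm_newman_kernel_horizontal x N a F) auto
    also have "\<dots> = 3 * A / R\<^sup>2"
      using x N by (simp add: powr_minus)
    finally show ?thesis .
  qed
  have tail_v: "cmod (GF z - GS z) \<le> 3 * A / R\<^sup>2" if z: "Re z = R" "\<bar>Im z\<bar> \<le> R" for z
  proof -
    have "cmod (GF z - GS z) = cmod (F z - S z) * cmod (newman_kernel R N z)"
      by (simp add: GF_def GS_def left_diff_distrib[symmetric] norm_mult)
    also have "\<dots> \<le> (A * (real N powr (- Re z) / Re z)) * (real N powr Re z * (3 / R))"
      unfolding S_def using z R A0
      by (intro mult_mono norm_dirichlet_tail_le norm_newman_kernel_vertical N a F) auto
    also have "\<dots> = 3 * A / R\<^sup>2"
      using z R N by (simp add: powr_minus power2_eq_square)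
    finally show ?thesis .
  qed
  have F_h: "cmod (GF z) \<le> 3 * K * \<delta> / R\<^sup>2" if z: "\<bar>Im z\<bar> = R" "-\<delta> \<le> Re z" "Re z \<le> 0" for z
  proof -
    have "cmod (GF z) = cmod (F z) * cmod (newman_kernel R N z)" by (simp add: GF_def norm_mult)
    also have "\<dots> \<le> K * (real N powr Re z * (3 * \<bar>Re z\<bar> / R\<^sup>2))"
      using z R K0 \<delta> by (intro mult_mono K norm_newman_kernel_horizontal) auto
    also have "\<dots> \<le> K * (1 * (3 * \<delta> / R\<^sup>2))"
    proof (intro mult_left_mono mult_mono divide_right_mono)
      show "real N powr Re z \<le> 1" using powr_mono[of "Re z" 0 "real N"] z N by simp
    qed (use z K0 \<delta> in \<open>auto simp: divide_le_0_iff\<close>)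
    finally show ?thesis by (simp add: mult_ac)
  qed
  have F_v: "cmod (GF z) \<le> K * real N powr (-\<delta>) * 3 / \<delta>" if z: "Re z = -\<delta>" "\<bar>Im z\<bar> \<le> R" for z
  proof -
    have "cmod (GF z) = cmod (F z) * cmod (newman_kernel R N z)" by (simp add: GF_def norm_mult)
    also have "\<dots> \<le> K * (real N powr Re z * (3 / \<delta>))"
      using z R K0 \<delta> by (intro mult_mono K norm_newman_kernel_vertical) auto
    finally show ?thesis using z by (simp add: mult_ac)
  qed
  have S_bd: "cmod (GS z) \<le> 6 * A / R\<^sup>2"
    if z: "Re z < 0" "(\<bar>Im z\<bar> = R \<and> -R \<le> Re z) \<or> (Re z = -R \<and> \<bar>Im z\<bar> \<le> R)" for z
  proof -
    have ker: "cmod (newman_kernel R N z) \<le> real N powr Re z * (3 * (- Re z) / R\<^sup>2)"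
    proof (cases "\<bar>Im z\<bar> = R \<and> -R \<le> Re z")
      case True
      then show ?thesis using norm_newman_kernel_horizontal[OF R, of z N] z R by simp
    next
      case False
      then have "Re z = -R" "\<bar>Im z\<bar> \<le> R" using z by auto
      then show ?thesis using norm_newman_kernel_vertical[OF R, of R z N] R by (simp add: power2_eq_square)
    qed
    have "cmod (GS z) = cmod (S z) * cmod (newman_kernel R N z)" by (simp add: GS_def norm_mult)
    also have "\<dots> \<le> (A * (real N powr (- Re z) * (1 / (- Re z) + 1 / real N))) * (real N powr Re z * (3 * (- Re z) / R\<^sup>2))"
      unfolding S_def
    proof (intro mult_mono norm_dirichlet_poly_le N a ker)
      show "0 \<le> A * (real N powr (- Re z) * (1 / (- Re z) + 1 / real N))"
        using z(1) by (intro mult_nonneg_nonneg A0 add_nonneg_nonneg) (auto simp: divide_le_0_iff)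
    qed (use z(1) in auto)
    also have "\<dots> = (real N powr (- Re z) * real N powr Re z) * (A * ((1 / (- Re z) + 1 / real N) * (3 * (- Re z) / R\<^sup>2)))"
      by (simp only: mult_ac)
    also have "real N powr (- Re z) * real N powr Re z = 1" using N by (simp add: powr_minus)
    also have "(1 / (- Re z) + 1 / real N) * (3 * (- Re z) / R\<^sup>2) = 3 / R\<^sup>2 * (1 + (- Re z) / real N)"
      using z(1) R N by (simp add: field_simps)
    also have "1 * (A * (3 / R\<^sup>2 * (1 + (- Re z) / real N))) \<le> 1 * (A * (3 / R\<^sup>2 * (1 + 1)))"
    proof -
      \<comment> \<open>The contour reaches only to depth R \<le> N, which controls the term 1/N of
        the partial-sum bound.\<close>
      have "- Re z \<le> real N" using z RN by auto
      then have "(- Re z) / real N \<le> 1" by (subst pos_divide_le_eq) (use N in auto)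
      then show ?thesis by (intro mult_left_mono add_mono order.refl A0) auto
    qed
    finally show ?thesis by (simp add: mult_ac)
  qed
  have S_bd0: "cmod (GS z) \<le> 6 * A / R\<^sup>2" if z: "\<bar>Im z\<bar> = R" "-R \<le> Re z" "Re z \<le> 0" for z
  proof (cases "Re z = 0")
    case True
    have "cmod (newman_kernel R N z) \<le> 0"
      using norm_newman_kernel_horizontal[OF R z(1), of N] True z R by simp
    then have "newman_kernel R N z = 0" by simp
    then show ?thesis using A0 by (simp add: GS_def)
  qed (use z S_bd in auto)

  have eF: "2 * of_real pi * \<i> * F 0 = contour_integral (?L (Complex (-\<delta>) (-R)) ?p1) GF
    + contour_integral (?L ?p1 ?p2) GF + contour_integral (?L ?p2 ?p3) GF + contour_integral (?L ?p3 ?p4) GF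
    + contour_integral (?L ?p4 (Complex (-\<delta>) R)) GF
    + contour_integral (?L (Complex (-\<delta>) R) (Complex (-\<delta>) (-R))) GF"
    by (rule rF(1)) (use \<delta> in simp)
  have eS: "2 * of_real pi * \<i> * S 0 = contour_integral (?L (Complex (-R) (-R)) ?p1) GS
    + contour_integral (?L ?p1 ?p2) GS + contour_integral (?L ?p2 ?p3) GS + contour_integral (?L ?p3 ?p4) GS
    + contour_integral (?L ?p4 (Complex (-R) R)) GS
    + contour_integral (?L (Complex (-R) R) (Complex (-R) (-R))) GS"
    by (rule rS(1)) (use R in simp)
  have diff: "contour_integral (?L u v) GF - contour_integral (?L u v) GS = contour_integral (?L u v) (\<lambda>z. GF z - GS z)"
    "(\<lambda>z. GF z - GS z) contour_integrable_on ?L u v"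
    if "(u, v) \<in> {(?p1, ?p2), (?p2, ?p3), (?p3, ?p4)}" for u v
  proof -
    have "GF contour_integrable_on ?L u v" "GS contour_integrable_on ?L u v"
      using that R \<delta> by (auto intro!: ciF ciS simp: mem)
    then show "contour_integral (?L u v) GF - contour_integral (?L u v) GS = contour_integral (?L u v) (\<lambda>z. GF z - GS z)"
      "(\<lambda>z. GF z - GS z) contour_integrable_on ?L u v"
      by (simp_all add: contour_integral_diff contour_integrable_diff)
  qed
  define I1 where "I1 = contour_integral (?L ?p1 ?p2) (\<lambda>z. GF z - GS z)"
  define I2 where "I2 = contour_integral (?L ?p2 ?p3) (\<lambda>z. GF z - GS z)"
  define I3 where "I3 = contour_integral (?L ?p3 ?p4) (\<lambda>z. GF z - GS z)"
  define F1 where "F1 = contour_integral (?L (Complex (-\<delta>) (-R)) ?p1) GF"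
  define F2 where "F2 = contour_integral (?L ?p4 (Complex (-\<delta>) R)) GF"
  define F3 where "F3 = contour_integral (?L (Complex (-\<delta>) R) (Complex (-\<delta>) (-R))) GF"
  define S1 where "S1 = contour_integral (?L (Complex (-R) (-R)) ?p1) GS"
  define S2 where "S2 = contour_integral (?L ?p4 (Complex (-R) R)) GS"
  define S3 where "S3 = contour_integral (?L (Complex (-R) R) (Complex (-R) (-R))) GS"
  have eq: "2 * of_real pi * \<i> * (F 0 - S 0) = I1 + I2 + I3 + F1 + F2 + F3 - S1 - S2 - S3"
    unfolding right_diff_distrib eF eS I1_def I2_def I3_def F1_def F2_def F3_def S1_def S2_def S3_def
    by (simp add: diff(1)[symmetric])
  have len: "cmod (Complex u v - Complex u' v) = \<bar>u - u'\<bar>" "cmod (Complex u v - Complex u v') = \<bar>v - v'\<bar>" for u u' v v'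
    by (simp_all add: cmod_def)
  have bI1: "cmod I1 \<le> 3 * A / R\<^sup>2 * R"
    unfolding I1_def
    by (rule order.trans[OF contour_integral_bound_linepath[OF diff(2), of _ _ "3 * A / R\<^sup>2"]])
       (use A0 R hor[of _ ?p1 ?p2] in \<open>auto intro!: tail_h simp: len\<close>)
  have bI3: "cmod I3 \<le> 3 * A / R\<^sup>2 * R"
    unfolding I3_def
    by (rule order.trans[OF contour_integral_bound_linepath[OF diff(2), of _ _ "3 * A / R\<^sup>2"]])
       (use A0 R hor[of _ ?p3 ?p4] in \<open>auto intro!: tail_h simp: len\<close>)
  have bI2: "cmod I2 \<le> 3 * A / R\<^sup>2 * (2 * R)"
    unfolding I2_def
    by (rule order.trans[OF contour_integral_bound_linepath[OF diff(2), of _ _ "3 * A / R\<^sup>2"]])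
       (use A0 R ver[of _ ?p2 ?p3] in \<open>auto intro!: tail_v simp: len\<close>)
  have bF1: "cmod F1 \<le> 3 * K * \<delta> / R\<^sup>2 * \<delta>"
    unfolding F1_def
    by (rule order.trans[OF contour_integral_bound_linepath[OF ciF, of _ _ "3 * K * \<delta> / R\<^sup>2"]])
       (use K0 R \<delta> hor[of _ "Complex (-\<delta>) (-R)" ?p1] in \<open>auto intro!: F_h simp: len mem\<close>)
  have bF2: "cmod F2 \<le> 3 * K * \<delta> / R\<^sup>2 * \<delta>"
    unfolding F2_def
    by (rule order.trans[OF contour_integral_bound_linepath[OF ciF, of _ _ "3 * K * \<delta> / R\<^sup>2"]])
       (use K0 R \<delta> hor[of _ ?p4 "Complex (-\<delta>) R"] in \<open>auto intro!: F_h simp: len mem\<close>)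
  have bF3: "cmod F3 \<le> K * real N powr (-\<delta>) * 3 / \<delta> * (2 * R)"
    unfolding F3_def
    by (rule order.trans[OF contour_integral_bound_linepath[OF ciF, of _ _ "K * real N powr (-\<delta>) * 3 / \<delta>"]])
       (use K0 R \<delta> ver[of _ "Complex (-\<delta>) R" "Complex (-\<delta>) (-R)"] in \<open>auto intro!: F_v simp: len mem\<close>)
  have bS1: "cmod S1 \<le> 6 * A / R\<^sup>2 * R"
    unfolding S1_def
    by (rule order.trans[OF contour_integral_bound_linepath[OF ciS, of _ _ "6 * A / R\<^sup>2"]])
       (use A0 R hor[of _ "Complex (-R) (-R)" ?p1] in \<open>auto intro!: S_bd0 simp: len mem\<close>)
  have bS2: "cmod S2 \<le> 6 * A / R\<^sup>2 * R"
    unfolding S2_def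
    by (rule order.trans[OF contour_integral_bound_linepath[OF ciS, of _ _ "6 * A / R\<^sup>2"]])
       (use A0 R hor[of _ ?p4 "Complex (-R) R"] in \<open>auto intro!: S_bd0 simp: len mem\<close>)
  have bS3: "cmod S3 \<le> 6 * A / R\<^sup>2 * (2 * R)"
    unfolding S3_def
    by (rule order.trans[OF contour_integral_bound_linepath[OF ciS, of _ _ "6 * A / R\<^sup>2"]])
       (use A0 R ver[of _ "Complex (-R) R" "Complex (-R) (-R)"] in \<open>auto intro!: S_bd simp: len mem\<close>)
  have "2 * pi * cmod (F 0 - S 0) = cmod (2 * of_real pi * \<i> * (F 0 - S 0))"
    by (simp add: norm_mult)
  also have "\<dots> \<le> cmod I1 + cmod I2 + cmod I3 + cmod F1 + cmod F2 + cmod F3 + cmod S1 + cmod S2 + cmod S3"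
    unfolding eq by (intro order.trans[OF norm_triangle_ineq] order.trans[OF norm_triangle_ineq4] add_mono order.refl)
  also have "\<dots> \<le> 6 * (6 * A / R + K * \<delta>\<^sup>2 / R\<^sup>2 + K * R * real N powr (-\<delta>) / \<delta>)"
  proof -
    have e: "c * A / R\<^sup>2 * R = c * (A / R)" "c * A / R\<^sup>2 * (2 * R) = 2 * c * (A / R)" for c
      using R by (simp_all add: power2_eq_square)
    have eK: "3 * K * \<delta> / R\<^sup>2 * \<delta> = 3 * (K * \<delta>\<^sup>2 / R\<^sup>2)"
      "K * real N powr (-\<delta>) * 3 / \<delta> * (2 * R) = 6 * (K * R * real N powr (-\<delta>) / \<delta>)"
      by (simp_all add: power2_eq_square)
    show ?thesis
      using bI1 bI2 bI3 bF1 bF2 bF3 bS1 bS2 bS3 unfolding e eK by simp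
  qed
  finally have fin: "2 * pi * cmod (F 0 - S 0) \<le> 6 * (6 * A / R + K * \<delta>\<^sup>2 / R\<^sup>2 + K * R * real N powr (-\<delta>) / \<delta>)" .
  have "6 * cmod (F 0 - S 0) \<le> 2 * pi * cmod (F 0 - S 0)"
    using pi_gt3 by (intro mult_right_mono) auto
  then have "6 * cmod (F 0 - S 0) \<le> 6 * (6 * A / R + K * \<delta>\<^sup>2 / R\<^sup>2 + K * R * real N powr (-\<delta>) / \<delta>)"
    using fin by (rule order.trans)
  then have "cmod (F 0 - S 0) \<le> 6 * A / R + K * \<delta>\<^sup>2 / R\<^sup>2 + K * R * real N powr (-\<delta>) / \<delta>"
    by (rule mult_left_le_imp_le) simp
  moreover have "S 0 = (\<Sum>n\<le>N. a n / of_nat n)"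
    unfolding S_def by (intro sum.cong) (auto simp: powr_minus divide_inverse)
  ultimately show ?thesis by simp
qed

section \<open>Zero-free regions and sums of coefficients of the logarithm\<close>

text \<open>Schwarz's lemma for \<phi> / (2M - \<phi>), which maps into the unit disc because Re
  \<phi> < M. At relative radius 3/4 this gives |\<phi>| \<le> 2M (3/4) / (1 - 3/4) = 6M.\<close>

lemma borel_caratheodory_three_quarters:
  assumes hol: "f holomorphic_on ball c r" and r: "r > 0" and M: "M > 0"
    and bd: "\<And>z. z \<in> ball c r \<Longrightarrow> Re (f z - f c) < M"
    and z: "dist c z \<le> 3 / 4 * r"
  shows "cmod (f z - f c) \<le> 6 * M"
proof -
  define \<phi> where "\<phi> w = f (c + of_real r * w) - f c" for w
  define \<psi> where "\<psi> w = \<phi> w / (of_real (2 * M) - \<phi> w)" for w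
  have inball: "c + of_real r * w \<in> ball c r" if "norm w < 1" for w
    using that r by (simp add: dist_norm norm_mult)
  have Re\<phi>: "Re (\<phi> w) < M" if "norm w < 1" for w
    unfolding \<phi>_def using bd inball[OF that] by blast
  have nz: "of_real (2 * M) - \<phi> w \<noteq> 0" if "norm w < 1" for w
  proof
    assume "of_real (2 * M) - \<phi> w = 0"
    then have "Re (\<phi> w) = 2 * M" by (metis Re_complex_of_real eq_iff_diff_eq_0)
    then show False using Re\<phi>[OF that] M by simp
  qed
  have img: "(\<lambda>w. c + of_real r * w) ` ball 0 1 \<subseteq> ball c r"
    by (rule image_subsetI, rule inball) simp
  have \<phi>_hol: "\<phi> holomorphic_on ball 0 1"
    unfolding \<phi>_def
    by (intro holomorphic_intros holomorphic_on_compose_gen[OF _ hol img, unfolded o_def])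
  then have \<psi>_hol: "\<psi> holomorphic_on ball 0 1"
    unfolding \<psi>_def using nz by (intro holomorphic_intros) auto
  have lt1: "norm (\<psi> w) < 1" if "norm w < 1" for w
  proof -
    have "(cmod (of_real (2 * M) - \<phi> w))\<^sup>2 - (cmod (\<phi> w))\<^sup>2 = 4 * M * (M - Re (\<phi> w))"
      unfolding cmod_power2 by (simp add: power2_eq_square algebra_simps)
    also have "\<dots> > 0" using M Re\<phi>[OF that] by simp
    finally have "cmod (\<phi> w) < cmod (of_real (2 * M) - \<phi> w)"
      by (simp add: power2_less_imp_less)
    then show ?thesis using nz[OF that] by (simp add: \<psi>_def norm_divide)
  qed
  define w where "w = (z - c) / of_real r"
  have w: "norm w \<le> 3 / 4" "norm w < 1"
    using z r by (auto simp: w_def norm_divide dist_norm norm_minus_commute divide_le_eq divide_less_eq)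
  have "norm (\<psi> w) \<le> norm w"
    by (rule Schwarz_Lemma(1)[OF \<psi>_hol]) (use lt1 w in \<open>auto simp: \<psi>_def \<phi>_def\<close>)
  then have \<psi>w: "norm (\<psi> w) \<le> 3 / 4" using w by linarith
  have "\<phi> w = of_real (2 * M) * \<psi> w - \<phi> w * \<psi> w"
  proof -
    have "\<psi> w * (of_real (2 * M) - \<phi> w) = \<phi> w" using nz[OF w(2)] by (simp add: \<psi>_def)
    then show ?thesis by (simp add: algebra_simps)
  qed
  then have "cmod (\<phi> w) \<le> cmod (of_real (2 * M) * \<psi> w) + cmod (\<phi> w * \<psi> w)"
    by (metis norm_triangle_ineq4)
  also have "\<dots> \<le> 2 * M * (3 / 4) + cmod (\<phi> w) * (3 / 4)"
    using mult_left_mono[OF \<psi>w, of "2 * M"] mult_left_mono[OF \<psi>w, of "cmod (\<phi> w)"] M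
    by (intro add_mono) (simp_all add: norm_mult)
  finally have "cmod (\<phi> w) \<le> 6 * M" by simp
  then show ?thesis using r by (simp add: \<phi>_def w_def)
qed

text \<open>Partial summation to remove the weights 1/n. The unknown limit \<open>F0\<close>
  cancels, and the three terms contribute N + M + (N - M) = 2N times \<open>s\<close>.\<close>

lemma sum_from_weighted_sums:
  fixes a :: "nat \<Rightarrow> complex"
  assumes bd: "\<And>k. M \<le> k \<Longrightarrow> k \<le> N \<Longrightarrow> cmod (F0 - (\<Sum>n\<le>k. a n / of_nat n)) \<le> s"
    and MN: "M \<le> N"
  shows "cmod (\<Sum>n\<in>{M<..N}. a n) \<le> 2 * real N * s"
proof -
  define b where "b k = (\<Sum>n\<le>k. a n / of_nat n) - F0" for k
  have b: "cmod (b k) \<le> s" if "M \<le> k" "k \<le> N" for k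
    using bd[OF that] by (simp add: b_def norm_minus_commute)
  have "(\<Sum>n\<in>{M<..N}. a n) = of_nat N * b N - of_nat M * b M - (\<Sum>k\<in>{M..<N}. b k)"
    using MN
  proof (induction N rule: dec_induct)
    case (step n)
    have "{M<..Suc n} = insert (Suc n) {M<..n}" using step(1) by auto
    then have "(\<Sum>k\<in>{M<..Suc n}. a k) = a (Suc n) + (\<Sum>k\<in>{M<..n}. a k)" by simp
    moreover have "b (Suc n) = b n + a (Suc n) / of_nat (Suc n)" by (simp add: b_def)
    then have "of_nat (Suc n) * b (Suc n) = of_nat (Suc n) * b n + a (Suc n)"
      by (simp add: field_simps del: of_nat_Suc)
    moreover have "(\<Sum>k\<in>{M..<Suc n}. b k) = (\<Sum>k\<in>{M..<n}. b k) + b n"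
      using step(1) by simp
    ultimately show ?case using step.IH by (simp add: algebra_simps)
  qed simp
  then have "cmod (\<Sum>n\<in>{M<..N}. a n) \<le> cmod (of_nat N * b N) + cmod (of_nat M * b M) + cmod (\<Sum>k\<in>{M..<N}. b k)"
    by (metis (no_types, lifting) add_mono_thms_linordered_semiring(3) norm_triangle_ineq4 order_trans)
  also have "\<dots> \<le> real N * s + real M * s + (\<Sum>k\<in>{M..<N}. s)"
    using b MN by (intro add_mono order.trans[OF norm_sum] sum_mono) (auto simp: norm_mult intro!: mult_left_mono)
  also have "\<dots> = 2 * real N * s" using MN by (simp add: of_nat_diff algebra_simps)
  finally show ?thesis .
qed

text \<open>Locally uniform convergence gives holomorphy; the bound is the tail estimate after the
  first term.\<close>

lemma dirichlet_series_bounded_coeffs: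
  fixes a :: "nat \<Rightarrow> complex"
  assumes a: "\<And>n. n \<ge> 1 \<Longrightarrow> cmod (a n) \<le> A"
  obtains G where "G holomorphic_on {s. Re s > 1}"
    "\<And>s. Re s > 1 \<Longrightarrow> (\<lambda>n. a n * of_nat n powr (- s)) sums G s"
    "\<And>s. Re s > 1 \<Longrightarrow> cmod (G s) \<le> A * (1 + 1 / (Re s - 1))"
proof -
  have A0: "A \<ge> 0" using a[of 1] norm_ge_zero[of "a 1"] by linarith
  let ?S = "{s. Re s > 1}"
  have op: "open ?S" by (rule open_halfspace_Re_gt)
  have "\<exists>G. \<forall>s\<in>?S. ((\<lambda>n. a n * of_nat n powr (- s)) sums G s) \<and> G field_differentiable (at s)"
  proof (rule series_differentiable_comparison_complex[OF op])
    fix n s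
    show "(\<lambda>s. a n * of_nat n powr (- s)) field_differentiable (at s)"
    proof (cases "n = 0")
      case False
      have "(\<lambda>s. a n * of_nat n powr (- s)) holomorphic_on UNIV"
        using False by (auto intro!: holomorphic_intros)
      then show ?thesis by (simp add: holomorphic_on_def)
    qed simp
  next
    fix s assume "s \<in> ?S"
    then have s: "Re s > 1" by simp
    define d where "d = (Re s - 1) / 2"
    define h where "h n = complex_of_real (A * real n powr (- (1 + d)))" for n
    have d: "d > 0" using s by (simp add: d_def)
    have "summable h"
      unfolding h_def using d by (intro summable_of_real summable_mult) (simp add: summable_real_powr_iff)
    moreover have "range h \<subseteq> \<real>\<^sub>\<ge>\<^sub>0" using A0 by (auto simp: h_def)
    moreover have "\<forall>\<^sub>F n in sequentially. \<forall>y\<in>ball s d \<inter> ?S. cmod (a n * of_nat n powr (- y)) \<le> cmod (h n)"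
      using eventually_ge_at_top[of 1]
    proof eventually_elim
      case (elim n)
      show ?case
      proof
        fix y assume "y \<in> ball s d \<inter> ?S"
        then have "\<bar>Re (s - y)\<bar> < d" using abs_Re_le_cmod[of "s - y"] by (auto simp: dist_norm)
        then have "Re s - Re y < d" by simp
        moreover have "Re s = 1 + 2 * d" by (simp add: d_def field_simps)
        ultimately have y: "Re y \<ge> 1 + d" by linarith
        have "cmod (a n * of_nat n powr (- y)) = cmod (a n) * real n powr (- Re y)"
          by (simp add: norm_mult norm_powr_real_powr)
        also have "\<dots> \<le> A * real n powr (- (1 + d))"
          using A0 elim y by (intro mult_mono a powr_mono) auto
        finally show "cmod (a n * of_nat n powr (- y)) \<le> cmod (h n)"
          using A0 by (simp add: h_def norm_mult)
      qed
    qed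
    ultimately show "\<exists>d h. 0 < d \<and> summable h \<and> range h \<subseteq> \<real>\<^sub>\<ge>\<^sub>0 \<and>
        (\<forall>\<^sub>F n in sequentially. \<forall>y\<in>ball s d \<inter> ?S. cmod (a n * of_nat n powr (- y)) \<le> cmod (h n))"
      using d by blast
  qed blast
  then obtain G where G: "\<And>s. Re s > 1 \<Longrightarrow> (\<lambda>n. a n * of_nat n powr (- s)) sums G s"
    "\<And>s. Re s > 1 \<Longrightarrow> G field_differentiable (at s)" by auto
  have "G holomorphic_on ?S"
    using G(2) by (auto simp: holomorphic_on_def intro: field_differentiable_at_within)
  moreover have "cmod (G s) \<le> A * (1 + 1 / (Re s - 1))" if s: "Re s > 1" for s
  proof -
    have sums: "(\<lambda>n. a n * of_nat n powr (-1 - (s - 1))) sums G s" using G(1)[OF s] by simp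
    have "cmod (G s - (\<Sum>n\<le>1. a n * of_nat n powr (-1 - (s - 1)))) \<le> A * (real 1 powr (- Re (s - 1)) / Re (s - 1))"
      by (rule norm_dirichlet_tail_le[OF _ _ a sums]) (use s in auto)
    then have "cmod (G s - a 1) \<le> A * (1 / (Re s - 1))" by simp
    moreover have "cmod (a 1) \<le> A" by (rule a) simp
    ultimately show ?thesis using norm_triangle_ineq[of "G s - a 1" "a 1"] by (simp add: algebra_simps)
  qed
  ultimately show ?thesis using that[of G] G(1) by blast
qed

text \<open>On the convex zero-free region the function has a holomorphic logarithm
  \<open>f\<close>. Subtracting \<open>E\<close> leaves the continuation of the series with
  coefficients \<open>a\<close> past the line Re s = 1, to which the contour argument applies with
  depth r0/2 and height T/2. The bound \<open>K\<close> for this continuation comes from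
  Borel-Caratheodory on discs centred at distance r0 to the right of that line, where the series
  itself bounds \<open>f\<close> by \<open>W\<close>.\<close>

lemma zero_free_imp_weighted_sum:
  fixes a :: "nat \<Rightarrow> complex" and L E :: "complex \<Rightarrow> complex"
  assumes a: "\<And>n. n \<ge> 1 \<Longrightarrow> cmod (a n) \<le> A"
    and L: "L holomorphic_on UNIV"
    and E: "E holomorphic_on {s. Re s > 3/4}" "\<And>s. Re s > 3/4 \<Longrightarrow> cmod (E s) \<le> CE"
    and LE: "\<And>s. Re s > 1 \<Longrightarrow> L s = exp ((\<Sum>n. a n * of_nat n powr (- s)) + E s)"
    and r0: "0 < r0" "r0 \<le> 1/8" and T: "T \<ge> 2" and M: "M \<ge> 0"
    and nz: "\<And>s. Re s > 1 - r0 \<Longrightarrow> \<bar>Im s\<bar> \<le> T \<Longrightarrow> L s \<noteq> 0"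
    and bd: "\<And>s. 1/2 \<le> Re s \<Longrightarrow> Re s \<le> 3/2 \<Longrightarrow> \<bar>Im s\<bar> \<le> T \<Longrightarrow> cmod (L s) \<le> exp M"
  defines "W \<equiv> A * (1 + 1 / r0) + CE"
  defines "K \<equiv> 6 * (M + W + 1) + W + CE"
  shows "\<exists>F0. \<forall>N. real N \<ge> T / 2 \<longrightarrow> cmod (F0 - (\<Sum>n\<le>N. a n / of_nat n))
    \<le> 6 * A / (T / 2) + K * (r0 / 2)\<^sup>2 / (T / 2)\<^sup>2 + K * (T / 2) * real N powr (- (r0 / 2)) / (r0 / 2)"
proof -
  have A0: "A \<ge> 0" using a[of 1] norm_ge_zero[of "a 1"] by linarith
  have CE0: "CE \<ge> 0" using order.trans[OF norm_ge_zero E(2)[of 1]] by simp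
  obtain G where G_hol: "G holomorphic_on {s. Re s > 1}"
    and G: "\<And>s. Re s > 1 \<Longrightarrow> (\<lambda>n. a n * of_nat n powr (- s)) sums G s"
    and G_bd: "\<And>s. Re s > 1 \<Longrightarrow> cmod (G s) \<le> A * (1 + 1 / (Re s - 1))"
    by (rule dirichlet_series_bounded_coeffs[OF a]) auto
  have LG: "L s = exp (G s + E s)" if "Re s > 1" for s
    using LE[OF that] sums_unique[OF G[OF that]] by simp
  define U where "U = {s. Re s > 1 - r0} \<inter> {s. Im s < T} \<inter> {s. Im s > - T}"
  define V where "V = {s. Re s > 1} \<inter> {s. Im s < T} \<inter> {s. Im s > - T}"
  have opV: "open V"
    unfolding V_def by (intro open_Int open_halfspace_Re_gt open_halfspace_Im_lt open_halfspace_Im_gt)+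
  have cvU: "convex U" and cvV: "convex V"
    unfolding U_def V_def by (intro convex_Int convex_halfspace_Re_gt convex_halfspace_Im_lt convex_halfspace_Im_gt)+
  have U1: "Re s > 1 - r0" "\<bar>Im s\<bar> < T" if "s \<in> U" for s using that by (auto simp: U_def)
  have U2: "s \<in> U" if "Re s > 1 - r0" "\<bar>Im s\<bar> < T" for s using that by (auto simp: U_def)
  have V1: "Re s > 1" "\<bar>Im s\<bar> < T" if "s \<in> V" for s using that by (auto simp: V_def)
  have V2: "s \<in> V" if "Re s > 1" "\<bar>Im s\<bar> < T" for s using that by (auto simp: V_def)
  have VU: "V \<subseteq> U" using r0 by (auto simp: U_def V_def)
  have "L s \<noteq> 0" if "s \<in> U" for s using nz U1[OF that] by simp
  then obtain g where g_hol: "g holomorphic_on U" and g: "\<And>s. s \<in> U \<Longrightarrow> L s = exp (g s)"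
    using contractible_imp_holomorphic_log[OF holomorphic_on_subset[OF L subset_UNIV] convex_imp_contractible[OF cvU]]
    by blast
  define D where "D s = g s - (G s + E s)" for s
  have D_hol: "D holomorphic_on V"
    unfolding D_def using VU V1 holomorphic_on_subset[OF g_hol VU]
    by (intro holomorphic_on_diff holomorphic_on_add holomorphic_on_subset[OF G_hol] holomorphic_on_subset[OF E(1)])
       (auto dest!: V1(1))
  have expD: "exp (D s) = 1" if "s \<in> V" for s
  proof -
    have "exp (g s) = exp (G s + E s)" using g[of s] LG[of s] V1[OF that] that VU by auto
    then show ?thesis by (simp add: D_def exp_diff)
  qed
  \<comment> \<open>\<open>D\<close> compares two logarithms of the same function: its exponential
    is 1, so its derivative vanishes and it is constant on the connected set
    \<open>V\<close>.\<close>
  have "deriv D s = 0" if s: "s \<in> V" for s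
  proof -
    have "((\<lambda>s. exp (D s)) has_field_derivative exp (D s) * deriv D s) (at s)"
      by (intro DERIV_chain2[OF DERIV_exp] holomorphic_derivI[OF D_hol opV s])
    moreover have "((\<lambda>s. exp (D s)) has_field_derivative 0) (at s)"
      by (rule has_field_derivative_transform_within_open[OF _ opV s, of "\<lambda>_. 1"]) (auto simp: expD)
    ultimately show ?thesis using DERIV_unique by fastforce
  qed
  then have "\<exists>c. \<forall>s\<in>V. D s = c"
    using DERIV_zero_connected_constant[OF convex_connected[OF cvV] opV finite.emptyI, of D]
      holomorphic_on_imp_continuous_on[OF D_hol] holomorphic_derivI[OF D_hol opV] by auto metis
  then obtain c where c: "\<And>s. s \<in> V \<Longrightarrow> D s = c" by blast
  define f where "f s = g s - c" for s
  have f_hol: "f holomorphic_on U" unfolding f_def by (intro holomorphic_intros g_hol)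
  have fV: "f s = G s + E s" if "s \<in> V" for s using c[OF that] by (simp add: f_def D_def algebra_simps)
  have "1 + 1 \<in> V" using T by (intro V2) auto
  then have expc: "exp c = 1" using expD c by metis
  have f: "L s = exp (f s)" if "s \<in> U" for s using g[OF that] expc by (simp add: f_def exp_diff)
  define F where "F z = f (1 + z) - E (1 + z)" for z
  let ?\<delta> = "r0 / 2" and ?R = "T / 2"
  have boxU: "1 + z \<in> U" if "- ?\<delta> \<le> Re z" "\<bar>Im z\<bar> \<le> ?R" for z using that r0 T by (intro U2) auto
  have W0: "W \<ge> 0" unfolding W_def using A0 CE0 r0 by simp
  have K: "cmod (F z) \<le> K" if z: "- ?\<delta> \<le> Re z" "Re z \<le> 0" "\<bar>Im z\<bar> \<le> ?R" for z
  proof -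
    \<comment> \<open>The disc of radius 2 r0 around \<open>s1\<close> just reaches the edge Re w =
      1 - r0 of the zero-free region, and the points with Re z \<ge> - r0 / 2 lie within 3 r0 / 2,
      three quarters of the radius. Halving the height leaves room for the disc.\<close>
    define s1 where "s1 = Complex (1 + r0) (Im z)"
    have ball: "w \<in> U \<and> 1/2 \<le> Re w \<and> Re w \<le> 3/2" if "w \<in> ball s1 (2 * r0)" for w
    proof -
      have "cmod (s1 - w) < 2 * r0" using that by (simp add: dist_norm)
      then have "\<bar>Re (s1 - w)\<bar> < 2 * r0" "\<bar>Im (s1 - w)\<bar> < 2 * r0"
        using abs_Re_le_cmod[of "s1 - w"] abs_Im_le_cmod[of "s1 - w"] by linarith+
      then have 1: "\<bar>1 + r0 - Re w\<bar> < 2 * r0" "\<bar>Im z - Im w\<bar> < 2 * r0" by (simp_all add: s1_def)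
      have "\<bar>Im w\<bar> < T" using 1(2) z(3) r0 T by linarith
      then show ?thesis using 1(1) r0 by (intro conjI U2) linarith+
    qed
    have s1V: "s1 \<in> V" using z(3) T r0 by (intro V2) (auto simp: s1_def)
    have fs1: "cmod (f s1) \<le> W"
    proof -
      have "cmod (f s1) \<le> cmod (G s1) + cmod (E s1)" unfolding fV[OF s1V] by (rule norm_triangle_ineq)
      also have "\<dots> \<le> A * (1 + 1 / (Re s1 - 1)) + CE"
        using r0 by (intro add_mono G_bd E(2)) (auto simp: s1_def)
      finally show ?thesis by (simp add: W_def s1_def)
    qed
    have "cmod (f (1 + z) - f s1) \<le> 6 * (M + W + 1)"
    proof (rule borel_caratheodory_three_quarters[where f = f and c = s1 and z = "1 + z" and r = "2 * r0"])
      show "f holomorphic_on ball s1 (2 * r0)" using ball by (intro holomorphic_on_subset[OF f_hol]) auto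
      fix w assume w: "w \<in> ball s1 (2 * r0)"
      have "exp (Re (f w)) = cmod (L w)" using f ball[OF w] by (simp add: norm_exp_eq_Re)
      also have "\<dots> \<le> exp M" using ball[OF w] U1(2)[of w] by (intro bd) auto
      finally have "Re (f w) \<le> M" by simp
      moreover have "- Re (f s1) \<le> W" using abs_Re_le_cmod[of "f s1"] fs1 by linarith
      ultimately show "Re (f w - f s1) < M + W + 1" by simp
    next
      have "s1 - (1 + z) = of_real (r0 - Re z)" by (simp add: s1_def complex_eq_iff)
      then have "dist s1 (1 + z) = \<bar>r0 - Re z\<bar>" unfolding dist_norm by (simp only: norm_of_real)
      then show "dist s1 (1 + z) \<le> 3 / 4 * (2 * r0)" using z r0 by simp
    qed (use r0 M W0 in auto)
    then have "cmod (f (1 + z)) \<le> 6 * (M + W + 1) + W"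
      using fs1 norm_triangle_ineq[of "f (1 + z) - f s1" "f s1"] by simp
    moreover have "cmod (E (1 + z)) \<le> CE" using z r0 by (intro E(2)) auto
    ultimately show ?thesis
      unfolding F_def K_def using norm_triangle_ineq4[of "f (1 + z)" "E (1 + z)"] by linarith
  qed
  have "cmod (F 0 - (\<Sum>n\<le>N. a n / of_nat n))
    \<le> 6 * A / ?R + K * ?\<delta>\<^sup>2 / ?R\<^sup>2 + K * ?R * real N powr (- ?\<delta>) / ?\<delta>" if N: "real N \<ge> ?R" for N
  proof (rule newman_estimate[where F = F and a = a and A = A and K = K and R = ?R and \<delta> = ?\<delta>])
    have img: "(\<lambda>z. 1 + z) ` cbox (Complex (- ?\<delta>) (- ?R)) (Complex ?R ?R) \<subseteq> U"
      by (rule image_subsetI, rule boxU) (auto simp: in_cbox_complex_iff)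
    have imgE: "(\<lambda>z. 1 + z) ` cbox (Complex (- ?\<delta>) (- ?R)) (Complex ?R ?R) \<subseteq> {s. Re s > 3/4}"
      using r0 by (auto simp: in_cbox_complex_iff)
    show "F holomorphic_on cbox (Complex (- ?\<delta>) (- ?R)) (Complex ?R ?R)"
      unfolding F_def
      by (intro holomorphic_on_diff holomorphic_on_compose_gen[OF _ f_hol img, unfolded o_def]
            holomorphic_on_compose_gen[OF _ E(1) imgE, unfolded o_def] holomorphic_intros)
    fix z assume z: "Re z > 0" "Re z \<le> ?R" "\<bar>Im z\<bar> \<le> ?R"
    have "1 + z \<in> V" using z T by (intro V2) auto
    then have "F z = G (1 + z)" by (simp add: F_def fV)
    then show "(\<lambda>n. a n * of_nat n powr (-1 - z)) sums F z" using G[of "1 + z"] z by simp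
  qed (use a K N r0 T in auto)
  then show ?thesis by blast
qed

text \<open>The logarithm of a local factor minus its linear term is of second order. For Re s > 3/4
  this is O(n^(-3/2)), so everything but the sum over primes converges to the left of 1 and goes
  into \<open>E\<close>. With |y| \<le> 3/5 the principal logarithm is holomorphic and the constant
  1 / (1 - 3/5) stays below 3.\<close>

lemma has_euler_product_log:
  fixes b :: "nat \<Rightarrow> complex" and \<beta> :: "nat \<Rightarrow> nat \<Rightarrow> complex"
  assumes ep: "has_euler_product d b \<beta>"
    and \<beta>: "\<And>p j. prime p \<Longrightarrow> j < d \<Longrightarrow> cmod (\<beta> j p) \<le> 1"
    and a: "\<And>n. a n = (if prime n then \<Sum>j<d. \<beta> j n else 0)"
  obtains E where "E holomorphic_on {s. Re s > 3/4}"
    "\<And>s. Re s > 3/4 \<Longrightarrow> cmod (E s) \<le> 3 * real d * (\<Sum>n. real n powr (-3/2))"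
    "\<And>s. Re s > 1 \<Longrightarrow> dirichlet_series b s = exp ((\<Sum>n. a n * of_nat n powr (- s)) + E s)"
proof -
  let ?S = "{s. Re s > 3/4}"
  define y where "y j n s = \<beta> j n * of_nat n powr (- s)" for j n s
  define e where "e n s = (if prime n then \<Sum>j<d. - Ln (1 - y j n s) - y j n s else 0)" for n s
  have op: "open ?S" by (rule open_halfspace_Re_gt)
  have summ: "summable (\<lambda>n. real n powr (-3/2))" by (simp add: summable_real_powr_iff)
  have y_le: "cmod (y j n s) \<le> real n powr (-3/4)" "cmod (y j n s) \<le> 3/5"
    if "prime n" "j < d" "Re s > 3/4" for j n s
  proof -
    have n2: "n \<ge> 2" using that(1) by (rule prime_ge_2_nat)
    have "cmod (y j n s) = cmod (\<beta> j n) * real n powr (- Re s)"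
      by (simp add: y_def norm_mult norm_powr_real_powr)
    also have "\<dots> \<le> 1 * real n powr (-3/4)"
      using that n2 by (intro mult_mono \<beta> powr_mono) auto
    finally show 1: "cmod (y j n s) \<le> real n powr (-3/4)" by simp
    \<comment> \<open>That 2^(-3/4) is at most 3/5 is checked on fourth powers: 1/8 \<le>
      81/625.\<close>
    have "(real n powr (-3/4)) ^ 4 = real n powr (-3)"
      using powr_powr[of "real n" "-3/4" 4] powr_realpow[of "real n powr (-3/4)" 4] n2 by simp
    also have "\<dots> \<le> 2 powr (-3)" using n2 by (intro powr_mono2') auto
    also have "\<dots> \<le> (3/5) ^ 4" by (simp add: powr_minus powr_numeral power_divide)
    finally have "real n powr (-3/4) \<le> 3/5"
      using power_mono_iff[of "real n powr (-3/4)" "3/5" 4] by simp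
    with 1 show "cmod (y j n s) \<le> 3/5" by linarith
  qed
  have e_le: "cmod (e n s) \<le> 3 * real d * real n powr (-3/2)" if s: "Re s > 3/4" for n s
  proof (cases "prime n")
    case True
    have n0: "n > 0" using True prime_gt_0_nat by blast
    have "cmod (e n s) \<le> (\<Sum>j<d. 3 * real n powr (-3/2))"
      unfolding e_def if_P[OF True]
    proof (intro order.trans[OF norm_sum] sum_mono)
      fix j assume "j \<in> {..<d}"
      then have j: "j < d" by simp
      note yl = y_le[OF True j s]
      have "cmod (- Ln (1 - y j n s) - y j n s) = cmod (Ln (1 + (- y j n s)) - (- y j n s))"
        by (metis add_uminus_conv_diff minus_diff_eq norm_minus_commute uminus_add_conv_diff)
      also have "\<dots> \<le> (cmod (- y j n s))\<^sup>2 / (1 - cmod (- y j n s))"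
        by (rule Ln_approx_linear) (use yl in simp)
      also have "\<dots> \<le> (real n powr (-3/4))\<^sup>2 / (2/5)"
        using yl by (intro frac_le power_mono) auto
      also have "(real n powr (-3/4))\<^sup>2 = real n powr (-3/2)"
        using n0 by (simp add: power2_eq_square flip: powr_add)
      also have "real n powr (-3/2) / (2/5) \<le> 3 * real n powr (-3/2)" by simp
      finally show "cmod (- Ln (1 - y j n s) - y j n s) \<le> 3 * real n powr (-3/2)" .
    qed
    then show ?thesis by simp
  qed (simp add: e_def)
  have e_diff: "e n field_differentiable (at s)" if "s \<in> ?S" for n s
  proof (cases "prime n")
    case True
    then have n0: "n > 0" using prime_gt_0_nat by blast
    have "(\<lambda>s. \<Sum>j<d. - Ln (1 - y j n s) - y j n s) holomorphic_on ?S"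
    proof (intro holomorphic_intros)
      fix j assume "j \<in> {..<d}"
      show "y j n holomorphic_on ?S" unfolding y_def using n0 by (intro holomorphic_intros) auto
      then show "y j n holomorphic_on ?S" .
      fix s assume "s \<in> ?S"
      then have "cmod (y j n s) \<le> 3/5" using y_le[OF True] \<open>j \<in> {..<d}\<close> by auto
      then have "Re (y j n s) \<le> 3/5" using complex_Re_le_cmod[of "y j n s"] by linarith
      then show "1 - y j n s \<notin> \<real>\<^sub>\<le>\<^sub>0" by (auto simp: complex_nonpos_Reals_iff)
    qed
    moreover have "e n = (\<lambda>s. \<Sum>j<d. - Ln (1 - y j n s) - y j n s)"
      by (rule ext) (simp add: e_def True)
    ultimately have "e n holomorphic_on ?S" by (simp only:)
    then show ?thesis using that op holomorphic_on_imp_differentiable_at by blast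
  next
    case False
    then have "e n = (\<lambda>_. 0)" by (auto simp: e_def)
    then show ?thesis by simp
  qed
  have "\<exists>E. \<forall>s\<in>?S. ((\<lambda>n. e n s) sums E s) \<and> E field_differentiable (at s)"
  proof (rule series_differentiable_comparison_complex[OF op e_diff])
    fix s assume "s \<in> ?S"
    define h where "h n = complex_of_real (3 * real d * real n powr (-3/2))" for n
    have "summable h" unfolding h_def by (intro summable_of_real summable_mult summ)
    moreover have "range h \<subseteq> \<real>\<^sub>\<ge>\<^sub>0" by (auto simp: h_def)
    moreover have "\<forall>\<^sub>F n in sequentially. \<forall>z\<in>ball s 1 \<inter> ?S. cmod (e n z) \<le> cmod (h n)"
      by (intro always_eventually allI ballI) (use e_le in \<open>auto simp: h_def norm_mult\<close>)
    ultimately show "\<exists>d h. 0 < d \<and> summable h \<and> range h \<subseteq> \<real>\<^sub>\<ge>\<^sub>0 \<and>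
        (\<forall>\<^sub>F n in sequentially. \<forall>z\<in>ball s d \<inter> ?S. cmod (e n z) \<le> cmod (h n))"
      using zero_less_one by blast
  qed blast+
  then obtain E where E: "\<And>s. Re s > 3/4 \<Longrightarrow> (\<lambda>n. e n s) sums E s"
    "\<And>s. Re s > 3/4 \<Longrightarrow> E field_differentiable (at s)" by auto
  have "E holomorphic_on ?S"
    using E(2) by (auto simp: holomorphic_on_def intro: field_differentiable_at_within)
  moreover have "cmod (E s) \<le> 3 * real d * (\<Sum>n. real n powr (-3/2))" if "Re s > 3/4" for s
    using norm_suminf_le[OF e_le[OF that] summable_mult[OF summ]]
    unfolding sums_unique[OF E(1)[OF that]] suminf_mult[OF summ] .
  moreover have "dirichlet_series b s = exp ((\<Sum>n. a n * of_nat n powr (- s)) + E s)" if s: "Re s > 1" for s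
  proof -
    have a_bd: "cmod (a n) \<le> real d" for n
    proof (cases "prime n")
      case True
      have "cmod (\<Sum>j<d. \<beta> j n) \<le> (\<Sum>j<d. 1)"
        by (intro order.trans[OF norm_sum] sum_mono \<beta> True) auto
      then show ?thesis using True by (simp add: a)
    qed (simp add: a)
    obtain G where G: "\<And>s. Re s > 1 \<Longrightarrow> (\<lambda>n. a n * of_nat n powr (- s)) sums G s"
      by (rule dirichlet_series_bounded_coeffs[of a "real d"]) (use a_bd in auto)
    have t: "(\<lambda>n. a n * of_nat n powr (- s) + e n s) sums (G s + E s)"
      using s by (intro sums_add G E) auto
    have lf: "local_factor d \<beta> s n = exp (a n * of_nat n powr (- s) + e n s)" for n
    proof (cases "prime n")
      case True
      have "a n * of_nat n powr (- s) + e n s = (\<Sum>j<d. - Ln (1 - y j n s))"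
        using True by (simp add: a e_def y_def sum_distrib_right sum.distrib[symmetric])
      then have "exp (a n * of_nat n powr (- s) + e n s) = (\<Prod>j<d. exp (- Ln (1 - y j n s)))"
        by (simp add: exp_sum)
      also have "\<dots> = (\<Prod>j<d. inverse (1 - \<beta> j n / of_nat n powr s))"
      proof (intro prod.cong refl)
        fix j assume "j \<in> {..<d}"
        then have "cmod (y j n s) \<le> 3/5" using y_le[OF True] s by auto
        then have "1 - y j n s \<noteq> 0" by auto
        then have "exp (- Ln (1 - y j n s)) = inverse (1 - y j n s)" by (simp add: exp_minus)
        then show "exp (- Ln (1 - y j n s)) = inverse (1 - \<beta> j n / of_nat n powr s)"
          by (simp add: y_def powr_minus divide_inverse)
      qed
      finally show ?thesis using True by (simp add: local_factor_def)
    qed (simp add: local_factor_def e_def a)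
    have "abs_convergent_prod (local_factor d \<beta> s)" and ds: "dirichlet_series b s = prodinf (local_factor d \<beta> s)"
      using ep s by (auto simp: has_euler_product_def)
    then have "(\<lambda>n. \<Prod>i\<le>n. local_factor d \<beta> s i) \<longlonglongrightarrow> prodinf (local_factor d \<beta> s)"
      by (intro convergent_prod_LIMSEQ abs_convergent_prod_imp_convergent_prod)
    moreover have "(\<lambda>n. \<Prod>i\<le>n. local_factor d \<beta> s i) = (\<lambda>n. exp (\<Sum>i\<le>n. a i * of_nat i powr (- s) + e i s))"
      by (simp add: lf exp_sum)
    moreover have "(\<lambda>n. exp (\<Sum>i\<le>n. a i * of_nat i powr (- s) + e i s)) \<longlonglongrightarrow> exp (G s + E s)"
      using t unfolding sums_def_le by (rule tendsto_exp)
    ultimately have "prodinf (local_factor d \<beta> s) = exp (G s + E s)"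
      using LIMSEQ_unique by metis
    then show ?thesis using ds sums_unique[OF G[OF s]] by simp
  qed
  ultimately show ?thesis using that by blast
qed

section \<open>The convexity bound\<close>

text \<open>The triangle inequality in Euler's integral.\<close>

lemma norm_Gamma_le:
  assumes "Re z > 0"
  shows "cmod (Gamma z) \<le> Gamma (Re z)"
proof -
  let ?f = "\<lambda>t. complex_of_real t powr (z - 1) / complex_of_real (exp t)"
  let ?g = "\<lambda>t. t powr (Re z - 1) / exp t"
  have f: "(?f has_integral Gamma z) {0..}" by (rule Gamma_integral_complex[OF assms])
  have g: "(?g has_integral Gamma (Re z)) {0..}" by (rule Gamma_integral_real[OF assms])
  have "cmod (integral {0..} ?f) \<le> integral {0..} ?g"
  proof (rule Henstock_Kurzweil_Integration.integral_norm_bound_integral)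
    fix t :: real assume "t \<in> {0..}"
    then show "cmod (?f t) \<le> ?g t" by (simp add: norm_divide norm_powr_real_powr)
  qed (use f g in \<open>auto intro: has_integral_integrable\<close>)
  then show ?thesis using integral_unique[OF f] integral_unique[OF g] by simp
qed

lemma norm_sin_le_exp: "cmod (sin w) \<le> exp \<bar>Im w\<bar>"
proof -
  have "sin w = (exp (\<i> * w) - exp (- (\<i> * w))) / (2 * \<i>)" by (rule sin_exp_eq)
  then have "cmod (sin w) \<le> (cmod (exp (\<i> * w)) + cmod (exp (- (\<i> * w)))) / 2"
    using norm_triangle_ineq4[of "exp (\<i> * w)" "exp (- (\<i> * w))"] by (simp add: norm_divide norm_mult)
  also have "\<dots> = (exp (- Im w) + exp (Im w)) / 2" by simp
  also have "\<dots> \<le> (exp \<bar>Im w\<bar> + exp \<bar>Im w\<bar>) / 2"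
    by (intro divide_right_mono add_mono) auto
  finally show ?thesis by simp
qed

text \<open>Each step divides by a number of modulus at least |Im z| \<ge> 1.\<close>

lemma norm_rGamma_shift:
  assumes "\<bar>Im z\<bar> \<ge> 1"
  shows "cmod (rGamma (z + of_nat k)) \<le> cmod (rGamma z)"
proof (induction k)
  case (Suc k)
  let ?w = "z + of_nat k"
  have "1 \<le> cmod ?w" using abs_Im_le_cmod[of ?w] assms by simp
  then have "1 * cmod (rGamma (?w + 1)) \<le> cmod ?w * cmod (rGamma (?w + 1))"
    by (intro mult_right_mono) auto
  also have "\<dots> = cmod (rGamma ?w)" using rGamma_plus1[of ?w] by (metis norm_mult)
  finally show ?case using Suc.IH by (simp add: add_ac)
qed simp

text \<open>Crude growth, enough for the a priori bound that Phragmen-Lindelof asks for. After a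
  shift to the left by k, which brings the real part of 1 - w to at least 1/2, the reflection
  formula expresses 1 / Gamma by a sine and by Gamma in a strip, where it is bounded by its values
  on a compact real interval.\<close>

lemma norm_rGamma_strip:
  obtains C where "C \<ge> 0" "\<And>z. a \<le> Re z \<Longrightarrow> Re z \<le> b \<Longrightarrow> \<bar>Im z\<bar> \<ge> 1 \<Longrightarrow> cmod (rGamma z) \<le> C * exp (pi * \<bar>Im z\<bar>)"
proof -
  obtain k :: nat where k: "b - 1/2 \<le> real k" using real_arch_simple by blast
  define l where "l = 1 - (b - real k)"
  define u where "u = 1 - (a - real k)"
  have l: "l > 0" using k by (simp add: l_def)
  have "compact ((\<lambda>x. Gamma x) ` {l..u})"
  proof (rule compact_continuous_image)
    show "continuous_on {l..u} (Gamma :: real \<Rightarrow> real)"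
      using l by (intro continuous_on_Gamma) (auto elim!: nonpos_Ints_cases)
  qed auto
  then obtain M where M: "\<And>x. x \<in> {l..u} \<Longrightarrow> norm (Gamma x) \<le> M"
    by (metis compact_imp_bounded bounded_iff imageI)
  define C where "C = \<bar>M\<bar>"
  have "cmod (rGamma z) \<le> C * exp (pi * \<bar>Im z\<bar>)" if z: "a \<le> Re z" "Re z \<le> b" "\<bar>Im z\<bar> \<ge> 1" for z
  proof -
    define w where "w = z - of_nat k"
    have Imw: "Im w = Im z" by (simp add: w_def)
    have Rew: "Re (1 - w) \<in> {l..u}" using z by (simp add: w_def l_def u_def)
    then have pos: "Re (1 - w) > 0" using l by simp
    have nz: "Gamma (1 - w) \<noteq> 0"
      using pos unfolding Gamma_eq_zero_iff by (auto elim!: nonpos_Ints_cases simp: complex_eq_iff)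
    have "rGamma w = (rGamma w * rGamma (1 - w)) * Gamma (1 - w)"
      using nz by (simp add: rGamma_inverse_Gamma)
    also have "rGamma w * rGamma (1 - w) = sin (of_real pi * w) / of_real pi"
      by (rule rGamma_reflection_complex)
    finally have "cmod (rGamma w) = cmod (sin (of_real pi * w)) / pi * cmod (Gamma (1 - w))"
      by (simp add: norm_mult norm_divide)
    also have "\<dots> \<le> exp (pi * \<bar>Im z\<bar>) / 1 * C"
    proof (intro mult_mono frac_le)
      show "cmod (sin (of_real pi * w)) \<le> exp (pi * \<bar>Im z\<bar>)"
        using norm_sin_le_exp[of "of_real pi * w"] by (simp add: Imw abs_mult)
      show "cmod (Gamma (1 - w)) \<le> C"
        using norm_Gamma_le[OF pos] M[OF Rew] by (simp add: C_def)
    qed (use pi_gt3 in auto)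
    finally have "cmod (rGamma w) \<le> C * exp (pi * \<bar>Im z\<bar>)" by (simp add: mult_ac)
    moreover have "cmod (rGamma (w + of_nat k)) \<le> cmod (rGamma w)"
      by (rule norm_rGamma_shift) (use z Imw in simp)
    ultimately show ?thesis by (simp add: w_def)
  qed
  then show ?thesis using that[of C] by (simp add: C_def)
qed

text \<open>The factor exp((z - s)^2) equals 1 at z = s and decays like a Gaussian in Im z - Im s.
  On remote horizontal sides this beats the growth exponent 3/2, which may be any number between the
  order 1 and the Gaussian 2; on the vertical sides it absorbs the change of the polynomial from Im
  s to Im z. The 4 in the constant is the squared width of the strip, and d^2 comes from 2 d u \<le>
  d^2 + u^2.\<close>

lemma phragmen_lindelof_strip:
  fixes h :: "complex \<Rightarrow> complex"
  assumes h: "h holomorphic_on UNIV" and B: "B \<ge> 0" and m: "m \<ge> 0" and c: "c > 0" and C: "C \<ge> 0"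
    and growth: "\<And>s. -1/2 \<le> Re s \<Longrightarrow> Re s \<le> 3/2 \<Longrightarrow> \<bar>Im s\<bar> \<ge> Y0 \<Longrightarrow> cmod (h s) \<le> C * exp (c * \<bar>Im s\<bar> powr (3/2))"
    and bd: "\<And>s. Re s = -1/2 \<or> Re s = 3/2 \<Longrightarrow> cmod (h s) \<le> B * (1 + \<bar>Im s\<bar> + m) ^ d"
    and s: "-1/2 \<le> Re s" "Re s \<le> 3/2"
  shows "cmod (h s) \<le> B * exp (4 + (real d)\<^sup>2) * (1 + \<bar>Im s\<bar> + m) ^ d"
proof -
  let ?B = "B * exp (4 + (real d)\<^sup>2) * (1 + \<bar>Im s\<bar> + m) ^ d"
  define f where "f z = h z * exp ((z - s)\<^sup>2)" for z
  have norm_f: "cmod (f z) = cmod (h z) * exp ((Re z - Re s)\<^sup>2 - (Im z - Im s)\<^sup>2)" for z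
    by (simp add: f_def norm_mult power2_eq_square)
  have sq4: "(Re z - Re s)\<^sup>2 \<le> 4" if "-1/2 \<le> Re z" "Re z \<le> 3/2" for z
  proof -
    have "\<bar>Re z - Re s\<bar> \<le> 2" using that s by linarith
    then show ?thesis using abs_le_square_iff[of "Re z - Re s" 2] by simp
  qed
  have side: "cmod (f z) \<le> ?B" if z: "Re z = -1/2 \<or> Re z = 3/2" for z
  proof -
    define u where "u = \<bar>Im z - Im s\<bar>"
    have u0: "u \<ge> 0" by (simp add: u_def)
    have "1 + \<bar>Im z\<bar> + m \<le> (1 + u) + (\<bar>Im s\<bar> + m)" by (simp add: u_def)
    also have "\<dots> \<le> (1 + u) * (1 + \<bar>Im s\<bar> + m)"
      using u0 m by (simp add: algebra_simps)
    finally have "(1 + \<bar>Im z\<bar> + m) ^ d \<le> ((1 + u) * (1 + \<bar>Im s\<bar> + m)) ^ d"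
      using m by (intro power_mono) auto
    also have "\<dots> = (1 + u) ^ d * (1 + \<bar>Im s\<bar> + m) ^ d" by (rule power_mult_distrib)
    also have "\<dots> \<le> exp (real d * u) * (1 + \<bar>Im s\<bar> + m) ^ d"
    proof (intro mult_right_mono)
      have "(1 + u) ^ d \<le> exp u ^ d" using u0 exp_ge_add_one_self[of u] by (intro power_mono) auto
      then show "(1 + u) ^ d \<le> exp (real d * u)" by (simp add: exp_of_nat_mult)
    qed (use m in auto)
    finally have 1: "(1 + \<bar>Im z\<bar> + m) ^ d \<le> exp (real d * u) * (1 + \<bar>Im s\<bar> + m) ^ d" .
    have "cmod (f z) \<le> (B * (1 + \<bar>Im z\<bar> + m) ^ d) * exp (4 - u\<^sup>2)"
      unfolding norm_f using sq4[of z] z B m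
      by (intro mult_mono bd) (auto simp: u_def)
    also have "\<dots> \<le> (B * (exp (real d * u) * (1 + \<bar>Im s\<bar> + m) ^ d)) * exp (4 - u\<^sup>2)"
      using 1 B by (intro mult_right_mono mult_left_mono) auto
    also have "\<dots> = B * (1 + \<bar>Im s\<bar> + m) ^ d * exp (real d * u + (4 - u\<^sup>2))"
      by (simp add: exp_add)
    also have "\<dots> \<le> B * (1 + \<bar>Im s\<bar> + m) ^ d * exp (4 + (real d)\<^sup>2)"
    proof (intro mult_left_mono)
      have "2 * (real d * u) \<le> (real d)\<^sup>2 + u\<^sup>2" using sum_squares_bound[of "real d" u] by simp
      moreover have "0 \<le> u\<^sup>2" "0 \<le> (real d)\<^sup>2" by auto
      ultimately have "real d * u + (4 - u\<^sup>2) \<le> 4 + (real d)\<^sup>2" by linarith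
      then show "exp (real d * u + (4 - u\<^sup>2)) \<le> exp (4 + (real d)\<^sup>2)" by simp
    qed (use B m in auto)
    finally show ?thesis by (simp add: mult_ac)
  qed
  have "cmod (h s) \<le> ?B + e" if e: "e > 0" for e
  proof -
    have "((\<lambda>t. C * exp (c * t powr (3/2) + 4 - (t - \<bar>Im s\<bar>)\<^sup>2)) \<longlongrightarrow> 0) at_top"
      using c by real_asymp
    then have "eventually (\<lambda>t. C * exp (c * t powr (3/2) + 4 - (t - \<bar>Im s\<bar>)\<^sup>2) < e) at_top"
      by (rule order_tendstoD(2)) (rule e)
    then obtain Y1 where Y1: "\<And>t. t \<ge> Y1 \<Longrightarrow> C * exp (c * t powr (3/2) + 4 - (t - \<bar>Im s\<bar>)\<^sup>2) < e"
      by (auto simp: eventually_at_top_linorder)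
    define Y where "Y = max (max Y0 Y1) (\<bar>Im s\<bar> + 1)"
    have Y: "Y \<ge> Y0" "Y \<ge> Y1" "Y > \<bar>Im s\<bar>" by (auto simp: Y_def)
    have top: "cmod (f z) \<le> e" if z: "-1/2 \<le> Re z" "Re z \<le> 3/2" "\<bar>Im z\<bar> = Y" for z
    proof -
      have "(Y - \<bar>Im s\<bar>)\<^sup>2 \<le> (Im z - Im s)\<^sup>2"
      proof -
        have "Y - \<bar>Im s\<bar> \<le> \<bar>Im z - Im s\<bar>" using z(3) by linarith
        then have "(Y - \<bar>Im s\<bar>)\<^sup>2 \<le> \<bar>Im z - Im s\<bar>\<^sup>2" using Y by (intro power_mono) auto
        then show ?thesis by simp
      qed
      then have "cmod (f z) \<le> (C * exp (c * Y powr (3/2))) * exp (4 - (Y - \<bar>Im s\<bar>)\<^sup>2)"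
        unfolding norm_f using growth[of z] z Y sq4[of z] C
        by (intro mult_mono) auto
      also have "\<dots> = C * exp (c * Y powr (3/2) + 4 - (Y - \<bar>Im s\<bar>)\<^sup>2)"
        by (simp add: exp_add[symmetric] add_diff_eq mult.assoc)
      also have "\<dots> \<le> e" using Y1[of Y] Y by simp
      finally show ?thesis .
    qed
    let ?S = "cbox (Complex (-1/2) (-Y)) (Complex (3/2) Y)"
    have "cmod (f s) \<le> ?B + e"
    proof (rule maximum_modulus_frontier[of f ?S])
      show "f holomorphic_on interior ?S"
        unfolding f_def by (intro holomorphic_intros holomorphic_on_subset[OF h]) auto
      have "f holomorphic_on UNIV" unfolding f_def by (intro holomorphic_intros h)
      then show "continuous_on (closure ?S) f"
        using holomorphic_on_imp_continuous_on continuous_on_subset by blast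
      show "bounded ?S" by (rule bounded_cbox)
      show "s \<in> ?S" using s Y by (auto simp: in_cbox_complex_iff)
      fix z assume "z \<in> frontier ?S"
      then have z: "z \<in> ?S" "z \<notin> box (Complex (-1/2) (-Y)) (Complex (3/2) Y)"
        unfolding frontier_cbox by auto
      then have "(Re z = -1/2 \<or> Re z = 3/2) \<or> (-1/2 \<le> Re z \<and> Re z \<le> 3/2 \<and> \<bar>Im z\<bar> = Y)"
        unfolding in_cbox_complex_iff in_box_complex_iff by (simp add: abs_if) linarith
      moreover have "?B \<ge> 0" using B m by simp
      ultimately show "cmod (f z) \<le> ?B + e" using side[of z] top[of z] e by fastforce
    qed
    then show ?thesis by (simp add: f_def)
  qed
  then show ?thesis by (rule field_le_epsilon)
qed

section \<open>Gamma factors of the functional equation and the dual function\<close>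

lemma real_pi_powr_norm: "cmod (of_real pi powr z) = pi powr Re z"
  by (simp add: norm_powr_real_powr)

text \<open>The reciprocal of \<open>L_inf\<close>, written with the entire function
  \<open>rGamma\<close> so that the poles of the gamma factors need no exception.\<close>

definition rL_inf :: "nat \<Rightarrow> nat \<Rightarrow> (nat \<Rightarrow> complex) \<Rightarrow> complex \<Rightarrow> complex" where
  "rL_inf d N m s = of_nat N powr (- s / 2) * (\<Prod>j<d. of_real pi powr ((s + m j) / 2) * rGamma ((s + m j) / 2))"

lemma rL_inf_holomorphic: "N \<ge> 1 \<Longrightarrow> rL_inf d N m holomorphic_on A"
  unfolding rL_inf_def by (intro holomorphic_intros) auto

lemma not_nonpos_Ints_Re_pos: "Re z > 0 \<Longrightarrow> z \<notin> \<int>\<^sub>\<le>\<^sub>0" for z :: complex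
  by (auto elim!: nonpos_Ints_cases)

text \<open>Shifting by 2 raises the arguments of the gamma factors by 1, so that
  \<open>\<Gamma>(w + 1) = w \<Gamma>(w)\<close> replaces Stirling's formula.\<close>

lemma L_inf_shift:
  assumes N: "N \<ge> 1" and pos: "\<And>j. j < d \<Longrightarrow> Re (s + m j) > -2"
  shows "L_inf d N m (s + 2) * rL_inf d N m s = of_nat N * (\<Prod>j<d. (s + m j) / (2 * of_real pi))"
proof -
  have N0: "of_nat N \<noteq> (0::complex)" using N by auto
  have "of_nat N powr ((s + 2) / 2) * of_nat N powr (- s / 2) = (of_nat N :: complex) powr 1"
    unfolding powr_add[symmetric] by (simp add: add_divide_distrib)
  then have 1: "of_nat N powr ((s + 2) / 2) * of_nat N powr (- s / 2) = (of_nat N :: complex)"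
    using N0 by simp
  have 2: "Gamma_R (s + 2 + m j) * (of_real pi powr ((s + m j) / 2) * rGamma ((s + m j) / 2)) = (s + m j) / (2 * of_real pi)"
    if j: "j < d" for j
  proof -
    let ?w = "(s + m j) / 2"
    have w1: "(s + 2 + m j) / 2 = ?w + 1" by (simp add: field_simps)
    have "Re (?w + 1) > 0" using pos[OF j] by (simp add: field_simps)
    then have "Gamma (?w + 1) \<noteq> 0" using not_nonpos_Ints_Re_pos Gamma_eq_zero_iff by blast
    then have G: "Gamma (?w + 1) * rGamma ?w = ?w"
      unfolding rGamma_plus1[of ?w, symmetric] by (simp add: rGamma_inverse_Gamma)
    have "- (s + 2 + m j) / 2 + ?w = -1" by (simp add: field_simps)
    then have P: "of_real pi powr (- (s + 2 + m j) / 2) * of_real pi powr ?w = (of_real pi :: complex) powr (-1)"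
      by (simp only: powr_add[symmetric])
    have "Gamma_R (s + 2 + m j) * (of_real pi powr ?w * rGamma ?w)
        = (of_real pi powr (- (s + 2 + m j) / 2) * of_real pi powr ?w) * (Gamma (?w + 1) * rGamma ?w)"
      unfolding Gamma_R_def w1 by (simp only: mult_ac)
    also have "\<dots> = (s + m j) / (2 * of_real pi)"
      unfolding P G by (simp add: powr_minus field_simps)
    finally show ?thesis .
  qed
  have "L_inf d N m (s + 2) * rL_inf d N m s
      = (of_nat N powr ((s + 2) / 2) * of_nat N powr (- s / 2)) *
        (\<Prod>j<d. Gamma_R (s + 2 + m j) * (of_real pi powr ((s + m j) / 2) * rGamma ((s + m j) / 2)))"
    unfolding L_inf_def rL_inf_def prod.distrib by (simp only: mult_ac)
  also have "\<dots> = of_nat N * (\<Prod>j<d. (s + m j) / (2 * of_real pi))"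
    unfolding 1 using 2 by (intro arg_cong2[of _ _ _ _ "(*)"] refl prod.cong) auto
  finally show ?thesis .
qed

lemma L_inf_inverse:
  assumes N: "N \<ge> 1" and pos: "\<And>j. j < d \<Longrightarrow> Re (s + m j) > 0"
  shows "L_inf d N m s * rL_inf d N m s = 1"
proof -
  have N0: "of_nat N \<noteq> (0::complex)" using N by auto
  have "of_nat N powr (s / 2) * of_nat N powr (- s / 2) = (of_nat N :: complex) powr 0"
    unfolding powr_add[symmetric] by simp
  then have 1: "of_nat N powr (s / 2) * of_nat N powr (- s / 2) = (1 :: complex)"
    using N0 by simp
  have 2: "Gamma_R (s + m j) * (of_real pi powr ((s + m j) / 2) * rGamma ((s + m j) / 2)) = 1"
    if j: "j < d" for j
  proof -
    let ?w = "(s + m j) / 2"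
    have "Re ?w > 0" using pos[OF j] by simp
    then have "Gamma ?w \<noteq> 0" using not_nonpos_Ints_Re_pos Gamma_eq_zero_iff by blast
    then have G: "Gamma ?w * rGamma ?w = 1" by (simp add: rGamma_inverse_Gamma)
    have "- (s + m j) / 2 + ?w = 0" by (simp add: field_simps)
    then have P: "of_real pi powr (- (s + m j) / 2) * of_real pi powr ?w = (of_real pi :: complex) powr 0"
      by (simp only: powr_add[symmetric])
    have "Gamma_R (s + m j) * (of_real pi powr ?w * rGamma ?w)
        = (of_real pi powr (- (s + m j) / 2) * of_real pi powr ?w) * (Gamma ?w * rGamma ?w)"
      unfolding Gamma_R_def by (simp only: mult_ac)
    also have "\<dots> = 1" unfolding P G by simp
    finally show ?thesis .
  qed
  have "L_inf d N m s * rL_inf d N m s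
      = (of_nat N powr (s / 2) * of_nat N powr (- s / 2)) *
        (\<Prod>j<d. Gamma_R (s + m j) * (of_real pi powr ((s + m j) / 2) * rGamma ((s + m j) / 2)))"
    unfolding L_inf_def rL_inf_def prod.distrib by (simp only: mult_ac)
  also have "\<dots> = 1" unfolding 1 using 2 by (simp add: prod.neutral)
  finally show ?thesis .
qed

lemma L_inf_cnj: "cnj (L_inf d N m (cnj s)) = L_inf d N (\<lambda>j. cnj (m j)) s"
proof -
  have "cnj (of_nat N powr (cnj s / 2)) = of_nat N powr (s / 2)"
    by (subst cnj_powr) auto
  moreover have "cnj (Gamma_R (cnj s + m j)) = Gamma_R (s + cnj (m j))" for j
    unfolding Gamma_R_def by (simp add: cnj_Gamma cnj_powr)
  ultimately show ?thesis by (simp add: L_inf_def cnj_prod)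
qed

lemma dirichlet_series_cnj: "cnj (dirichlet_series a (cnj s)) = dirichlet_series (\<lambda>n. cnj (a n)) s"
proof -
  have "cnj (of_nat n powr cnj s) = of_nat n powr s" for n
    by (cases "n = 0") (simp_all add: cnj_powr)
  then show ?thesis unfolding dirichlet_series_def infsum_cnj[symmetric] by simp
qed

text \<open>The dual completed function is the reflection \<open>cnj (g (cnj s))\<close>, so its
  continuation comes from that of the original and the functional equation relates \<open>g\<close>
  to itself.\<close>

lemma is_entire_extension_dual:
  assumes "is_entire_extension (Lambda_series d N m lam chi) g"
  shows "is_entire_extension (Lambda_series d N (\<lambda>j. cnj (m j)) (\<lambda>n. cnj (lam n)) (\<lambda>a. cnj (chi a))) (\<lambda>s. cnj (g (cnj s)))"
proof -
  have hol: "g holomorphic_on UNIV" and eq: "\<And>s. Re s > 1 \<Longrightarrow> g s = Lambda_series d N m lam chi s"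
    using assms by (auto simp: is_entire_extension_def)
  have "(cnj \<circ> g \<circ> cnj) holomorphic_on UNIV"
    by (rule holomorphic_on_compose_cnj_cnj) (use hol in \<open>auto intro: holomorphic_on_subset\<close>)
  moreover have "cnj (g (cnj s)) = Lambda_series d N (\<lambda>j. cnj (m j)) (\<lambda>n. cnj (lam n)) (\<lambda>a. cnj (chi a)) s"
    if "Re s > 1" for s
    using that by (simp add: eq Lambda_series_def L_inf_cnj dirichlet_series_cnj twist_def[abs_def])
  ultimately show ?thesis by (simp add: is_entire_extension_def o_def)
qed

section \<open>Twisted L-functions in the strip from -1/2 to 3/2\<close>

context twisted_L_framework
begin

text \<open>Covers both parities, since chi(-1) is 1 or -1; this makes the bound uniform in the
  modulus and the character.\<close>

definition "mu_max = (\<Sum>j<d. cmod (\<mu> 1 j)) + (\<Sum>j<d. cmod (\<mu> (-1) j))"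

lemma mu_max_nonneg: "mu_max \<ge> 0"
  unfolding mu_max_def by (intro add_nonneg_nonneg sum_nonneg) auto

lemma mu_le_mu_max:
  assumes "2 \<le> q" "primitive_dirichlet_char q chi" "j < d"
  shows "cmod (\<mu> (chi (-1)) j) \<le> mu_max"
proof -
  interpret dirichlet_character q chi
    using assms by unfold_locales (auto simp: primitive_dirichlet_char_def)
  have "chi (-1) * chi (-1) = 1" using mult[of "-1" "-1"] by simp
  then have sign: "chi (-1) = 1 \<or> chi (-1) = -1"
    using square_eq_1_iff[of "chi (-1)"] by simp
  have le: "cmod (\<mu> e j) \<le> (\<Sum>j<d. cmod (\<mu> e j))" for e
    using assms(3) by (intro member_le_sum) auto
  have ge: "(\<Sum>j<d. cmod (\<mu> e j)) \<ge> 0" for e by (intro sum_nonneg) auto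
  from sign show ?thesis
  proof
    assume "chi (-1) = 1"
    then show ?thesis unfolding mu_max_def using le[of 1] ge[of "-1"] by simp
  next
    assume "chi (-1) = -1"
    then show ?thesis unfolding mu_max_def using le[of "-1"] ge[of 1] by simp
  qed
qed

text \<open>Bounds every twisted series on the line Re s = 3/2, since characters have modulus at
  most 1.\<close>

definition "Z32 = (\<Sum>\<^sub>\<infinity>n\<in>{1..}. norm (lam n / of_nat n powr (3/2)))"

lemma Z32_nonneg: "Z32 \<ge> 0"
  unfolding Z32_def by (intro infsum_nonneg) auto

lemma norm_dirichlet_series_twist_le:
  assumes q: "2 \<le> q" "primitive_dirichlet_char q chi" and s: "Re s = 3/2"
  shows "cmod (dirichlet_series (twist lam chi) s) \<le> Z32"
proof -
  interpret dirichlet_character q chi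
    using q by unfold_locales (auto simp: primitive_dirichlet_char_def)
  have S: "(\<lambda>n. norm (lam n / of_nat n powr (3/2))) summable_on {1..}"
    using euler_product[unfolded has_euler_product_def, rule_format, of "3/2"] by simp
  have le: "cmod (twist lam chi n / of_nat n powr s) \<le> norm (lam n / of_nat n powr (3/2))" for n
  proof -
    have "cmod (twist lam chi n / of_nat n powr s) = cmod (lam n) * cmod (chi (int n)) / real n powr (3/2)"
      by (simp add: twist_def norm_mult norm_divide norm_powr_real_powr s)
    also have "\<dots> \<le> cmod (lam n) * 1 / real n powr (3/2)"
      by (intro divide_right_mono mult_left_mono norm_le_1) auto
    finally show ?thesis by (simp add: norm_divide norm_powr_real_powr)
  qed
  have S': "(\<lambda>n. norm (twist lam chi n / of_nat n powr s)) summable_on {1..}"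
    by (rule Infinite_Sum.abs_summable_on_comparison_test[OF S]) (rule le)
  have "cmod (dirichlet_series (twist lam chi) s) \<le> (\<Sum>\<^sub>\<infinity>n\<in>{1..}. cmod (twist lam chi n / of_nat n powr s))"
    unfolding dirichlet_series_def by (rule norm_infsum_bound[OF S'])
  also have "\<dots> \<le> Z32"
    unfolding Z32_def by (rule infsum_mono[OF S' S]) (rule le)
  finally show ?thesis .
qed

lemma theta_pos: "\<theta> > 0"
  using theta_bounds(1) by (meson divide_nonneg_nonneg le_less_trans mult_nonneg_nonneg of_nat_0_le_iff zero_le_numeral zero_le_one)

text \<open>The continuation is the completed function times \<open>rL_inf\<close>. On the left edge
  of the strip the reflection 1 - cnj s equals s + 2, so the functional equation compares the value
  at s with the absolutely convergent series at s + 2, and the gamma quotient is N times d linear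
  factors. Phragmen-Lindelof carries the bound across the strip.\<close>

lemma L_twist_properties:
  assumes q: "2 \<le> q" "primitive_dirichlet_char q chi"
  shows "L_twist lam chi holomorphic_on UNIV"
    and "\<And>s. Re s > 1 \<Longrightarrow> L_twist lam chi s = dirichlet_series (twist lam chi) s"
    and "\<And>s. -1/2 \<le> Re s \<Longrightarrow> Re s \<le> 3/2 \<Longrightarrow>
      cmod (L_twist lam chi s) \<le> Z32 * real (N q) * exp (4 + (real d)\<^sup>2) * (1 + \<bar>Im s\<bar> + mu_max) ^ d"
proof -
  define m where "m = \<mu> (chi (-1))"
  define Nq where "Nq = N q"
  have N1: "Nq \<ge> 1" using conductor_pos q by (simp add: Nq_def)
  have mu: "Re (m j) \<ge> -1 + \<theta>" "cmod (m j) \<le> mu_max" if "j < d" for j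
    using mu_bound[OF q that] mu_le_mu_max[OF q that] by (auto simp: m_def)
  obtain g where g: "is_entire_extension (Lambda_series d Nq m lam chi) g"
    using entire[OF q] by (auto simp: m_def Nq_def)
  have Lam: "Lambda_twist d Nq m lam chi = g"
    unfolding Lambda_twist_def by (rule entire_extension_eqI[OF g])
  have g_hol: "g holomorphic_on UNIV" and g_eq: "\<And>s. Re s > 1 \<Longrightarrow> g s = Lambda_series d Nq m lam chi s"
    using g by (auto simp: is_entire_extension_def)
  define h where "h s = g s * rL_inf d Nq m s" for s
  have h_hol: "h holomorphic_on UNIV"
    unfolding h_def by (intro holomorphic_intros g_hol rL_inf_holomorphic N1)
  have h_eq: "h s = dirichlet_series (twist lam chi) s" if "Re s > 1" for s
  proof -
    have "Re (s + m j) > 0" if "j < d" for j using mu(1)[OF that] \<open>Re s > 1\<close> theta_pos by simp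
    then have "L_inf d Nq m s * rL_inf d Nq m s = 1" by (intro L_inf_inverse N1)
    then show ?thesis unfolding h_def g_eq[OF that] Lambda_series_def by simp
  qed
  have L: "L_twist lam chi = h"
    unfolding L_twist_def by (rule entire_extension_eqI) (simp add: is_entire_extension_def h_hol h_eq)
  show "L_twist lam chi holomorphic_on UNIV" unfolding L by (rule h_hol)
  show "L_twist lam chi s = dirichlet_series (twist lam chi) s" if "Re s > 1" for s
    unfolding L by (rule h_eq[OF that])
  have dual: "Lambda_twist d Nq (\<lambda>j. cnj (m j)) (\<lambda>n. cnj (lam n)) (\<lambda>a. cnj (chi a)) = (\<lambda>s. cnj (g (cnj s)))"
    unfolding Lambda_twist_def by (rule entire_extension_eqI[OF is_entire_extension_dual[OF g]])
  \<comment> \<open>Only moduli matter, so the root number \<kappa> and the outer conjugation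
    disappear.\<close>
  have fe: "cmod (g s) = cmod (g (1 - cnj s))" for s
  proof -
    obtain \<kappa> where \<kappa>: "cmod \<kappa> = 1" "\<And>s. g s = \<kappa> * cnj (g (cnj (1 - s)))"
      using functional_equation[OF q] Lam dual by (auto simp: m_def Nq_def)
    show ?thesis unfolding \<kappa>(2)[of s] norm_mult \<kappa>(1) by simp
  qed
  have bd: "cmod (h s) \<le> (Z32 * real Nq) * (1 + \<bar>Im s\<bar> + mu_max) ^ d" if s: "Re s = -1/2 \<or> Re s = 3/2" for s
    using s
  proof
    assume s: "Re s = 3/2"
    have "1 * 1 \<le> real Nq * (1 + \<bar>Im s\<bar> + mu_max) ^ d"
      using N1 mu_max_nonneg by (intro mult_mono one_le_power) auto
    then have "Z32 * 1 \<le> Z32 * (real Nq * (1 + \<bar>Im s\<bar> + mu_max) ^ d)"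
      using Z32_nonneg by (intro mult_left_mono) auto
    moreover have "cmod (h s) \<le> Z32"
      using h_eq[of s] norm_dirichlet_series_twist_le[OF q s] s by simp
    ultimately show ?thesis by (simp add: mult_ac)
  next
    assume s: "Re s = -1/2"
    have s2: "1 - cnj s = s + 2" using s by (simp add: complex_eq_iff)
    have Re2: "Re (s + 2) = 3/2" using s by simp
    have "cmod (h s) = cmod (g (s + 2)) * cmod (rL_inf d Nq m s)"
      unfolding h_def norm_mult fe[of s] s2 ..
    also have "\<dots> = cmod (dirichlet_series (twist lam chi) (s + 2)) * cmod (L_inf d Nq m (s + 2) * rL_inf d Nq m s)"
      using g_eq[of "s + 2"] Re2 by (simp add: Lambda_series_def norm_mult mult.assoc)
    also have "L_inf d Nq m (s + 2) * rL_inf d Nq m s = of_nat Nq * (\<Prod>j<d. (s + m j) / (2 * of_real pi))"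
    proof (rule L_inf_shift[OF N1])
      fix j assume "j < d"
      then show "Re (s + m j) > -2" using mu(1)[of j] s theta_pos by simp
    qed
    also have "cmod (dirichlet_series (twist lam chi) (s + 2)) * cmod (of_nat Nq * (\<Prod>j<d. (s + m j) / (2 * of_real pi)))
        \<le> Z32 * (real Nq * (1 + \<bar>Im s\<bar> + mu_max) ^ d)"
    proof (intro mult_mono norm_dirichlet_series_twist_le[OF q Re2])
      have "cmod (\<Prod>j<d. (s + m j) / (2 * of_real pi)) = (\<Prod>j<d. cmod (s + m j) / (2 * pi))"
        by (simp add: prod_norm[symmetric] norm_divide norm_mult)
      also have "\<dots> \<le> (\<Prod>j<d. 1 + \<bar>Im s\<bar> + mu_max)"
      proof (intro prod_mono conjI)
        fix j assume "j \<in> {..<d}"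
        then have j: "j < d" by simp
        have "cmod (s + m j) \<le> cmod s + cmod (m j)" by (rule norm_triangle_ineq)
        also have "cmod s \<le> \<bar>Re s\<bar> + \<bar>Im s\<bar>" by (rule cmod_le)
        finally have "cmod (s + m j) \<le> 1 + \<bar>Im s\<bar> + mu_max" using mu(2)[OF j] s by simp
        moreover have "cmod (s + m j) / (2 * pi) \<le> cmod (s + m j) / 1"
          using pi_gt3 by (intro divide_left_mono) auto
        ultimately show "cmod (s + m j) / (2 * pi) \<le> 1 + \<bar>Im s\<bar> + mu_max" by simp
      qed auto
      finally have "cmod (\<Prod>j<d. (s + m j) / (2 * of_real pi)) \<le> (1 + \<bar>Im s\<bar> + mu_max) ^ d" by simp
      then show "cmod (of_nat Nq * (\<Prod>j<d. (s + m j) / (2 * of_real pi))) \<le> real Nq * (1 + \<bar>Im s\<bar> + mu_max) ^ d"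
        by (simp add: norm_mult mult_left_mono)
    qed (use Z32_nonneg in auto)
    finally show ?thesis by (simp add: mult_ac)
  qed
  \<comment> \<open>Order 1 gives some exponent below 3/2 for the completed function, and
    \<open>rL_inf\<close> grows at most like the exponential of a multiple of |Im s|.\<close>
  obtain C where C: "C \<ge> 0" and growth: "\<exists>Y0. \<forall>s. -1/2 \<le> Re s \<longrightarrow> Re s \<le> 3/2 \<longrightarrow> \<bar>Im s\<bar> \<ge> Y0 \<longrightarrow>
      cmod (h s) \<le> C * exp ((3 + 4 * real d) * \<bar>Im s\<bar> powr (3/2))"
  proof -
    have "entire_order g = 1" using entire[OF q] Lam by (simp add: m_def Nq_def)
    then have "entire_order g < ereal (3/2)" by simp
    then obtain a where a: "0 \<le> a" "a < 3/2" "g \<in> O[at_infinity](\<lambda>z. of_real (exp (norm z powr a)))"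
      unfolding entire_order_def Inf_less_iff by auto
    then obtain c1 where c1: "c1 > 0" "eventually (\<lambda>z. cmod (g z) \<le> c1 * cmod (of_real (exp (norm z powr a)) :: complex)) at_infinity"
      by (auto elim: landau_o.bigE)
    then obtain r0 where r0: "\<And>z. cmod z \<ge> r0 \<Longrightarrow> cmod (g z) \<le> c1 * exp (cmod z powr a)"
      by (auto simp: eventually_at_infinity)
    obtain Cr where Cr: "Cr \<ge> 0" "\<And>z. (-1/2 - mu_max) / 2 \<le> Re z \<Longrightarrow> Re z \<le> (3/2 + mu_max) / 2 \<Longrightarrow> \<bar>Im z\<bar> \<ge> 1 \<Longrightarrow>
        cmod (rGamma z) \<le> Cr * exp (pi * \<bar>Im z\<bar>)"
      using norm_rGamma_strip[of "(-1/2 - mu_max) / 2" "(3/2 + mu_max) / 2"] by blast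
    define P where "P = pi powr ((3/2 + mu_max) / 2)"
    \<comment> \<open>From height mu_max + 2 on, the imaginary parts of the gamma arguments lie
      between 1 and t in modulus; height 2 gives |s| \<le> 2 t.\<close>
    define Y0 where "Y0 = max (max r0 2) (mu_max + 2)"
    define C where "C = c1 * (real Nq * (P * Cr) ^ d)"
    have "cmod (h s) \<le> C * exp ((3 + 4 * real d) * \<bar>Im s\<bar> powr (3/2))"
      if s: "-1/2 \<le> Re s" "Re s \<le> 3/2" "\<bar>Im s\<bar> \<ge> Y0" for s
    proof -
      define t where "t = \<bar>Im s\<bar>"
      have t: "t \<ge> r0" "t \<ge> 2" "t \<ge> mu_max + 2" using s(3) by (auto simp: Y0_def t_def)
      have tt: "t \<le> t powr (3/2)" using powr_mono[of 1 "3/2" t] t by simp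
      have cs: "cmod s \<ge> t" "cmod s \<le> 2 * t"
        using abs_Im_le_cmod[of s] cmod_le[of s] s t by (auto simp: t_def)
      have "cmod (g s) \<le> c1 * exp (cmod s powr a)" using cs t by (intro r0) simp
      also have "cmod s powr a \<le> 3 * t powr (3/2)"
      proof -
        have "cmod s powr a \<le> cmod s powr (3/2)" using cs t a by (intro powr_mono) auto
        also have "\<dots> \<le> (2 * t) powr (3/2)" using cs by (intro powr_mono2) auto
        also have "\<dots> = 2 powr (3/2) * t powr (3/2)" using t by (simp add: powr_mult)
        also have "\<dots> \<le> 3 * t powr (3/2)"
        proof (rule mult_right_mono)
          have "(2 powr (3/2)) ^ 2 = (2::real) powr 3"
            using powr_powr[of 2 "3/2::real" 2] powr_realpow[of "2 powr (3/2::real)" 2] by simp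
          also have "\<dots> \<le> 3 ^ 2" by simp
          finally show "2 powr (3/2) \<le> (3::real)" using power_mono_iff[of "2 powr (3/2::real)" 3 2] by simp
        qed auto
        finally show ?thesis .
      qed
      finally have gs: "cmod (g s) \<le> c1 * exp (3 * t powr (3/2))" using c1 by simp
      have "cmod (rL_inf d Nq m s) = real Nq powr (- Re s / 2) * (\<Prod>j<d. pi powr (Re (s + m j) / 2) * cmod (rGamma ((s + m j) / 2)))"
        using N1 by (simp add: rL_inf_def norm_mult prod_norm[symmetric] norm_powr_real_powr real_pi_powr_norm)
      also have "\<dots> \<le> real Nq powr 1 * (\<Prod>j<d. P * (Cr * exp (4 * t)))"
      proof (intro mult_mono prod_mono conjI powr_mono)
        fix j assume "j \<in> {..<d}"
        then have j: "j < d" by simp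
        have mj: "\<bar>Re (m j)\<bar> \<le> mu_max" "\<bar>Im (m j)\<bar> \<le> mu_max"
          using mu(2)[OF j] abs_Re_le_cmod[of "m j"] abs_Im_le_cmod[of "m j"] by auto
        show "pi powr (Re (s + m j) / 2) \<le> P"
          unfolding P_def using mj s pi_gt3 by (intro powr_mono) auto
        have Im: "\<bar>Im ((s + m j) / 2)\<bar> \<ge> 1" "\<bar>Im ((s + m j) / 2)\<bar> \<le> t"
          using mj t by (auto simp: t_def)
        have "cmod (rGamma ((s + m j) / 2)) \<le> Cr * exp (pi * \<bar>Im ((s + m j) / 2)\<bar>)"
          using mj s Im(1) by (intro Cr(2)) auto
        also have "\<dots> \<le> Cr * exp (4 * t)"
        proof -
          have "pi * \<bar>Im ((s + m j) / 2)\<bar> \<le> 4 * t"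
            using Im(2) pi_less_4 t by (intro mult_mono) auto
          then show ?thesis using Cr(1) by (intro mult_left_mono) auto
        qed
        finally show "cmod (rGamma ((s + m j) / 2)) \<le> Cr * exp (4 * t)" .
      qed (use N1 s in \<open>auto simp: P_def intro!: prod_nonneg\<close>)
      also have "\<dots> = real Nq * (P * Cr) ^ d * exp (4 * real d * t)"
        using N1 by (simp add: power_mult_distrib exp_of_nat_mult[symmetric] mult_ac)
      also have "\<dots> \<le> real Nq * (P * Cr) ^ d * exp (4 * real d * t powr (3/2))"
        using tt Cr(1) by (intro mult_left_mono) (auto simp: P_def mult_left_mono)
      finally have rs: "cmod (rL_inf d Nq m s) \<le> real Nq * (P * Cr) ^ d * exp (4 * real d * t powr (3/2))" .
      have "cmod (h s) \<le> (c1 * exp (3 * t powr (3/2))) * (real Nq * (P * Cr) ^ d * exp (4 * real d * t powr (3/2)))"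
        unfolding h_def norm_mult using gs rs c1 by (intro mult_mono) auto
      also have "\<dots> = C * exp ((3 + 4 * real d) * t powr (3/2))"
        by (simp add: C_def exp_add[symmetric] algebra_simps)
      finally show ?thesis by (simp add: t_def)
    qed
    moreover have "C \<ge> 0" using c1 Cr(1) by (simp add: C_def P_def)
    ultimately show ?thesis using that by blast
  qed
  obtain Y0 where Y0: "\<And>s. -1/2 \<le> Re s \<Longrightarrow> Re s \<le> 3/2 \<Longrightarrow> \<bar>Im s\<bar> \<ge> Y0 \<Longrightarrow>
      cmod (h s) \<le> C * exp ((3 + 4 * real d) * \<bar>Im s\<bar> powr (3/2))" using growth by blast
  show "cmod (L_twist lam chi s) \<le> Z32 * real (N q) * exp (4 + (real d)\<^sup>2) * (1 + \<bar>Im s\<bar> + mu_max) ^ d"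
    if s: "-1/2 \<le> Re s" "Re s \<le> 3/2" for s
  proof -
    have "cmod (h s) \<le> (Z32 * real Nq) * exp (4 + (real d)\<^sup>2) * (1 + \<bar>Im s\<bar> + mu_max) ^ d"
      by (rule phragmen_lindelof_strip[OF h_hol _ mu_max_nonneg _ C Y0 bd s]) (use Z32_nonneg in auto)
    then show ?thesis unfolding L Nq_def .
  qed
qed

end

section \<open>Sums over primes\<close>

text \<open>At prime powers (A1) is a polynomial bound in the exponent, which through the generating
  series forces the Ramanujan bound for the Euler parameters.\<close>

lemma (in twisted_L_framework) alpha_norm_le_1:
  assumes A1: "\<And>n. 1 \<le> n \<Longrightarrow> cmod (lam n) \<le> real (divisor_tau d n)"
    and p: "prime p" and j: "j < d"
  shows "cmod (\<alpha> j p) \<le> 1"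
proof (rule parameters_norm_le_1[where x = "\<lambda>j. \<alpha> j p"])
  fix r
  have "complete_hom d (\<lambda>j. \<alpha> j p) r = lam (p ^ r)"
    using prime_powers[OF p, of r] by (simp add: complete_hom_def)
  moreover have "cmod (lam (p ^ r)) \<le> real (divisor_tau d (p ^ r))"
    using p by (intro A1) (simp add: prime_gt_0_nat Suc_leI)
  moreover have "real (divisor_tau d (p ^ r)) \<le> real ((r + 1) ^ d)"
    using divisor_tau_prime_power_le[OF p] of_nat_le_iff by blast
  ultimately show "cmod (complete_hom d (\<lambda>j. \<alpha> j p) r) \<le> real (r + 1) ^ d"
    by (simp only: of_nat_power)
qed (rule j)

lemma (in twisted_L_framework) lam_prime:
  assumes "prime p"
  shows "lam p = (\<Sum>j<d. \<alpha> j p)"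
  using prime_powers[OF assms, of 1] complete_hom_at_1[of d "\<lambda>j. \<alpha> j p"]
  by (simp add: complete_hom_def)

text \<open>Partial summation uses the partial sums from \<open>m\<close> on, so the error bound
  \<open>e\<close> is required for every k \<ge> m. At a prime \<open>lam\<close> is the sum of the
  Euler parameters, hence the coefficient bound d in the first error term.\<close>

lemma (in twisted_L_framework) prime_sum_estimate:
  assumes A1: "\<And>n. 1 \<le> n \<Longrightarrow> cmod (lam n) \<le> real (divisor_tau d n)"
    and q: "2 \<le> q" "primitive_dirichlet_char q chi"
    and r0: "0 < r0" "r0 \<le> 1/8" and T: "T \<ge> 2" and M: "M \<ge> 0"
    and nz: "\<And>s. Re s > 1 - r0 \<Longrightarrow> \<bar>Im s\<bar> \<le> T \<Longrightarrow> L_twist lam chi s \<noteq> 0"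
    and bd: "Z32 * real (N q) * exp (4 + (real d)\<^sup>2) * (1 + T + mu_max) ^ d \<le> exp M"
  defines "CE \<equiv> 3 * real d * (\<Sum>n. real n powr (-3/2))"
  defines "W \<equiv> real d * (1 + 1 / r0) + CE"
  defines "K \<equiv> 6 * (M + W + 1) + W + CE"
  assumes e: "\<And>k. m \<le> k \<Longrightarrow> 6 * real d / (T / 2) + K * (r0 / 2)\<^sup>2 / (T / 2)\<^sup>2 + K * (T / 2) * real k powr (- (r0 / 2)) / (r0 / 2) \<le> e"
    and m: "real m \<ge> T / 2" "m \<le> n"
  shows "cmod (\<Sum>k\<in>{m<..n}. if prime k then lam k * chi (int k) else 0) \<le> 2 * real n * e"
proof -
  interpret dirichlet_character q chi
    using q by unfold_locales (auto simp: primitive_dirichlet_char_def)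
  define a where "a k = (if prime k then lam k * chi (int k) else 0)" for k
  have a_eq: "a k = (if prime k then \<Sum>j<d. \<alpha> j k * chi (int k) else 0)" for k
    by (simp add: a_def lam_prime sum_distrib_right)
  have \<beta>: "cmod (\<alpha> j p * chi (int p)) \<le> 1" if "prime p" "j < d" for j p
    unfolding norm_mult using alpha_norm_le_1[OF A1 that] norm_le_1[of "int p"]
    by (intro mult_le_one) auto
  have a_bd: "cmod (a k) \<le> real d" for k
  proof (cases "prime k")
    case True
    have "cmod (\<Sum>j<d. \<alpha> j k * chi (int k)) \<le> (\<Sum>j<d. 1)"
      by (intro order.trans[OF norm_sum] sum_mono \<beta> True) auto
    then show ?thesis using True by (simp add: a_eq)
  qed (simp add: a_def)
  obtain E where E: "E holomorphic_on {s. Re s > 3/4}"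
    "\<And>s. Re s > 3/4 \<Longrightarrow> cmod (E s) \<le> CE"
    "\<And>s. Re s > 1 \<Longrightarrow> dirichlet_series (twist lam chi) s = exp ((\<Sum>n. a n * of_nat n powr (- s)) + E s)"
    unfolding CE_def by (rule has_euler_product_log[OF euler_product_twist[OF q] \<beta> a_eq]) auto
  note L = L_twist_properties[OF q]
  have "\<exists>F0. \<forall>N. real N \<ge> T / 2 \<longrightarrow> cmod (F0 - (\<Sum>n\<le>N. a n / of_nat n))
    \<le> 6 * real d / (T / 2) + K * (r0 / 2)\<^sup>2 / (T / 2)\<^sup>2 + K * (T / 2) * real N powr (- (r0 / 2)) / (r0 / 2)"
    unfolding K_def W_def
  proof (rule zero_free_imp_weighted_sum[OF a_bd L(1) E(1) E(2) _ r0 T M nz])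
    show "L_twist lam chi s = exp ((\<Sum>n. a n * of_nat n powr (- s)) + E s)" if "Re s > 1" for s
      using L(2)[OF that] E(3)[OF that] by simp
    show "cmod (L_twist lam chi s) \<le> exp M" if s: "1/2 \<le> Re s" "Re s \<le> 3/2" "\<bar>Im s\<bar> \<le> T" for s
    proof -
      have "cmod (L_twist lam chi s) \<le> Z32 * real (N q) * exp (4 + (real d)\<^sup>2) * (1 + \<bar>Im s\<bar> + mu_max) ^ d"
        using s by (intro L(3)) auto
      also have "\<dots> \<le> Z32 * real (N q) * exp (4 + (real d)\<^sup>2) * (1 + T + mu_max) ^ d"
        using s Z32_nonneg mu_max_nonneg by (intro mult_left_mono power_mono) auto
      finally show ?thesis using bd by linarith
    qed
  qed
  then obtain F0 where F0: "\<And>N. real N \<ge> T / 2 \<Longrightarrow> cmod (F0 - (\<Sum>n\<le>N. a n / of_nat n))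
    \<le> 6 * real d / (T / 2) + K * (r0 / 2)\<^sup>2 / (T / 2)\<^sup>2 + K * (T / 2) * real N powr (- (r0 / 2)) / (r0 / 2)" by blast
  have "cmod (\<Sum>k\<in>{m<..n}. a k) \<le> 2 * real n * e"
  proof (rule sum_from_weighted_sums[OF _ m(2)])
    fix k assume k: "m \<le> k" "k \<le> n"
    then have "real k \<ge> T / 2" using m(1) by (meson of_nat_le_iff order.trans)
    from order.trans[OF F0[OF this] e[OF k(1)]]
    show "cmod (F0 - (\<Sum>n\<le>k. a n / of_nat n)) \<le> e" .
  qed
  then show ?thesis by (simp add: a_def)
qed

text \<open>All losses are powers of log q: \<open>K\<close> and 1/r0 are O(log q), and T is its
  100th power. The cut-off for m makes the remaining factor decay faster than any such power. Above
  the cut-off m and n are arbitrary, so one threshold for q serves all cells at once.\<close>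

lemma (in twisted_L_framework) prime_sum_bound:
  assumes A1: "\<And>n. 1 \<le> n \<Longrightarrow> cmod (lam n) \<le> real (divisor_tau d n)"
    and beta: "0 \<le> \<beta>" "\<beta> < \<gamma>" "\<gamma> < 1"
    and family: "\<And>q. 2 \<le> q \<Longrightarrow> Fam q \<subseteq> {chi. primitive_dirichlet_char q chi}"
    and A4: "zero_free_hypothesis lam \<beta> Fam S"
  shows "\<forall>\<^sub>F q in sequentially. q \<in> S \<longrightarrow> finite (Fam q) \<longrightarrow> (\<forall>chi\<in>Fam q. \<forall>m n.
    exp (ln (real q) powr \<gamma>) \<le> real m \<and> m \<le> n \<longrightarrow>
    cmod (\<Sum>k\<in>{m<..n}. if prime k then lam k * chi (int k) else 0) \<le> real n * ln (real q) powr (-10))"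
proof -
  \<comment> \<open>A fixed power of log q is admissible; with this one the error 12 d / T has 90
    powers of log q to spare over the target exponent -10.\<close>
  define T where "T q = ln (real q) ^ 100" for q :: nat
  have "admissible_height T"
    unfolding admissible_height_def
  proof (intro conjI)
    show "\<forall>\<^sub>F q in sequentially. 0 < T q" unfolding T_def by real_asymp
    show "(\<lambda>q. ln (real q) ^ 100) \<in> O(T)" unfolding T_def[abs_def] by simp
    show "(\<lambda>q. ln (T q)) \<in> o(\<lambda>q. ln (real q))" unfolding T_def by real_asymp
  qed
  then obtain c where c: "c > 0" and zf: "\<forall>\<^sub>F q in sequentially. q \<in> S \<longrightarrow>
      (\<forall>\<sigma> t. \<sigma> > 1 - c / ln (real q * T q) powr \<beta> \<and> \<bar>t\<bar> \<le> T q \<longrightarrow>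
              (\<Prod>chi\<in>Fam q. L_twist lam chi (Complex \<sigma> t)) \<noteq> 0)"
    using A4 unfolding zero_free_hypothesis_def by blast
  obtain A B where AB: "\<forall>\<^sub>F q in sequentially. \<forall>chi. primitive_dirichlet_char q chi \<longrightarrow>
         analytic_conductor d (N q) (\<mu> (chi (-1))) (1 / 2) \<le> A * real (N q) \<and>
         real (N q) \<le> B * real q ^ d"
    using conductor_bound by blast
  \<comment> \<open>The minimum with 1/8 ensures r0 \<le> 1/8, as the contour lemma asks.\<close>
  define c0 where "c0 = min c (1/8)"
  have c0: "0 < c0" "c0 \<le> c" "c0 \<le> 1/8" using c by (auto simp: c0_def)
  define CE where "CE = 3 * real d * (\<Sum>n. real n powr (-3/2))"
  have CE0: "CE \<ge> 0"
    unfolding CE_def by (intro mult_nonneg_nonneg suminf_nonneg) (auto simp: summable_real_powr_iff)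
  define CK where "CK = 6 * (2 * real d + 1) + 7 * (real d * (1 + 2 / c0) + CE) + 6 + CE"
  have CK0: "CK \<ge> 0" using c0 CE0 by (simp add: CK_def)
  define B1 where "B1 = Z32 * \<bar>B\<bar> * exp (4 + (real d)\<^sup>2)"
  define \<delta> where "\<delta> = \<gamma> - \<beta>"
  have \<delta>: "\<delta> > 0" using beta by (simp add: \<delta>_def)
  have lnq: "filterlim (\<lambda>q::nat. ln (real q)) at_top sequentially" by real_asymp
  have ev_err: "\<forall>\<^sub>F q in sequentially. 12 * real d / ln (real q) ^ 100 + CK * ln (real q) * 4 / (ln (real q) ^ 100)\<^sup>2
      + CK * ln (real q) * ln (real q) ^ 100 * exp (- (c0 / 4) * ln (real q) powr \<delta>) * (4 / c0 * ln (real q))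
      \<le> 1/2 * ln (real q) powr (-10)"
  proof -
    have "\<forall>\<^sub>F x::real in at_top. 12 * real d / x ^ 100 + CK * x * 4 / (x ^ 100)\<^sup>2
      + CK * x * x ^ 100 * exp (- (c0 / 4) * x powr \<delta>) * (4 / c0 * x) \<le> 1/2 * x powr (-10)"
    proof -
      have "((\<lambda>x::real. x powr 10 * (12 * real d / x ^ 100 + CK * x * 4 / (x ^ 100)\<^sup>2)) \<longlongrightarrow> 0) at_top"
        by real_asymp
      moreover have "((\<lambda>x::real. x powr 10 * (x * x ^ 100 * x * exp (- (c0 / 4) * x powr \<delta>))) \<longlongrightarrow> 0) at_top"
        using \<delta> c0(1) by real_asymp
      then have "((\<lambda>x::real. (CK * (4 / c0)) * (x powr 10 * (x * x ^ 100 * x * exp (- (c0 / 4) * x powr \<delta>)))) \<longlongrightarrow> (CK * (4 / c0)) * 0) at_top"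
        by (intro tendsto_mult tendsto_const)
      ultimately have "((\<lambda>x::real. x powr 10 * (12 * real d / x ^ 100 + CK * x * 4 / (x ^ 100)\<^sup>2) +
        (CK * (4 / c0)) * (x powr 10 * (x * x ^ 100 * x * exp (- (c0 / 4) * x powr \<delta>)))) \<longlongrightarrow> 0 + (CK * (4 / c0)) * 0) at_top"
        by (rule tendsto_add)
      then have "\<forall>\<^sub>F x::real in at_top. x powr 10 * (12 * real d / x ^ 100 + CK * x * 4 / (x ^ 100)\<^sup>2) +
        (CK * (4 / c0)) * (x powr 10 * (x * x ^ 100 * x * exp (- (c0 / 4) * x powr \<delta>))) < 1/2"
        by (rule order_tendstoD(2)) simp
      then show ?thesis using eventually_gt_at_top[of 0]
      proof eventually_elim
        case (elim x)
        define Z where "Z = 12 * real d / x ^ 100 + CK * x * 4 / (x ^ 100)\<^sup>2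
          + CK * x * x ^ 100 * exp (- (c0 / 4) * x powr \<delta>) * (4 / c0 * x)"
        have "x powr 10 * Z \<le> 1/2" using elim(1) by (simp add: Z_def algebra_simps)
        then have "x powr (-10) * (x powr 10 * Z) \<le> x powr (-10) * (1/2)"
          by (intro mult_left_mono) auto
        also have "x powr (-10) * (x powr 10 * Z) = Z"
          using elim(2) by (simp only: powr_add[symmetric] mult.assoc[symmetric]) simp
        finally show ?case by (simp add: Z_def)
      qed
    qed
    then show ?thesis using lnq by (rule eventually_compose_filterlim)
  qed
  have ev_m: "\<forall>\<^sub>F q in sequentially. ln (real q) ^ 100 / 2 \<le> exp (ln (real q) powr \<gamma>)"
  proof -
    have "\<forall>\<^sub>F x::real in at_top. x ^ 100 / 2 \<le> exp (x powr \<gamma>)" using beta by real_asymp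
    then show ?thesis using lnq by (rule eventually_compose_filterlim)
  qed
  have ev1: "\<forall>\<^sub>F q in sequentially. ln (real q) \<ge> 2" using lnq by (simp add: filterlim_at_top)
  have ev2: "\<forall>\<^sub>F q::nat in sequentially. ln (real q) + 100 * ln (ln (real q)) \<le> 2 * ln (real q)" by real_asymp
  have ev3: "\<forall>\<^sub>F q::nat in sequentially. 1 + ln (real q) ^ 100 + mu_max \<le> real q"
  proof -
    have "\<forall>\<^sub>F q::nat in sequentially. 1 + ln (real q) ^ 100 \<le> real q / 2" by real_asymp
    moreover have "\<forall>\<^sub>F q::nat in sequentially. 2 * mu_max \<le> real q"
      using filterlim_real_sequentially by (simp add: filterlim_at_top)
    ultimately show ?thesis by eventually_elim linarith
  qed
  have ev4: "\<forall>\<^sub>F q::nat in sequentially. B1 \<le> real q"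
    using filterlim_real_sequentially by (simp add: filterlim_at_top)
  show ?thesis
    using zf AB ev_err ev_m ev1 ev2 ev3 ev4
  proof eventually_elim
    case (elim q)
    show ?case
    proof (intro impI ballI allI)
      fix chi m n
      assume qS: "q \<in> S" and fin: "finite (Fam q)" and chi: "chi \<in> Fam q"
        and mn: "exp (ln (real q) powr \<gamma>) \<le> real m \<and> m \<le> n"
      define l where "l = ln (real q)"
      have l2: "l \<ge> 2" using elim(5) by (simp add: l_def)
      have q3: "real q \<ge> 3"
      proof (rule ccontr)
        assume "\<not> real q \<ge> 3"
        then have "q \<le> 2" by linarith
        then have "l \<le> ln 2" using l2 by (cases "q = 0") (auto simp: l_def)
        then show False using l2 ln_2_less_1 by linarith
      qed
      have q2: "2 \<le> q" using q3 by linarith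
      have prim: "primitive_dirichlet_char q chi" using family[OF q2] chi by blast
      have T: "T q = l ^ 100" by (simp add: T_def l_def)
      have Tpos: "T q > 0" and T2: "T q \<ge> 2"
      proof -
        have "l ^ 1 \<le> l ^ 100" using l2 by (intro power_increasing) auto
        then show "T q \<ge> 2" "T q > 0" using l2 T by auto
      qed
      have lnqT: "ln (real q * T q) = l + 100 * ln l"
        using q3 l2 by (simp add: T ln_mult ln_realpow l_def)
      have lnl: "ln l \<ge> 0" using l2 by simp
      have qT: "1 \<le> ln (real q * T q)" "ln (real q * T q) \<le> 2 * l"
        using elim(6) l2 lnl unfolding lnqT l_def[symmetric] by linarith+
      define r0 where "r0 = c0 / ln (real q * T q) powr \<beta>"
      have pw1: "ln (real q * T q) powr \<beta> \<ge> 1" using qT beta by (simp add: ge_one_powr_ge_zero)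
      have r0: "0 < r0" "r0 \<le> 1/8"
      proof -
        have "0 < ln (real q * T q) powr \<beta>" using pw1 by linarith
        then show "0 < r0" using c0(1) unfolding r0_def by (rule divide_pos_pos[rotated])
        have "r0 \<le> c0 / 1" unfolding r0_def using c0(1) pw1 by (intro divide_left_mono mult_pos_pos) linarith+
        then show "r0 \<le> 1/8" using c0 by simp
      qed
      have pw2: "ln (real q * T q) powr \<beta> \<le> 2 * l powr \<beta>"
      proof -
        have "ln (real q * T q) powr \<beta> \<le> (2 * l) powr \<beta>" using qT beta by (intro powr_mono2) auto
        also have "\<dots> = 2 powr \<beta> * l powr \<beta>" using l2 by (simp add: powr_mult)
        also have "\<dots> \<le> 2 powr 1 * l powr \<beta>" using beta by (intro mult_right_mono powr_mono) auto
        finally show ?thesis by simp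
      qed
      have r0_inv: "1 / r0 \<le> 2 / c0 * l"
      proof -
        have "1 / r0 = ln (real q * T q) powr \<beta> / c0" by (simp add: r0_def)
        also have "\<dots> \<le> 2 * l powr \<beta> / c0" using pw2 c0 by (intro divide_right_mono) auto
        also have "\<dots> \<le> 2 * l powr 1 / c0"
          using beta l2 c0 by (intro divide_right_mono mult_left_mono powr_mono) auto
        finally show ?thesis using l2 by simp
      qed
      have r0_l: "r0 * l powr \<gamma> \<ge> c0 / 2 * l powr \<delta>"
      proof -
        have "c0 / (2 * l powr \<beta>) \<le> r0" unfolding r0_def using pw2 pw1 c0(1) by (intro divide_left_mono mult_pos_pos) linarith+
        then have "c0 / (2 * l powr \<beta>) * l powr \<gamma> \<le> r0 * l powr \<gamma>" by (intro mult_right_mono) auto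
        moreover have "c0 / (2 * l powr \<beta>) * l powr \<gamma> = c0 / 2 * l powr \<delta>"
          unfolding \<delta>_def using l2 by (simp add: powr_diff)
        ultimately show ?thesis by (simp only:)
      qed
      \<comment> \<open>The conductor and the polynomial factor contribute q^d each, and one further
        power of q absorbs the constant \<open>B1\<close>.\<close>
      define M where "M = (2 * real d + 1) * l"
      define W where "W = real d * (1 + 1 / r0) + CE"
      define K where "K = 6 * (M + W + 1) + W + CE"
      have K_le: "K \<le> CK * l"
      proof -
        have "W \<le> real d * (1 + 2 / c0 * l) + CE"
          unfolding W_def using r0_inv by (intro add_right_mono mult_left_mono add_left_mono) auto
        also have "\<dots> \<le> real d * (l + 2 / c0 * l) + CE * l"
          using l2 CE0 by (intro add_mono mult_left_mono add_right_mono) (auto simp: mult_le_cancel_left1)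
        also have "\<dots> = (real d * (1 + 2 / c0) + CE) * l" by (simp add: algebra_simps)
        finally have W: "W \<le> (real d * (1 + 2 / c0) + CE) * l" .
        define Y where "Y = (real d * (1 + 2 / c0) + CE) * l"
        define Z where "Z = CE * l"
        have "CE * 1 \<le> Z" unfolding Z_def using l2 CE0 by (intro mult_left_mono) auto
        then have "K \<le> 6 * M + 7 * Y + 6 * l + Z"
          unfolding K_def using W[folded Y_def] l2 by argo
        also have "\<dots> = CK * l" by (simp add: CK_def M_def Y_def Z_def algebra_simps)
        finally show ?thesis .
      qed
      have K0: "K \<ge> 0" unfolding K_def W_def M_def using r0 CE0 l2 by simp
      have bd: "Z32 * real (N q) * exp (4 + (real d)\<^sup>2) * (1 + T q + mu_max) ^ d \<le> exp M"
      proof -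
        have "real (N q) \<le> B * real q ^ d" using elim(2) prim by blast
        also have "\<dots> \<le> \<bar>B\<bar> * real q ^ d" by (intro mult_right_mono) auto
        finally have Nq: "real (N q) \<le> \<bar>B\<bar> * real q ^ d" .
        have "Z32 * real (N q) * exp (4 + (real d)\<^sup>2) * (1 + T q + mu_max) ^ d
            \<le> Z32 * (\<bar>B\<bar> * real q ^ d) * exp (4 + (real d)\<^sup>2) * real q ^ d"
          using Nq Z32_nonneg Tpos mu_max_nonneg elim(7) by (intro mult_mono power_mono mult_nonneg_nonneg) (auto simp: T_def)
        also have "\<dots> = B1 * (real q ^ d * real q ^ d)" by (simp add: B1_def)
        also have "\<dots> \<le> real q * (real q ^ d * real q ^ d)" using elim(8) by (intro mult_right_mono) auto
        also have "\<dots> = real q ^ (2 * d + 1)" by (simp add: power_add mult_2)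
        also have "\<dots> = exp M"
        proof -
          have "exp l = real q" using q3 by (simp add: l_def)
          moreover have "M = real (2 * d + 1) * l" by (simp add: M_def)
          ultimately show ?thesis by (simp only: exp_of_nat_mult)
        qed
        finally show ?thesis .
      qed
      have "cmod (\<Sum>k\<in>{m<..n}. if prime k then lam k * chi (int k) else 0) \<le> 2 * real n * (1/2 * l powr (-10))"
      proof (rule prime_sum_estimate[OF A1 q2 prim r0 T2 _ _ bd, folded CE_def, folded W_def, folded K_def])
        show "M \<ge> 0" using l2 by (simp add: M_def)
        show "L_twist lam chi s \<noteq> 0" if s: "Re s > 1 - r0" "\<bar>Im s\<bar> \<le> T q" for s
        proof -
          have "r0 \<le> c / ln (real q * T q) powr \<beta>"
            unfolding r0_def using c0 by (intro divide_right_mono) auto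
          then have "1 - c / ln (real q * T q) powr \<beta> < Re s" using s(1) by linarith
          then have "(\<Prod>chi\<in>Fam q. L_twist lam chi (Complex (Re s) (Im s))) \<noteq> 0"
            using elim(1)[rule_format, OF qS, of "Re s" "Im s"] s(2) by blast
          \<comment> \<open>A nonzero product over a finite set has nonzero factors; over an
            infinite set the product would be 1 by convention, hence the finiteness
            condition.\<close>
          then show ?thesis using chi fin by simp
        qed
        show "real m \<ge> T q / 2" using mn elim(4) by (simp add: T_def)
        show "m \<le> n" using mn by simp
        fix k assume k: "m \<le> k"
        have kl: "exp (l powr \<gamma>) \<le> real k" using mn k unfolding l_def by (meson of_nat_le_iff order.trans)
        have "real k powr (- (r0 / 2)) \<le> exp (l powr \<gamma>) powr (- (r0 / 2))"
          using kl r0 by (intro powr_mono2') auto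
        also have "\<dots> = exp (- (1/2) * (r0 * l powr \<gamma>))" by (simp add: powr_def mult_ac)
        also have "\<dots> \<le> exp (- (1/2) * (c0 / 2 * l powr \<delta>))" using r0_l by simp
        finally have kp: "real k powr (- (r0 / 2)) \<le> exp (- (c0 / 4) * l powr \<delta>)" by simp
        have t1: "6 * real d / (T q / 2) = 12 * real d / l ^ 100" by (simp add: T)
        have t2: "K * (r0 / 2)\<^sup>2 / (T q / 2)\<^sup>2 \<le> CK * l * 4 / (l ^ 100)\<^sup>2"
        proof -
          have "(r0 / 2)\<^sup>2 \<le> 1" using r0 by (intro power_le_one) auto
          then have "K * (r0 / 2)\<^sup>2 \<le> (CK * l) * 1" using K_le K0 by (intro mult_mono) auto
          then have "K * (r0 / 2)\<^sup>2 / (T q / 2)\<^sup>2 \<le> (CK * l) * 1 / (T q / 2)\<^sup>2" by (intro divide_right_mono) auto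
          then show ?thesis by (simp add: T power_divide)
        qed
        have t3: "K * (T q / 2) * real k powr (- (r0 / 2)) / (r0 / 2)
            \<le> CK * l * l ^ 100 * exp (- (c0 / 4) * l powr \<delta>) * (4 / c0 * l)"
        proof -
          have "K * (T q / 2) * real k powr (- (r0 / 2)) / (r0 / 2)
              = K * (T q / 2) * real k powr (- (r0 / 2)) * (2 * (1 / r0))" by simp
          also have "\<dots> \<le> (CK * l) * l ^ 100 * exp (- (c0 / 4) * l powr \<delta>) * (2 * (2 / c0 * l))"
            using K_le K0 kp r0_inv Tpos r0 CK0 l2 c0
            by (intro mult_mono mult_nonneg_nonneg) (auto simp: T)
          finally show ?thesis by simp
        qed
        show "6 * real d / (T q / 2) + K * (r0 / 2)\<^sup>2 / (T q / 2)\<^sup>2 + K * (T q / 2) * real k powr (- (r0 / 2)) / (r0 / 2)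
            \<le> 1/2 * l powr (-10)"
          using t1 t2 t3 elim(3) unfolding l_def[symmetric] by linarith
      qed
      then show "cmod (\<Sum>k\<in>{m<..n}. if prime k then lam k * chi (int k) else 0) \<le> real n * ln (real q) powr (-10)"
        by (simp add: l_def)
    qed
  qed
qed

section \<open>The mean square estimate\<close>

lemma geometric_grid_iff:
  fixes \<kappa> y :: real
  assumes \<kappa>: "\<kappa> > 1" and y: "y \<ge> 1"
  shows "nat \<lfloor>ln y / ln \<kappa>\<rfloor> = j \<longleftrightarrow> \<kappa> ^ j \<le> y \<and> y < \<kappa> ^ (j + 1)"
proof -
  have lk: "ln \<kappa> > 0" using \<kappa> by simp
  have pw: "\<kappa> ^ i = exp (real i * ln \<kappa>)" for i using \<kappa> by (simp add: exp_of_nat_mult)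
  have y_exp: "y = exp (ln y)" using y by simp
  have 1: "\<kappa> ^ i \<le> y \<longleftrightarrow> real i \<le> ln y / ln \<kappa>" for i
    by (subst y_exp, subst pw) (simp add: lk pos_le_divide_eq)
  have 2: "y < \<kappa> ^ i \<longleftrightarrow> ln y / ln \<kappa> < real i" for i
    using 1[of i] by (simp add: not_le[symmetric])
  have "ln y / ln \<kappa> \<ge> 0" using y lk by simp
  then have "nat \<lfloor>ln y / ln \<kappa>\<rfloor> = j \<longleftrightarrow> \<lfloor>ln y / ln \<kappa>\<rfloor> = int j" by auto
  also have "\<dots> \<longleftrightarrow> real j \<le> ln y / ln \<kappa> \<and> ln y / ln \<kappa> < real j + 1"
    by (simp add: floor_eq_iff)
  also have "\<dots> \<longleftrightarrow> \<kappa> ^ j \<le> y \<and> y < \<kappa> ^ (j + 1)"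
    unfolding 1 2 by (simp add: add.commute)
  finally show ?thesis .
qed

text \<open>With h = l this bounds the number of cells of ratio 1 + 1/l below the upper end of the
  window by O(l^2).\<close>

lemma ln_one_plus_inverse_ge:
  fixes h :: real
  assumes "h \<ge> 2"
  shows "1 / (2 * h) \<le> ln (1 + 1 / h)"
proof -
  have "1 / h - (1 / h)\<^sup>2 \<le> ln (1 + 1 / h)"
    using assms by (intro ln_one_plus_pos_lower_bound) auto
  moreover have "(1 / h)\<^sup>2 \<le> 1 / (2 * h)"
    using assms by (simp add: power2_eq_square divide_simps)
  moreover have "1 / (2 * h) + 1 / (2 * h) = 1 / h" by simp
  ultimately show ?thesis by argo
qed

context twisted_L_framework
begin

text \<open>No prime lies in \<open>[P1, P2]\<close> for \<open>P1 = P2 = 5/2\<close>, so the coprimality condition is void.\<close>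

lemma mean_square_bound:
  assumes A3: "\<And>X P1 P2 :: real. 2 \<le> P1 \<Longrightarrow> P1 \<le> P2 \<Longrightarrow> P2 \<le> X \<Longrightarrow>
               (\<Sum>n | 1 \<le> n \<and> real n \<le> X \<and>
                      coprime n (\<Prod>p | prime p \<and> P1 \<le> real p \<and> real p \<le> P2. p).
                  (cmod (lam n))\<^sup>2) \<le> C3 * (X * (ln P1 / ln P2))"
  shows "(\<Sum>n=1..k. (cmod (lam n))\<^sup>2) \<le> (\<bar>C3\<bar> + (\<Sum>n=1..2. (cmod (lam n))\<^sup>2)) * real k"
\<comment> \<open>(A3) with P2 = 5/2 speaks of k \<ge> 5/2; the smaller k are covered by the extra
  constant.\<close>
proof (cases "k \<ge> 3")
  case True
  have emp: "{p::nat. prime p \<and> 5/2 \<le> real p \<and> real p \<le> 5/2} = {}"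
  proof -
    have "real p \<noteq> 5/2" for p :: nat
    proof
      assume "real p = 5/2"
      then have "real (2 * p) = real 5" by simp
      then have "2 * p = 5" by (simp only: of_nat_eq_iff)
      then show False by presburger
    qed
    then show ?thesis by (auto dest: order.antisym)
  qed
  have "(\<Sum>n | 1 \<le> n \<and> real n \<le> real k. (cmod (lam n))\<^sup>2) \<le> C3 * (real k * (ln (5/2) / ln (5/2)))"
    using A3[of "5/2" "5/2" "real k", unfolded emp] True by simp
  also have "{n. 1 \<le> n \<and> real n \<le> real k} = {1..k}" by auto
  also have "ln (5/2::real) / ln (5/2) = 1" by simp
  also have "C3 * (real k * 1) \<le> (\<bar>C3\<bar> + (\<Sum>n=1..2. (cmod (lam n))\<^sup>2)) * real k"
    by (simp add: mult_right_mono sum_nonneg add_increasing2)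
  finally show ?thesis .
next
  case False
  show ?thesis
  proof (cases "k = 0")
    case False
    have "(\<Sum>n=1..k. (cmod (lam n))\<^sup>2) \<le> (\<Sum>n=1..2. (cmod (lam n))\<^sup>2)"
      using \<open>\<not> k \<ge> 3\<close> by (intro sum_mono2) auto
    also have "\<dots> \<le> (\<bar>C3\<bar> + (\<Sum>n=1..2. (cmod (lam n))\<^sup>2)) * 1" by simp
    also have "\<dots> \<le> (\<bar>C3\<bar> + (\<Sum>n=1..2. (cmod (lam n))\<^sup>2)) * real k"
      using False by (intro mult_left_mono add_nonneg_nonneg sum_nonneg) auto
    finally show ?thesis .
  qed simp
qed

lemma lam_prime_power_le:
  assumes A1: "\<And>n. 1 \<le> n \<Longrightarrow> cmod (lam n) \<le> real (divisor_tau d n)" and p: "prime p"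
  shows "cmod (lam (p ^ k)) \<le> real (k + 1) ^ d"
proof -
  have "cmod (lam (p ^ k)) \<le> real (divisor_tau d (p ^ k))"
    using p by (intro A1) (simp add: prime_gt_0_nat Suc_leI)
  also have "\<dots> \<le> real ((k + 1) ^ d)"
    using divisor_tau_prime_power_le[OF p] of_nat_le_iff by blast
  finally show ?thesis by (simp only: of_nat_power)
qed

text \<open>One Q beyond every threshold, with explicit constants. Two exponents occur because prime
  sums are bounded in terms of log q with q up to 2Q and the lower end of the window is rounded to
  an integer; \<open>e3\<close> absorbs both effects. The upper end, half of Q^\<epsilon>, gives D *
  P2 \<le> X / 2, so that cofactors reach length D even after X is rounded down.\<close>

lemma large_sieve_mean_square_estimate:
  fixes Q X \<epsilon> \<gamma> \<gamma>' C2 C3 :: real and D :: nat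
  defines "l \<equiv> ln Q"
  defines "Cm \<equiv> \<bar>C3\<bar> + (\<Sum>n=1..2. (cmod (lam n))\<^sup>2)"
  defines "C1 \<equiv> (\<Sum>k. real (k + 3) ^ (2 * d) / 2 ^ k)"
  assumes A1: "\<And>n. 1 \<le> n \<Longrightarrow> cmod (lam n) \<le> real (divisor_tau d n)"
    and A2: "\<And>x. x \<ge> Q \<Longrightarrow> (\<Sum>n | x \<le> real n \<and> real n \<le> x + x / l. (cmod (lam n))\<^sup>2) \<le> C2 * (x / l)"
    and A3: "\<And>X P1 P2 :: real. 2 \<le> P1 \<Longrightarrow> P1 \<le> P2 \<Longrightarrow> P2 \<le> X \<Longrightarrow>
               (\<Sum>n | 1 \<le> n \<and> real n \<le> X \<and>
                      coprime n (\<Prod>p | prime p \<and> P1 \<le> real p \<and> real p \<le> P2. p).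
                  (cmod (lam n))\<^sup>2) \<le> C3 * (X * (ln P1 / ln P2))"
    and PS: "\<And>q chi m n. q \<in> \<Q> \<Longrightarrow> chi \<in> Fam q \<Longrightarrow> exp (ln (real q) powr \<gamma>') \<le> real m \<Longrightarrow> m \<le> n \<Longrightarrow>
        cmod (\<Sum>k\<in>{m<..n}. if prime k then lam k * chi (int k) else 0) \<le> real n * ln (real q) powr (-10)"
    and \<Q>: "finite \<Q>" "\<Q> \<noteq> {}" "\<And>q. q \<in> \<Q> \<Longrightarrow> Q \<le> real q \<and> real q \<le> 2 * Q"
      "\<And>q. q \<in> \<Q> \<Longrightarrow> finite (Fam q)" "\<And>q chi. q \<in> \<Q> \<Longrightarrow> chi \<in> Fam q \<Longrightarrow> primitive_dirichlet_char q chi"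
      "\<And>q q'. q \<in> \<Q> \<Longrightarrow> q' \<in> \<Q> \<Longrightarrow> lcm q q' \<le> D"
    and \<epsilon>: "\<epsilon> > 0" and \<gamma>: "0 < \<gamma>'" "\<gamma>' < \<gamma>" "\<gamma> < 1"
    and X: "real D * Q powr \<epsilon> \<le> X"
    and Qpos: "Q > 0" and l: "l \<ge> 2"
    and e3: "exp (ln (2 * Q) powr \<gamma>') \<le> exp (l powr \<gamma>) - 1"
    and e4: "exp (l powr \<gamma>) \<le> Q powr \<epsilon> / 2"
    and e7: "l \<le> exp (l powr \<gamma>)"
    and e8: "\<epsilon> * l / 2 \<le> \<epsilon> * l - ln 2"
  shows "(\<Sum>q\<in>\<Q>. \<Sum>chi\<in>Fam q. (cmod (\<Sum>n | 1 \<le> n \<and> real n \<le> X. lam n * chi (int n)))\<^sup>2)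
    \<le> (2 * (20 * (2 * (\<bar>C3\<bar> * (2 / \<epsilon>)) + 2 * \<bar>C2\<bar> + 2 * ((1 + ((2::real) ^ d)\<^sup>2) * C1 * Cm * 4)))
       + 2 * (4 * (2 * \<epsilon> + 1)\<^sup>2 * 10 * Cm)) * (X\<^sup>2 * l powr (\<gamma> - 1))"
    and "X \<ge> 2 * Q"
proof -
  have Q: "Q > exp 1"
  proof -
    note Qpos
    moreover have "exp 1 < exp (ln Q)" using l by (simp add: l_def)
    ultimately show ?thesis by simp
  qed
  have Q2: "Q > 2" using Q exp_ge_add_one_self[of 1] by linarith
  define P1 where "P1 = exp (l powr \<gamma>)"
  define P2 where "P2 = Q powr \<epsilon> / 2"
  define \<kappa> where "\<kappa> = 1 + 1 / l"
  have \<kappa>: "1 < \<kappa>" "\<kappa> \<le> 2" using l by (auto simp: \<kappa>_def)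
  have P1: "P1 \<ge> 2" using e7 l by (simp add: P1_def)
  have P12: "P1 \<le> P2" using e4 by (simp add: P1_def P2_def)
  obtain q0 where q0: "q0 \<in> \<Q>" using \<Q>(2) by blast
  have DQ: "real D \<ge> Q"
  proof -
    have "lcm q0 q0 \<le> D" by (rule \<Q>(6)[OF q0 q0])
    then have "q0 \<le> D" by simp
    then show ?thesis using \<Q>(3)[OF q0] by linarith
  qed
  have DX: "real D * P2 \<le> X / 2" using X by (simp add: P2_def)
  have XQ: "X \<ge> 2 * Q"
  proof -
    have "Q * 2 \<le> real D * (2 * P2)" using DQ P1 P12 Q2 by (intro mult_mono) auto
    then show ?thesis using DX by linarith
  qed
  then show "X \<ge> 2 * Q" .
  define x where "x = nat \<lfloor>X\<rfloor>"
  have x_iff: "n \<le> x \<longleftrightarrow> real n \<le> X" for n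
    unfolding x_def using XQ Q2 by (simp add: le_nat_iff le_floor_iff)
  have xX: "real x \<le> X" using x_iff[of x] by simp
  have xX1: "X - 1 \<le> real x" unfolding x_def using XQ Q2 by linarith
  have x2: "X / 2 \<le> real x" using xX1 XQ Q2 by linarith
  have xQ: "real x \<ge> Q" using xX1 XQ Q2 by linarith
  have P2x: "P2 \<le> real x"
  proof -
    have "1 * P2 \<le> real D * P2" using DQ Q2 P1 P12 by (intro mult_right_mono) auto
    then show ?thesis using DX x2 by linarith
  qed
  define I where "I = {p. prime p \<and> P1 \<le> real p \<and> real p \<le> P2}"
  define jj where "jj p = nat \<lfloor>ln (real p) / ln \<kappa>\<rfloor>" for p :: nat
  define J where "J = {..nat \<lfloor>ln P2 / ln \<kappa>\<rfloor>}"
  define K where "K = Sigma \<Q> Fam"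
  define g :: "nat \<times> (int \<Rightarrow> complex) \<Rightarrow> nat \<Rightarrow> complex" where "g k n = snd k (int n)" for k n
  \<comment> \<open>The factor 2 covers the upper end \<kappa>^(j + 1) \<le> 2 \<kappa>^j of a
    cell.\<close>
  define s where "s = 2 * l powr (-10)"
  define M where "M = nat \<lceil>P1\<rceil>"
  have finI: "finite I"
    by (rule finite_subset[of _ "{..nat \<lfloor>P2\<rfloor>}"]) (auto simp: I_def le_nat_floor)
  have I1: "real p \<ge> 1" "real p \<ge> P1" "real p \<le> P2" "prime p" if "p \<in> I" for p
    using that P1 by (auto simp: I_def)
  have jj_iff: "jj p = j \<longleftrightarrow> \<kappa> ^ j \<le> real p \<and> real p < \<kappa> ^ (j + 1)" if "real p \<ge> 1" for p j
    unfolding jj_def by (rule geometric_grid_iff[OF \<kappa>(1) that])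
  have lnk: "ln \<kappa> > 0" using \<kappa> by simp
  interpret R: ramare lam I "2 ^ d"
  proof
    fix p assume "p \<in> I"
    then show "cmod (lam p) \<le> 2 ^ d" using lam_prime_power_le[OF A1, of p 1] I1 by simp
  qed (use multiplicative finI I1 in auto)
  have Jk: "\<kappa> ^ j \<le> P2" if "j \<in> J" for j
  proof -
    have "ln P2 / ln \<kappa> \<ge> 0" using P1 P12 lnk by simp
    then have "real (nat \<lfloor>ln P2 / ln \<kappa>\<rfloor>) \<le> ln P2 / ln \<kappa>" by linarith
    moreover have "real j \<le> real (nat \<lfloor>ln P2 / ln \<kappa>\<rfloor>)" using that by (simp add: J_def)
    ultimately have "real j \<le> ln P2 / ln \<kappa>" by linarith
    then have "real j * ln \<kappa> \<le> ln P2" using lnk by (simp only: pos_le_divide_eq)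
    then have "exp (real j * ln \<kappa>) \<le> exp (ln P2)" by simp
    then show ?thesis using \<kappa> P1 P12 by (simp add: exp_of_nat_mult)
  qed
  have lnP2: "ln P2 = \<epsilon> * l - ln 2"
    using Q2 by (simp add: P2_def l_def ln_div ln_powr)
  have lnP1: "ln P1 = l powr \<gamma>" by (simp add: P1_def)
  have cardJ: "real (card J) \<le> (2 * \<epsilon> + 1) * l\<^sup>2"
  proof -
    have "ln P2 / ln \<kappa> \<ge> 0" using P1 P12 lnk by simp
    then have "real (card J) \<le> ln P2 / ln \<kappa> + 1" unfolding J_def card_atMost by linarith
    also have "ln P2 / ln \<kappa> \<le> (\<epsilon> * l) / (1 / (2 * l))"
      using ln_one_plus_inverse_ge[OF l] lnk l \<epsilon> unfolding lnP2 \<kappa>_def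
      by (intro frac_le) auto
    also have "(\<epsilon> * l) / (1 / (2 * l)) + 1 = 2 * \<epsilon> * l\<^sup>2 + 1" by (simp add: power2_eq_square)
    also have "\<dots> \<le> 2 * \<epsilon> * l\<^sup>2 + l\<^sup>2" using l by (intro add_left_mono one_le_power) auto
    also have "\<dots> = (2 * \<epsilon> + 1) * l\<^sup>2" by (simp add: algebra_simps)
    finally show ?thesis by simp
  qed
  have C1_0: "C1 \<ge> 0"
    unfolding C1_def using summable_poly_geometric[of "1/2" 3 "2 * d"]
    by (intro suminf_nonneg) (auto simp: power_one_over)
  have Cm0: "Cm \<ge> 0" unfolding Cm_def by (intro add_nonneg_nonneg sum_nonneg) auto
  have main: "(\<Sum>k\<in>K. (cmod (\<Sum>n=1..x. lam n * g k n))\<^sup>2)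
      \<le> 2 * (10 * (2 * real x) * (2 * (\<Sum>n | 1 \<le> n \<and> n \<le> x \<and> omega_in I n = 0. (cmod (lam n))\<^sup>2)
            + 2 * (\<Sum>n | x < n \<and> real n \<le> \<kappa> * real x. (cmod (lam n))\<^sup>2)
            + 2 * ((1 + (2 ^ d)\<^sup>2) * C1 * Cm * (2 * real x) * (2 / real M))))
        + 2 * ((real (card J))\<^sup>2 * s\<^sup>2 * 10 * Cm * (real x)\<^sup>2)"
  proof (rule R.ramare_large_sieve[where jj = jj and D = D and d = d])
    fix k m n assume k: "k \<in> K"
    then obtain q chi where q: "k = (q, chi)" "q \<in> \<Q>" "chi \<in> Fam q" by (auto simp: K_def)
    have "dirichlet_char q chi" using \<Q>(5)[OF q(2,3)] by (simp add: primitive_dirichlet_char_def)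
    then show "g k (m * n) = g k m * g k n"
      by (simp add: g_def q dirichlet_char_def)
  next
    fix M' b assume M': "D \<le> (M' :: nat)"
    have "(\<Sum>q\<in>\<Q>. \<Sum>chi\<in>Fam q. (cmod (\<Sum>n=1..M'. b n * chi (int n)))\<^sup>2) \<le> 10 * real M' * (\<Sum>n=1..M'. (cmod (b n))\<^sup>2)"
    proof (rule multiplicative_large_sieve[OF \<Q>(1)])
      show "q > 0" if "q \<in> \<Q>" for q using \<Q>(3)[OF that] Q2 by (cases q) auto
      show "lcm q q' \<le> M'" if "q \<in> \<Q>" "q' \<in> \<Q>" for q q' using \<Q>(6)[OF that] M' by linarith
    qed (use \<Q> in blast)
    then show "(\<Sum>k\<in>K. (cmod (\<Sum>n=1..M'. b n * g k n))\<^sup>2) \<le> 10 * real M' * (\<Sum>n=1..M'. (cmod (b n))\<^sup>2)"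
      unfolding K_def g_def using \<Q> by (subst (asm) sum.Sigma) (auto simp: case_prod_unfold)
  next
    fix j assume j: "j \<in> J"
    have "real D * \<kappa> ^ j \<le> real D * P2" using Jk[OF j] by (intro mult_left_mono) auto
    then have "real D * \<kappa> ^ j \<le> real x" using DX x2 by linarith
    then have "real D \<le> real x / \<kappa> ^ j" using \<kappa> by (simp add: pos_le_divide_eq)
    then show "D \<le> nat \<lfloor>real x / \<kappa> ^ j\<rfloor>" by (rule le_nat_floor)
  next
    have "real D * 1 \<le> real D * P2" using P1 P12 by (intro mult_left_mono) auto
    then have "real D \<le> real x" using DX x2 by linarith
    then show "D \<le> x" by simp
  next
    fix p assume p: "p \<in> I"
    show "\<kappa> ^ jj p \<le> real p \<and> real p < \<kappa> ^ (jj p + 1)" using jj_iff[OF I1(1)[OF p]] by blast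
    have "ln (real p) / ln \<kappa> \<le> ln P2 / ln \<kappa>"
      using I1[OF p] lnk by (intro divide_right_mono) auto
    then show "jj p \<in> J" unfolding jj_def J_def by (simp add: nat_mono floor_mono)
    show "M \<le> p" using I1(2)[OF p] by (simp add: M_def nat_le_iff ceiling_le_iff)
  next
    show "2 \<le> M" using P1 unfolding M_def by linarith
  next
    fix k j assume k: "k \<in> K" and j: "j \<in> J"
    obtain q chi where q: "k = (q, chi)" "q \<in> \<Q>" "chi \<in> Fam q" using k by (auto simp: K_def)
    \<comment> \<open>The part of cell j inside the window, as a half-open integer interval. Its
      lower end is attained, hence the -1 in \<open>Ma\<close>; the upper end of the cell is not,
      hence the -1 in \<open>Nb\<close>.\<close>
    define lo where "lo = max P1 (\<kappa> ^ j)"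
    define Ma where "Ma = nat \<lceil>lo\<rceil> - 1"
    define Nb where "Nb = min (nat \<lfloor>P2\<rfloor>) (nat \<lceil>\<kappa> ^ (j + 1)\<rceil> - 1)"
    have lo: "lo \<ge> 2" using P1 by (simp add: lo_def)
    have Ma_iff: "Ma < n \<longleftrightarrow> lo \<le> real n" for n
    proof -
      have "nat \<lceil>lo\<rceil> \<ge> 1" using lo by linarith
      then have "Ma < n \<longleftrightarrow> nat \<lceil>lo\<rceil> \<le> n" unfolding Ma_def by linarith
      also have "\<dots> \<longleftrightarrow> lo \<le> real n" by (simp add: nat_le_iff ceiling_le_iff)
      finally show ?thesis .
    qed
    have kj1: "\<kappa> ^ (j + 1) \<ge> 1" using \<kappa> by (intro one_le_power) auto
    have Nb_iff: "n \<le> Nb \<longleftrightarrow> real n \<le> P2 \<and> real n < \<kappa> ^ (j + 1)" for n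
    proof -
      have "n \<le> nat \<lfloor>P2\<rfloor> \<longleftrightarrow> real n \<le> P2" using P1 P12 by (simp add: le_nat_iff le_floor_iff)
      moreover have "n \<le> nat \<lceil>\<kappa> ^ (j + 1)\<rceil> - 1 \<longleftrightarrow> real n < \<kappa> ^ (j + 1)"
      proof -
        have "nat \<lceil>\<kappa> ^ (j + 1)\<rceil> \<ge> 1" using kj1 by linarith
        then have "n \<le> nat \<lceil>\<kappa> ^ (j + 1)\<rceil> - 1 \<longleftrightarrow> n < nat \<lceil>\<kappa> ^ (j + 1)\<rceil>" by linarith
        also have "\<dots> \<longleftrightarrow> int n < \<lceil>\<kappa> ^ (j + 1)\<rceil>" by (rule zless_nat_eq_int_zless)
        also have "\<dots> \<longleftrightarrow> real n < \<kappa> ^ (j + 1)" by (simp only: less_ceiling_iff of_int_of_nat_eq)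
        finally show ?thesis .
      qed
      ultimately show ?thesis unfolding Nb_def by simp
    qed
    have set_eq: "{p. p \<in> I \<and> jj p = j} = {n \<in> {Ma<..Nb}. prime n}"
    proof (intro equalityI subsetI)
      fix p assume "p \<in> {p. p \<in> I \<and> jj p = j}"
      then have p: "p \<in> I" "jj p = j" by auto
      have "\<kappa> ^ j \<le> real p \<and> real p < \<kappa> ^ (j + 1)" using jj_iff[OF I1(1)[OF p(1)]] p(2) by blast
      then show "p \<in> {n \<in> {Ma<..Nb}. prime n}"
        using I1[OF p(1)] unfolding mem_Collect_eq greaterThanAtMost_iff Ma_iff Nb_iff by (simp add: lo_def)
    next
      fix p assume "p \<in> {n \<in> {Ma<..Nb}. prime n}"
      then have p: "prime p" "lo \<le> real p" "real p \<le> P2" "real p < \<kappa> ^ (j + 1)"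
        unfolding mem_Collect_eq greaterThanAtMost_iff Ma_iff Nb_iff by auto
      then have "\<kappa> ^ j \<le> real p" "P1 \<le> real p" by (auto simp: lo_def)
      moreover have "real p \<ge> 1" using lo p(2) by linarith
      ultimately show "p \<in> {p. p \<in> I \<and> jj p = j}" using p jj_iff[of p j] by (simp add: I_def)
    qed
    have "(\<Sum>p | p \<in> I \<and> jj p = j. lam p * g k p) = (\<Sum>n\<in>{Ma<..Nb}. if prime n then lam n * chi (int n) else 0)"
      unfolding set_eq g_def q(1) snd_conv by (rule sum.inter_filter[OF finite_greaterThanAtMost])
    also have "cmod \<dots> \<le> s * \<kappa> ^ j"
    proof (cases "Ma \<le> Nb")
      case True
      have lnq: "l \<le> ln (real q)" "ln (real q) \<le> ln (2 * Q)"
        using \<Q>(3)[OF q(2)] Q2 by (auto simp: l_def)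
      have "ln (real q) powr \<gamma>' \<le> ln (2 * Q) powr \<gamma>'"
        using lnq l \<gamma> by (intro powr_mono2) auto
      then have "exp (ln (real q) powr \<gamma>') \<le> exp (ln (2 * Q) powr \<gamma>')" by simp
      also have "\<dots> \<le> P1 - 1" using e3 by (simp add: P1_def)
      also have "\<dots> \<le> lo - 1" by (simp add: lo_def)
      also have "\<dots> \<le> real Ma" unfolding Ma_def using lo by linarith
      finally have "cmod (\<Sum>n\<in>{Ma<..Nb}. if prime n then lam n * chi (int n) else 0) \<le> real Nb * ln (real q) powr (-10)"
        by (rule PS[OF q(2,3) _ True])
      also have "\<dots> \<le> \<kappa> ^ (j + 1) * l powr (-10)"
        using Nb_iff[of Nb] lnq l by (intro mult_mono powr_mono2') auto
      also have "\<dots> = \<kappa> * (\<kappa> ^ j * l powr (-10))" by simp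
      also have "\<dots> \<le> 2 * (\<kappa> ^ j * l powr (-10))" using \<kappa> by (intro mult_right_mono) auto
      finally show ?thesis by (simp add: s_def mult_ac)
    next
      case False
      then show ?thesis using \<kappa> by (simp add: s_def)
    qed
    finally show "cmod (\<Sum>p | p \<in> I \<and> jj p = j. lam p * g k p) \<le> s * \<kappa> ^ j" .
  next
    show "(\<Sum>n = 1..N. (cmod (lam n))\<^sup>2) \<le> Cm * real N" for N
      unfolding Cm_def by (rule mean_square_bound[OF A3])
    show "cmod (lam (p ^ k)) \<le> real (k + 1) ^ d" if "prime p" for p k
      by (rule lam_prime_power_le[OF A1 that])
    show "C1 = (\<Sum>k. real (k + 3) ^ (2 * d) / 2 ^ k)" by (simp add: C1_def)
  qed (use Cm0 \<kappa> in \<open>auto simp: J_def\<close>)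
  \<comment> \<open>The target size: the integers without a prime factor in the window cost
    \<open>u\<close>, while the cell boundaries and the square divisors cost 1/l \<le> u.\<close>
  define u where "u = l powr (\<gamma> - 1)"
  have u0: "u > 0" using l by (simp add: u_def)
  have inv_l: "1 / l \<le> u"
  proof -
    have "l powr (-1) \<le> l powr (\<gamma> - 1)" using l \<gamma> by (intro powr_mono) auto
    then show ?thesis using l by (simp add: u_def powr_minus_divide)
  qed
  have S0: "(\<Sum>n | 1 \<le> n \<and> n \<le> x \<and> omega_in I n = 0. (cmod (lam n))\<^sup>2) \<le> \<bar>C3\<bar> * (2 / \<epsilon>) * (real x * u)"
  proof -
    have "(\<Sum>n | 1 \<le> n \<and> n \<le> x \<and> omega_in I n = 0. (cmod (lam n))\<^sup>2)
        \<le> (\<Sum>n | 1 \<le> n \<and> real n \<le> real x \<and> coprime n (\<Prod>p | prime p \<and> P1 \<le> real p \<and> real p \<le> P2. p). (cmod (lam n))\<^sup>2)"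
    proof (rule sum_mono2)
      show "finite {n. 1 \<le> n \<and> real n \<le> real x \<and> coprime n (\<Prod>p | prime p \<and> P1 \<le> real p \<and> real p \<le> P2. p)}"
        by (rule finite_subset[of _ "{..x}"]) auto
      show "{n. 1 \<le> n \<and> n \<le> x \<and> omega_in I n = 0}
        \<subseteq> {n. 1 \<le> n \<and> real n \<le> real x \<and> coprime n (\<Prod>p | prime p \<and> P1 \<le> real p \<and> real p \<le> P2. p)}"
      proof
        fix n assume n: "n \<in> {n. 1 \<le> n \<and> n \<le> x \<and> omega_in I n = 0}"
        then have "{p\<in>I. p dvd n} = {}" using finI by (simp add: omega_in_def)
        then have "\<not> p dvd n" if "p \<in> I" for p using that by blast
        then have "coprime n (\<Prod>p\<in>I. p)"
          by (intro prod_coprime_right) (metis I1(4) coprime_commute prime_imp_coprime)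
        then show "n \<in> {n. 1 \<le> n \<and> real n \<le> real x \<and> coprime n (\<Prod>p | prime p \<and> P1 \<le> real p \<and> real p \<le> P2. p)}"
          using n unfolding I_def by simp
      qed
    qed auto
    also have "\<dots> \<le> C3 * (real x * (ln P1 / ln P2))"
      by (rule A3[OF P1 P12 P2x])
    also have "\<dots> \<le> \<bar>C3\<bar> * (real x * (ln P1 / ln P2))"
      using P1 P12 by (intro mult_right_mono) auto
    also have "\<dots> \<le> \<bar>C3\<bar> * (real x * ((2 / \<epsilon>) * u))"
    proof (intro mult_left_mono)
      have pb: "0 < \<epsilon> * l / 2" using \<epsilon> l by simp
      then have pa: "0 < \<epsilon> * l - ln 2" using e8 by linarith
      have "ln P1 / ln P2 \<le> l powr \<gamma> / (\<epsilon> * l / 2)"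
        unfolding lnP1 lnP2 by (rule divide_left_mono[OF e8 powr_ge_zero mult_pos_pos[OF pa pb]])
      also have "\<dots> = (2 / \<epsilon>) * u"
        using l by (simp add: u_def powr_diff)
      finally show "ln P1 / ln P2 \<le> (2 / \<epsilon>) * u" .
    qed auto
    finally show ?thesis by (simp add: mult_ac)
  qed
  have S2: "(\<Sum>n | x < n \<and> real n \<le> \<kappa> * real x. (cmod (lam n))\<^sup>2) \<le> \<bar>C2\<bar> * (real x * u)"
  proof -
    have "(\<Sum>n | x < n \<and> real n \<le> \<kappa> * real x. (cmod (lam n))\<^sup>2)
        \<le> (\<Sum>n | real x \<le> real n \<and> real n \<le> real x + real x / l. (cmod (lam n))\<^sup>2)"
    proof (rule sum_mono2)
      show "finite {n. real x \<le> real n \<and> real n \<le> real x + real x / l}"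
        by (rule finite_subset[of _ "{..nat \<lfloor>real x + real x / l\<rfloor>}"],
            rule subsetI, unfold mem_Collect_eq atMost_iff, elim conjE, rule le_nat_floor) auto
      have "\<kappa> * real x = real x + real x / l" by (simp add: \<kappa>_def algebra_simps)
      then show "{n. x < n \<and> real n \<le> \<kappa> * real x} \<subseteq> {n. real x \<le> real n \<and> real n \<le> real x + real x / l}"
        by auto
    qed auto
    also have "\<dots> \<le> C2 * (real x / l)" by (rule A2[OF xQ])
    also have "\<dots> \<le> \<bar>C2\<bar> * (real x * (1 / l))" using l by (simp add: divide_right_mono mult_right_mono)
    also have "\<dots> \<le> \<bar>C2\<bar> * (real x * u)" using inv_l by (intro mult_left_mono) auto
    finally show ?thesis .
  qed
  have S3: "(1 + ((2::real) ^ d)\<^sup>2) * C1 * Cm * (2 * real x) * (2 / real M) \<le> (1 + (2 ^ d)\<^sup>2) * C1 * Cm * 4 * (real x * u)"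
  proof -
    have "l \<le> real M" using e7 unfolding M_def P1_def by linarith
    then have "1 / real M \<le> 1 / l" using l by (intro divide_left_mono) auto
    then have "1 / real M \<le> u" using inv_l by linarith
    then have "((1 + ((2::real) ^ d)\<^sup>2) * C1 * Cm * 4 * real x) * (1 / real M) \<le> ((1 + (2 ^ d)\<^sup>2) * C1 * Cm * 4 * real x) * u"
      using C1_0 Cm0 by (intro mult_left_mono mult_nonneg_nonneg) auto
    then show ?thesis by (simp add: mult_ac)
  qed
  have S4: "(real (card J))\<^sup>2 * s\<^sup>2 \<le> 4 * (2 * \<epsilon> + 1)\<^sup>2 * u"
  proof -
    have "(real (card J))\<^sup>2 * s\<^sup>2 \<le> ((2 * \<epsilon> + 1) * l\<^sup>2)\<^sup>2 * s\<^sup>2"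
      using cardJ by (intro mult_right_mono power_mono) auto
    also have "\<dots> = 4 * (2 * \<epsilon> + 1)\<^sup>2 * (l ^ 4 * (l powr (-10))\<^sup>2)"
      by (simp add: s_def power_mult_distrib flip: power_mult)
    also have "l ^ 4 * (l powr (-10))\<^sup>2 = l powr 4 * l powr (-20)"
      using l by (simp add: power2_eq_square flip: powr_add)
    also have "\<dots> = l powr (-16)" by (simp only: powr_add[symmetric]) simp
    also have "4 * (2 * \<epsilon> + 1)\<^sup>2 * l powr (-16) \<le> 4 * (2 * \<epsilon> + 1)\<^sup>2 * u"
      unfolding u_def using l \<gamma> by (intro mult_left_mono powr_mono) auto
    finally show ?thesis .
  qed
  have "(\<Sum>q\<in>\<Q>. \<Sum>chi\<in>Fam q. (cmod (\<Sum>n | 1 \<le> n \<and> real n \<le> X. lam n * chi (int n)))\<^sup>2)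
      = (\<Sum>k\<in>K. (cmod (\<Sum>n=1..x. lam n * g k n))\<^sup>2)"
  proof -
    have eq: "{n. 1 \<le> n \<and> real n \<le> X} = {1..x}" unfolding x_iff[symmetric] by auto
    show ?thesis unfolding K_def g_def eq
      by (subst sum.Sigma) (simp_all add: case_prod_unfold \<Q>(1,4))
  qed
  also have "\<dots> \<le> 2 * (10 * (2 * real x) * (2 * (\<bar>C3\<bar> * (2 / \<epsilon>) * (real x * u))
            + 2 * (\<bar>C2\<bar> * (real x * u)) + 2 * ((1 + (2 ^ d)\<^sup>2) * C1 * Cm * 4 * (real x * u))))
        + 2 * (4 * (2 * \<epsilon> + 1)\<^sup>2 * u * 10 * Cm * (real x)\<^sup>2)"
    using S0 S2 S3 S4 Cm0
    by (intro order.trans[OF main] add_mono mult_left_mono mult_right_mono) auto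
  also have "\<dots> = (2 * (20 * (2 * (\<bar>C3\<bar> * (2 / \<epsilon>)) + 2 * \<bar>C2\<bar> + 2 * ((1 + ((2::real) ^ d)\<^sup>2) * C1 * Cm * 4)))
       + 2 * (4 * (2 * \<epsilon> + 1)\<^sup>2 * 10 * Cm)) * ((real x)\<^sup>2 * u)" (is "_ = ?C * _")
    by (simp add: algebra_simps power2_eq_square)
  also have "\<dots> \<le> ?C * (X\<^sup>2 * u)"
    using xX u0 C1_0 Cm0 \<epsilon> by (intro mult_left_mono mult_right_mono power_mono add_nonneg_nonneg mult_nonneg_nonneg) auto
  finally show "(\<Sum>q\<in>\<Q>. \<Sum>chi\<in>Fam q. (cmod (\<Sum>n | 1 \<le> n \<and> real n \<le> X. lam n * chi (int n)))\<^sup>2) \<le> ?C * (X\<^sup>2 * l powr (\<gamma> - 1))"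
    by (simp only: u_def)
qed

text \<open>Fixes the exponents and one threshold for Q, then expresses the saving in terms of log
  X. The set of moduli and the lcm bound \<open>D\<close> stay free, so that both assertions of the
  theorem can be read off.\<close>

lemma large_moduli_estimate:
  fixes \<beta> \<eta> \<epsilon> b :: real
  assumes A1: "\<And>n. 1 \<le> n \<Longrightarrow> cmod (lam n) \<le> real (divisor_tau d n)"
    and A2: "\<exists>\<epsilon>0>0. \<exists>C. \<forall>\<^sub>F X::real in at_top. \<forall>Y. X powr (1 - \<epsilon>0) \<le> Y \<and> Y \<le> X \<longrightarrow>
               (\<Sum>n | X \<le> real n \<and> real n \<le> X + Y. (cmod (lam n))\<^sup>2) \<le> C * Y"
    and A3: "\<exists>C. \<forall>X P1 P2 :: real. 2 \<le> P1 \<and> P1 \<le> P2 \<and> P2 \<le> X \<longrightarrow>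
               (\<Sum>n | 1 \<le> n \<and> real n \<le> X \<and>
                      coprime n (\<Prod>p | prime p \<and> P1 \<le> real p \<and> real p \<le> P2. p).
                  (cmod (lam n))\<^sup>2) \<le> C * (X * (ln P1 / ln P2))"
    and A4: "zero_free_hypothesis lam \<beta> Fam S"
    and beta: "0 \<le> \<beta>" "\<beta> < 1"
    and family: "\<And>q. 2 \<le> q \<Longrightarrow> Fam q \<subseteq> {chi. primitive_dirichlet_char q chi}"
    and \<epsilon>: "\<epsilon> > 0" and \<eta>: "\<eta> < 1 - \<beta>" and b: "b > 0"
  shows "\<exists>C\<ge>0. \<exists>Q0\<ge>2. \<forall>Q\<ge>Q0. \<forall>\<Q> D X. finite \<Q> \<and> \<Q> \<subseteq> S \<and> (\<forall>q\<in>\<Q>. Q \<le> real q \<and> real q \<le> 2 * Q \<and> finite (Fam q)) \<and>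
    (\<forall>q\<in>\<Q>. \<forall>q'\<in>\<Q>. lcm q q' \<le> D) \<and> real D * Q powr \<epsilon> \<le> X \<and> ln X \<le> b * ln Q \<longrightarrow>
    (\<Sum>q\<in>\<Q>. \<Sum>chi\<in>Fam q. (cmod (\<Sum>n | 1 \<le> n \<and> real n \<le> X. lam n * chi (int n)))\<^sup>2)
      \<le> C * (X\<^sup>2 / ln X powr \<eta>)"
proof -
  \<comment> \<open>The midpoint between \<beta> and min 1 (1 - \<eta>); the minimum keeps \<gamma>
    below 1 when \<eta> is negative.\<close>
  define \<gamma> where "\<gamma> = (\<beta> + min 1 (1 - \<eta>)) / 2"
  define \<gamma>' where "\<gamma>' = (\<beta> + \<gamma>) / 2"
  have \<gamma>: "\<beta> < \<gamma>" "\<gamma> < 1" "\<gamma> \<le> 1 - \<eta>" using beta \<eta> by (auto simp: \<gamma>_def min_def)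
  have \<gamma>': "0 < \<gamma>'" "\<beta> < \<gamma>'" "\<gamma>' < \<gamma>" "\<gamma>' < 1" using beta \<gamma> by (auto simp: \<gamma>'_def)
  have \<gamma>0: "\<gamma> > 0" using beta \<gamma> by linarith
  obtain \<epsilon>0 C2 where \<epsilon>0: "\<epsilon>0 > 0" and "\<forall>\<^sub>F X::real in at_top. \<forall>Y. X powr (1 - \<epsilon>0) \<le> Y \<and> Y \<le> X \<longrightarrow>
               (\<Sum>n | X \<le> real n \<and> real n \<le> X + Y. (cmod (lam n))\<^sup>2) \<le> C2 * Y"
    using A2 by blast
  then obtain X2 where X2: "\<And>X Y. X \<ge> X2 \<Longrightarrow> X powr (1 - \<epsilon>0) \<le> Y \<Longrightarrow> Y \<le> X \<Longrightarrow>
               (\<Sum>n | X \<le> real n \<and> real n \<le> X + Y. (cmod (lam n))\<^sup>2) \<le> C2 * Y"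
    unfolding eventually_at_top_linorder by blast
  obtain C3 where A3': "\<And>X P1 P2 :: real. 2 \<le> P1 \<Longrightarrow> P1 \<le> P2 \<Longrightarrow> P2 \<le> X \<Longrightarrow>
               (\<Sum>n | 1 \<le> n \<and> real n \<le> X \<and>
                      coprime n (\<Prod>p | prime p \<and> P1 \<le> real p \<and> real p \<le> P2. p).
                  (cmod (lam n))\<^sup>2) \<le> C3 * (X * (ln P1 / ln P2))"
    using A3 by blast
  obtain q0 :: nat where PS: "\<And>q chi m n. q \<ge> q0 \<Longrightarrow> q \<in> S \<Longrightarrow> finite (Fam q) \<Longrightarrow> chi \<in> Fam q \<Longrightarrow>
      exp (ln (real q) powr \<gamma>') \<le> real m \<Longrightarrow> m \<le> n \<Longrightarrow>
    cmod (\<Sum>k\<in>{m<..n}. if prime k then lam k * chi (int k) else 0) \<le> real n * ln (real q) powr (-10)"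
    using prime_sum_bound[OF A1 beta(1) \<gamma>'(2,4) family A4] unfolding eventually_sequentially by blast
  have ev: "\<forall>\<^sub>F Q::real in at_top. Q \<ge> max 2 (max X2 (real q0))"
    "\<forall>\<^sub>F Q::real in at_top. ln Q \<ge> 2"
    "\<forall>\<^sub>F Q::real in at_top. exp (ln (2 * Q) powr \<gamma>') \<le> exp (ln Q powr \<gamma>) - 1"
    "\<forall>\<^sub>F Q::real in at_top. exp (ln Q powr \<gamma>) \<le> Q powr \<epsilon> / 2"
    "\<forall>\<^sub>F Q::real in at_top. ln Q \<le> exp (ln Q powr \<gamma>)"
    "\<forall>\<^sub>F Q::real in at_top. \<epsilon> * ln Q / 2 \<le> \<epsilon> * ln Q - ln 2"
    "\<forall>\<^sub>F Q::real in at_top. ln Q \<le> Q powr \<epsilon>0"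
  proof -
    show "\<forall>\<^sub>F Q::real in at_top. Q \<ge> max 2 (max X2 (real q0))" by (rule eventually_ge_at_top)
    show "\<forall>\<^sub>F Q::real in at_top. ln Q \<ge> 2" by real_asymp
    show "\<forall>\<^sub>F Q::real in at_top. exp (ln (2 * Q) powr \<gamma>') \<le> exp (ln Q powr \<gamma>) - 1"
    proof -
      have "\<gamma> - \<gamma>' > 0" using \<gamma>' by simp
      then have "\<forall>\<^sub>F x::real in at_top. 3 \<le> x powr (\<gamma> - \<gamma>')" by real_asymp
      then have "\<forall>\<^sub>F Q::real in at_top. 3 \<le> ln Q powr (\<gamma> - \<gamma>')"
        using ln_at_top by (rule eventually_compose_filterlim)
      moreover have "\<forall>\<^sub>F Q::real in at_top. ln Q \<ge> 1" by real_asymp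
      ultimately show ?thesis using eventually_ge_at_top[of 2]
      proof eventually_elim
        case (elim Q)
        have ge1: "ln Q powr \<gamma>' \<ge> 1" using elim(2) \<gamma>' by (simp add: ge_one_powr_ge_zero)
        \<comment> \<open>The factor 3 pays 2 for ln (2Q) \<le> 2 ln Q and 1 for an additive 1 in
          the exponent; the latter yields the -1 of the claim, since e^(y + 1) \<ge> 2 e^y \<ge> e^y
          + 1 for y \<ge> 0.\<close>
        have "ln (2 * Q) powr \<gamma>' \<le> (2 * ln Q) powr \<gamma>'"
          using elim \<gamma>' by (intro powr_mono2) (auto simp: ln_mult)
        also have "\<dots> = 2 powr \<gamma>' * ln Q powr \<gamma>'" using elim(2) by (simp add: powr_mult)
        also have "\<dots> \<le> 2 powr 1 * ln Q powr \<gamma>'" using \<gamma>' by (intro mult_right_mono powr_mono) auto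
        finally have "ln (2 * Q) powr \<gamma>' + 1 \<le> 3 * ln Q powr \<gamma>'" using ge1 by simp
        also have "\<dots> \<le> ln Q powr (\<gamma> - \<gamma>') * ln Q powr \<gamma>'" using elim(1) by (intro mult_right_mono) auto
        also have "\<dots> = ln Q powr \<gamma>" by (simp only: powr_add[symmetric]) simp
        finally have "exp (ln (2 * Q) powr \<gamma>' + 1) \<le> exp (ln Q powr \<gamma>)" by simp
        moreover have "exp (ln (2 * Q) powr \<gamma>') * 2 \<le> exp (ln (2 * Q) powr \<gamma>') * exp 1"
          using exp_ge_add_one_self[of "1::real"] by (intro mult_left_mono) auto
        moreover have "exp (ln (2 * Q) powr \<gamma>') \<ge> 1" by simp
        ultimately show ?case unfolding exp_add by linarith
      qed
    qed
    show "\<forall>\<^sub>F Q::real in at_top. exp (ln Q powr \<gamma>) \<le> Q powr \<epsilon> / 2"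
      using \<gamma>' \<gamma> \<epsilon> by real_asymp
    show "\<forall>\<^sub>F Q::real in at_top. ln Q \<le> exp (ln Q powr \<gamma>)"
    proof -
      have "\<forall>\<^sub>F x::real in at_top. x \<le> exp (x powr \<gamma>)" using \<gamma>0 by real_asymp
      then show ?thesis using ln_at_top by (rule eventually_compose_filterlim)
    qed
    show "\<forall>\<^sub>F Q::real in at_top. \<epsilon> * ln Q / 2 \<le> \<epsilon> * ln Q - ln 2"
      using \<epsilon> by real_asymp
    show "\<forall>\<^sub>F Q::real in at_top. ln Q \<le> Q powr \<epsilon>0"
      using \<epsilon>0 by real_asymp
  qed
  obtain Q0 where Q0: "\<And>Q. Q \<ge> Q0 \<Longrightarrow> Q \<ge> max 2 (max X2 (real q0)) \<and> ln Q \<ge> 2 \<and>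
    exp (ln (2 * Q) powr \<gamma>') \<le> exp (ln Q powr \<gamma>) - 1 \<and> exp (ln Q powr \<gamma>) \<le> Q powr \<epsilon> / 2 \<and>
    ln Q \<le> exp (ln Q powr \<gamma>) \<and> \<epsilon> * ln Q / 2 \<le> \<epsilon> * ln Q - ln 2 \<and> ln Q \<le> Q powr \<epsilon>0"
    using eventually_conj[OF ev(1) eventually_conj[OF ev(2) eventually_conj[OF ev(3) eventually_conj[OF ev(4)
      eventually_conj[OF ev(5) eventually_conj[OF ev(6,7)]]]]]]
    unfolding eventually_at_top_linorder by blast
  define Cm where "Cm = \<bar>C3\<bar> + (\<Sum>n=1..2. (cmod (lam n))\<^sup>2)"
  define C1 where "C1 = (\<Sum>k. real (k + 3) ^ (2 * d) / 2 ^ k)"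
  define Ct where "Ct = 2 * (20 * (2 * (\<bar>C3\<bar> * (2 / \<epsilon>)) + 2 * \<bar>C2\<bar> + 2 * ((1 + ((2::real) ^ d)\<^sup>2) * C1 * Cm * 4)))
       + 2 * (4 * (2 * \<epsilon> + 1)\<^sup>2 * 10 * Cm)"
  have "C1 \<ge> 0"
    unfolding C1_def using summable_poly_geometric[of "1/2" 3 "2 * d"]
    by (intro suminf_nonneg) (auto simp: power_one_over)
  moreover have "Cm \<ge> 0" unfolding Cm_def by (intro add_nonneg_nonneg sum_nonneg) auto
  ultimately have Ct0: "Ct \<ge> 0"
    unfolding Ct_def using \<epsilon> by (intro add_nonneg_nonneg mult_nonneg_nonneg) auto
  define C where "C = Ct * b powr (1 - \<gamma>)"
  have C0: "C \<ge> 0" using Ct0 by (simp add: C_def)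
  show ?thesis
  proof (rule exI[of _ C], rule conjI[OF C0], rule exI[of _ "max 2 Q0"], intro conjI allI impI)
    fix Q X :: real and \<Q> :: "nat set" and D :: nat
    assume Q: "max 2 Q0 \<le> Q"
    assume as: "finite \<Q> \<and> \<Q> \<subseteq> S \<and> (\<forall>q\<in>\<Q>. Q \<le> real q \<and> real q \<le> 2 * Q \<and> finite (Fam q)) \<and>
      (\<forall>q\<in>\<Q>. \<forall>q'\<in>\<Q>. lcm q q' \<le> D) \<and> real D * Q powr \<epsilon> \<le> X \<and> ln X \<le> b * ln Q"
    have Q': "Q \<ge> 2" "Q \<ge> X2" "Q \<ge> real q0" "ln Q \<ge> 2"
      "exp (ln (2 * Q) powr \<gamma>') \<le> exp (ln Q powr \<gamma>) - 1" "exp (ln Q powr \<gamma>) \<le> Q powr \<epsilon> / 2"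
      "ln Q \<le> exp (ln Q powr \<gamma>)" "\<epsilon> * ln Q / 2 \<le> \<epsilon> * ln Q - ln 2" "ln Q \<le> Q powr \<epsilon>0"
      using Q0[of Q] Q by auto
    show "(\<Sum>q\<in>\<Q>. \<Sum>chi\<in>Fam q. (cmod (\<Sum>n | 1 \<le> n \<and> real n \<le> X. lam n * chi (int n)))\<^sup>2) \<le> C * (X\<^sup>2 / ln X powr \<eta>)"
    proof (cases "\<Q> = {}")
      case True
      then show ?thesis using C0 by simp
    next
      case False
      \<comment> \<open>For x \<ge> Q the length x / ln Q is at least x^(1 - \<epsilon>0), so (A2)
        covers intervals shorter than x by one logarithm.\<close>
      have A2': "(\<Sum>n | x \<le> real n \<and> real n \<le> x + x / ln Q. (cmod (lam n))\<^sup>2) \<le> C2 * (x / ln Q)" if x: "x \<ge> Q" for x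
      proof (rule X2)
        show "X2 \<le> x" using Q' x by linarith
        have "x powr (1 - \<epsilon>0) = x / x powr \<epsilon>0" using x Q' by (simp add: powr_diff)
        also have "\<dots> \<le> x / ln Q"
        proof (rule divide_left_mono)
          have "Q powr \<epsilon>0 \<le> x powr \<epsilon>0" using x Q' \<epsilon>0 by (intro powr_mono2) auto
          then show "ln Q \<le> x powr \<epsilon>0" using Q' by linarith
        qed (use x Q' in auto)
        finally show "x powr (1 - \<epsilon>0) \<le> x / ln Q" .
        have "x / ln Q \<le> x / 1" using x Q' by (intro divide_left_mono) auto
        then show "x / ln Q \<le> x" by simp
      qed
      have q2: "2 \<le> q" "q \<ge> q0" if "q \<in> \<Q>" for q
      proof -
        have "real 2 \<le> real q" "real q0 \<le> real q" using as that Q' by fastforce+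
        then show "2 \<le> q" "q \<ge> q0" by (simp_all only: of_nat_le_iff)
      qed
      have PS': "cmod (\<Sum>k\<in>{m<..n}. if prime k then lam k * chi (int k) else 0) \<le> real n * ln (real q) powr (-10)"
        if "q \<in> \<Q>" "chi \<in> Fam q" "exp (ln (real q) powr \<gamma>') \<le> real m" "m \<le> n" for q chi m n
        by (rule PS[OF q2(2)[OF that(1)] _ _ that(2,3,4)]) (use as that in blast)+
      have prim: "primitive_dirichlet_char q chi" if "q \<in> \<Q>" "chi \<in> Fam q" for q chi
        using family[OF q2(1)[OF that(1)]] that(2) by blast
      have Qpos: "Q > 0" using Q' by linarith
      have range: "Q \<le> real q \<and> real q \<le> 2 * Q" "finite (Fam q)" if "q \<in> \<Q>" for q using as that by blast+
      have lcm: "lcm q q' \<le> D" if "q \<in> \<Q>" "q' \<in> \<Q>" for q q' using as that by blast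
      have finQ: "finite \<Q>" and X: "real D * Q powr \<epsilon> \<le> X" and lnX: "ln X \<le> b * ln Q" using as by blast+
      note core = large_sieve_mean_square_estimate[OF A1 A2' A3' PS' finQ False range(1) range(2) prim lcm \<epsilon> \<gamma>'(1) \<gamma>'(3) \<gamma>(2) X Qpos Q'(4-8),
          folded Cm_def, folded C1_def, folded Ct_def]
      have XQ: "X \<ge> 2 * Q" by (rule core(2))
      have lnX2: "ln X \<ge> 2"
      proof -
        have "ln Q \<le> ln X" using XQ Qpos by simp
        then show ?thesis using Q'(4) by linarith
      qed
      \<comment> \<open>The exponent \<gamma> - 1 is negative, so the upper bound ln X \<le> b * ln
        Q is the one that gives the right direction.\<close>
      have "ln Q powr (\<gamma> - 1) \<le> (ln X / b) powr (\<gamma> - 1)"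
        using lnX lnX2 b \<gamma> by (intro powr_mono2') (auto simp: pos_divide_le_eq mult.commute)
      also have "\<dots> = b powr (1 - \<gamma>) * ln X powr (\<gamma> - 1)"
        using b lnX2 by (simp add: powr_divide powr_minus_divide[symmetric] flip: powr_minus)
          (simp add: powr_diff field_simps)
      also have "\<dots> \<le> b powr (1 - \<gamma>) * ln X powr (- \<eta>)"
        using lnX2 \<gamma> by (intro mult_left_mono powr_mono) auto
      finally have u: "ln Q powr (\<gamma> - 1) \<le> b powr (1 - \<gamma>) * ln X powr (- \<eta>)" .
      have "(\<Sum>q\<in>\<Q>. \<Sum>chi\<in>Fam q. (cmod (\<Sum>n | 1 \<le> n \<and> real n \<le> X. lam n * chi (int n)))\<^sup>2)
          \<le> Ct * (X\<^sup>2 * ln Q powr (\<gamma> - 1))" by (rule core(1))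
      also have "\<dots> \<le> Ct * (X\<^sup>2 * (b powr (1 - \<gamma>) * ln X powr (- \<eta>)))"
        using u Ct0 by (intro mult_left_mono) auto
      also have "\<dots> = C * (X\<^sup>2 / ln X powr \<eta>)"
        by (simp add: C_def powr_minus_divide)
      finally show ?thesis .
    qed
  qed simp
qed

text \<open>Below the threshold the moduli and \<open>X\<close> are bounded, so the trivial bound is
  a constant, and the right-hand side stays away from 0. An infinite \<open>Fam q\<close> has
  cardinality 0 and sum 0 by convention, in agreement with the bound.\<close>

lemma small_moduli_estimate:
  fixes X0 \<eta> :: real
  assumes family: "\<And>q. 2 \<le> q \<Longrightarrow> Fam q \<subseteq> {chi. primitive_dirichlet_char q chi}" and X0: "X0 \<ge> 2"
  shows "\<exists>C\<ge>0. \<forall>\<Q> X. \<Q> \<subseteq> {2..n} \<and> 2 \<le> X \<and> X \<le> X0 \<longrightarrow>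
    (\<Sum>q\<in>\<Q>. \<Sum>chi\<in>Fam q. (cmod (\<Sum>n | 1 \<le> n \<and> real n \<le> X. lam n * chi (int n)))\<^sup>2)
      \<le> C * (X\<^sup>2 / ln X powr \<eta>)"
proof -
  define V where "V = (\<Sum>n=1..nat \<lfloor>X0\<rfloor>. cmod (lam n))"
  define B where "B = (\<Sum>q=2..n. real (card (Fam q)) * V\<^sup>2)"
  \<comment> \<open>Two summands because ln X powr \<eta> is largest at the right end of the range
    for \<eta> \<ge> 0 and at the left end for \<eta> < 0.\<close>
  define U where "U = ln 2 powr \<eta> + ln X0 powr \<eta>"
  have B0: "B \<ge> 0" unfolding B_def by (intro sum_nonneg) auto
  have U0: "U \<ge> 0" by (simp add: U_def)
  have "(\<Sum>q\<in>\<Q>. \<Sum>chi\<in>Fam q. (cmod (\<Sum>n | 1 \<le> n \<and> real n \<le> X. lam n * chi (int n)))\<^sup>2)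
      \<le> B * U * (X\<^sup>2 / ln X powr \<eta>)" if \<Q>: "\<Q> \<subseteq> {2..n}" and X: "2 \<le> X" "X \<le> X0" for \<Q> X
  proof -
    have term_le: "(\<Sum>chi\<in>Fam q. (cmod (\<Sum>n | 1 \<le> n \<and> real n \<le> X. lam n * chi (int n)))\<^sup>2) \<le> real (card (Fam q)) * V\<^sup>2"
      if "q \<in> \<Q>" for q
    proof -
      have q2: "2 \<le> q" using \<Q> that by auto
      have "(cmod (\<Sum>n | 1 \<le> n \<and> real n \<le> X. lam n * chi (int n)))\<^sup>2 \<le> V\<^sup>2" if "chi \<in> Fam q" for chi
      proof (rule power_mono)
        interpret dirichlet_character q chi
          using family[OF q2] that q2 by unfold_locales (auto simp: primitive_dirichlet_char_def)
        have "cmod (\<Sum>n | 1 \<le> n \<and> real n \<le> X. lam n * chi (int n)) \<le> (\<Sum>n | 1 \<le> n \<and> real n \<le> X. cmod (lam n))"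
        proof (intro order.trans[OF norm_sum] sum_mono)
          fix n
          show "cmod (lam n * chi (int n)) \<le> cmod (lam n)"
            using mult_left_mono[OF norm_le_1[of "int n"], of "cmod (lam n)"] by (simp add: norm_mult)
        qed
        also have "\<dots> \<le> V" unfolding V_def
        proof (rule sum_mono2)
          show "{n. 1 \<le> n \<and> real n \<le> X} \<subseteq> {1..nat \<lfloor>X0\<rfloor>}"
            using X by (auto intro!: le_nat_floor)
        qed auto
        finally show "cmod (\<Sum>n | 1 \<le> n \<and> real n \<le> X. lam n * chi (int n)) \<le> V" .
      qed auto
      then show ?thesis
        using sum_bounded_above[of "Fam q" "\<lambda>chi. (cmod (\<Sum>n | 1 \<le> n \<and> real n \<le> X. lam n * chi (int n)))\<^sup>2" "V\<^sup>2"] by simp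
    qed
    have "(\<Sum>q\<in>\<Q>. \<Sum>chi\<in>Fam q. (cmod (\<Sum>n | 1 \<le> n \<and> real n \<le> X. lam n * chi (int n)))\<^sup>2)
        \<le> (\<Sum>q\<in>\<Q>. real (card (Fam q)) * V\<^sup>2)" by (intro sum_mono term_le)
    also have "\<dots> \<le> B" unfolding B_def using \<Q> by (intro sum_mono2) auto
    also have "B \<le> B * (U * (X\<^sup>2 / ln X powr \<eta>))"
    proof -
      have ln2: "(0::real) < ln 2" by simp
      have lnX: "ln 2 \<le> ln X" "ln X \<le> ln X0" using X by auto
      have "ln X powr \<eta> \<le> U"
      proof (cases "\<eta> \<ge> 0")
        case True
        then have "ln X powr \<eta> \<le> ln X0 powr \<eta>" using lnX ln2 by (intro powr_mono2) linarith+
        then show ?thesis by (simp add: U_def add_increasing)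
      next
        case False
        then have "ln X powr \<eta> \<le> ln 2 powr \<eta>" using lnX ln2 by (intro powr_mono2') linarith+
        then show ?thesis by (simp add: U_def add_increasing2)
      qed
      moreover have "ln X > 0" using lnX ln2 by linarith
      then have "ln X powr \<eta> > 0" by simp
      ultimately have "1 \<le> U / ln X powr \<eta>" by (simp add: pos_le_divide_eq)
      moreover have "1 \<le> X\<^sup>2" using X by (intro one_le_power) auto
      ultimately have "1 * 1 \<le> U / ln X powr \<eta> * X\<^sup>2" by (intro mult_mono) auto
      then have "B * 1 \<le> B * (U / ln X powr \<eta> * X\<^sup>2)" using B0 by (intro mult_left_mono) auto
      then show ?thesis by (simp add: mult_ac)
    qed
    finally show ?thesis by (simp add: mult_ac)
  qed
  then show ?thesis using B0 U0 by (intro exI[of _ "B * U"]) auto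
qed

end

theorem proposition1p7:
  fixes d :: nat
    and lam :: "nat \<Rightarrow> complex"
    and \<alpha> :: "nat \<Rightarrow> nat \<Rightarrow> complex"
    and N :: "nat \<Rightarrow> nat"
    and \<mu> :: "complex \<Rightarrow> nat \<Rightarrow> complex"
    and \<theta> \<beta> :: real
    and Fam :: "nat \<Rightarrow> (int \<Rightarrow> complex) set"
    and S :: "nat set"
  assumes framework: "twisted_L_framework d lam \<alpha> N \<mu> \<theta>"
    and degree: "3 \<le> d"
    and beta: "0 \<le> \<beta>" "\<beta> < 1"
    and family: "\<And>q. 2 \<le> q \<Longrightarrow> Fam q \<subseteq> {chi. primitive_dirichlet_char q chi}"
    and A1: "\<And>n. 1 \<le> n \<Longrightarrow> cmod (lam n) \<le> real (divisor_tau d n)"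
    and A2: "\<exists>\<epsilon>0>0. \<exists>C. \<forall>\<^sub>F X::real in at_top. \<forall>Y. X powr (1 - \<epsilon>0) \<le> Y \<and> Y \<le> X \<longrightarrow>
               (\<Sum>n | X \<le> real n \<and> real n \<le> X + Y. (cmod (lam n))\<^sup>2) \<le> C * Y"
    and A3: "\<exists>C. \<forall>X P1 P2 :: real. 2 \<le> P1 \<and> P1 \<le> P2 \<and> P2 \<le> X \<longrightarrow>
               (\<Sum>n | 1 \<le> n \<and> real n \<le> X \<and>
                      coprime n (\<Prod>p | prime p \<and> P1 \<le> real p \<and> real p \<le> P2. p).
                  (cmod (lam n))\<^sup>2) \<le> C * (X * (ln P1 / ln P2))"
    and moduli: "S \<subseteq> {2..}"
    and A4: "zero_free_hypothesis lam \<beta> Fam S"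
  shows "(\<forall>\<epsilon>>0. \<forall>\<eta><1 - \<beta>. \<forall>a>0. \<forall>b>0. \<exists>C. \<forall>q\<in>S. \<forall>X::real.
            X \<ge> real q powr (1 + \<epsilon>) \<and> a * ln (real q) \<le> ln X \<and> ln X \<le> b * ln (real q) \<longrightarrow>
            (\<Sum>chi\<in>Fam q. (cmod (\<Sum>n | 1 \<le> n \<and> real n \<le> X. lam n * chi (int n)))\<^sup>2)
              \<le> C * (X\<^sup>2 / ln X powr \<eta>)) \<and>
         (\<forall>\<epsilon>>0. \<forall>\<eta><1 - \<beta>. \<forall>a>0. \<forall>b>0. \<exists>C. \<forall>Q\<ge>2. \<forall>X::real.
            {q. Q \<le> real q \<and> real q \<le> 2 * Q} \<subseteq> S \<and>
            X \<ge> Q powr (2 + \<epsilon>) \<and> a * ln Q \<le> ln X \<and> ln X \<le> b * ln Q \<longrightarrow>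
            (\<Sum>q | Q \<le> real q \<and> real q \<le> 2 * Q.
               \<Sum>chi\<in>Fam q. (cmod (\<Sum>n | 1 \<le> n \<and> real n \<le> X. lam n * chi (int n)))\<^sup>2)
              \<le> C * (X\<^sup>2 / ln X powr \<eta>))"
proof (intro conjI allI impI)
  interpret twisted_L_framework d lam \<alpha> N \<mu> \<theta> by (rule framework)
  define F where "F q X = (\<Sum>chi\<in>Fam q. (cmod (\<Sum>n | 1 \<le> n \<and> real n \<le> X. lam n * chi (int n)))\<^sup>2)" for q and X :: real
  fix \<epsilon> \<eta> a b :: real
  assume \<epsilon>: "0 < \<epsilon>" and \<eta>: "\<eta> < 1 - \<beta>" and "0 < a" and b: "0 < b"
  \<comment> \<open>The summand 2 makes the bound at least 2, as
    \<open>small_moduli_estimate\<close> requires.\<close>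
  have small_X: "X \<le> exp (b * ln Q1) + 2" if "ln X \<le> b * ln Q" "0 < Q" "Q \<le> Q1" "X > 0" for X Q Q1
  proof -
    have "ln X \<le> b * ln Q1"
      using that b by (intro order.trans[OF that(1)] mult_left_mono) auto
    then have "exp (ln X) \<le> exp (b * ln Q1)" by simp
    then show ?thesis using that(4) by simp
  qed
  have nonneg: "X\<^sup>2 / ln X powr \<eta> \<ge> 0" for X :: real by simp
  show "\<exists>C. \<forall>q\<in>S. \<forall>X::real.
            X \<ge> real q powr (1 + \<epsilon>) \<and> a * ln (real q) \<le> ln X \<and> ln X \<le> b * ln (real q) \<longrightarrow>
            (\<Sum>chi\<in>Fam q. (cmod (\<Sum>n | 1 \<le> n \<and> real n \<le> X. lam n * chi (int n)))\<^sup>2)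
              \<le> C * (X\<^sup>2 / ln X powr \<eta>)"
    unfolding F_def[symmetric]
  proof -
    have "\<exists>C\<ge>0. \<exists>Q0\<ge>2. \<forall>Q\<ge>Q0. \<forall>\<Q> D X. finite \<Q> \<and> \<Q> \<subseteq> S \<and>
        (\<forall>q\<in>\<Q>. Q \<le> real q \<and> real q \<le> 2 * Q \<and> finite (Fam q)) \<and>
        (\<forall>q\<in>\<Q>. \<forall>q'\<in>\<Q>. lcm q q' \<le> D) \<and> real D * Q powr \<epsilon> \<le> X \<and> ln X \<le> b * ln Q \<longrightarrow>
        (\<Sum>q\<in>\<Q>. F q X) \<le> C * (X\<^sup>2 / ln X powr \<eta>)"
      unfolding F_def by (rule large_moduli_estimate[OF A1 A2 A3 A4 beta family \<epsilon> \<eta> b])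
    then obtain C Q0 where C: "C \<ge> 0" "Q0 \<ge> 2" and "\<forall>Q\<ge>Q0. \<forall>\<Q> D X. finite \<Q> \<and> \<Q> \<subseteq> S \<and>
        (\<forall>q\<in>\<Q>. Q \<le> real q \<and> real q \<le> 2 * Q \<and> finite (Fam q)) \<and>
        (\<forall>q\<in>\<Q>. \<forall>q'\<in>\<Q>. lcm q q' \<le> D) \<and> real D * Q powr \<epsilon> \<le> X \<and> ln X \<le> b * ln Q \<longrightarrow>
        (\<Sum>q\<in>\<Q>. F q X) \<le> C * (X\<^sup>2 / ln X powr \<eta>)"
      by (elim exE conjE) (rule that)
    note large = this(3)[rule_format]
    have "\<exists>C\<ge>0. \<forall>\<Q> X. \<Q> \<subseteq> {2..nat \<lceil>Q0\<rceil>} \<and> 2 \<le> X \<and> X \<le> exp (b * ln Q0) + 2 \<longrightarrow>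
        (\<Sum>q\<in>\<Q>. F q X) \<le> C * (X\<^sup>2 / ln X powr \<eta>)"
      unfolding F_def by (rule small_moduli_estimate[OF family]) simp_all
    then obtain C' where C': "C' \<ge> 0" and "\<forall>\<Q> X. \<Q> \<subseteq> {2..nat \<lceil>Q0\<rceil>} \<and> 2 \<le> X \<and> X \<le> exp (b * ln Q0) + 2 \<longrightarrow>
        (\<Sum>q\<in>\<Q>. F q X) \<le> C' * (X\<^sup>2 / ln X powr \<eta>)"
      by (elim exE conjE) (rule that)
    note small = this(2)[rule_format]
    show "\<exists>C. \<forall>q\<in>S. \<forall>X::real.
            X \<ge> real q powr (1 + \<epsilon>) \<and> a * ln (real q) \<le> ln X \<and> ln X \<le> b * ln (real q) \<longrightarrow>
            F q X \<le> C * (X\<^sup>2 / ln X powr \<eta>)"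
    proof (intro exI[of _ "C + C'"] ballI allI impI)
      fix q X assume q: "q \<in> S" and X: "X \<ge> real q powr (1 + \<epsilon>) \<and> a * ln (real q) \<le> ln X \<and> ln X \<le> b * ln (real q)"
      have q2: "2 \<le> q" using q moduli by auto
      have "F q X \<le> C * (X\<^sup>2 / ln X powr \<eta>) \<or> F q X \<le> C' * (X\<^sup>2 / ln X powr \<eta>)"
      proof (cases "finite (Fam q)")
        \<comment> \<open>A sum over an infinite set is 0 by convention.\<close>
        case False
        then show ?thesis using C nonneg[of X] by (simp add: F_def)
      next
        case fin: True
        show ?thesis
        proof (cases "real q \<ge> Q0")
          case True
          have "real q * real q powr \<epsilon> = real q powr (1 + \<epsilon>)" using q2 by (simp add: powr_add)
          \<comment> \<open>One modulus: here Q and D are both q, and D * Q^\<epsilon> is exactly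
            q^(1 + \<epsilon>).\<close>
          then have "(\<Sum>q\<in>{q}. F q X) \<le> C * (X\<^sup>2 / ln X powr \<eta>)"
            using q X fin by (intro large[OF True, of "{q}" q]) auto
          then show ?thesis by simp
        next
          case False
          have "real q powr 1 \<le> real q powr (1 + \<epsilon>)" using q2 \<epsilon> by (intro powr_mono) auto
          then have X2: "2 \<le> X" using X q2 by simp
          have "X \<le> exp (b * ln Q0) + 2"
            using X q2 False X2 by (intro small_X[of X "real q"]) auto
          moreover have "q \<le> nat \<lceil>Q0\<rceil>" using False by linarith
          ultimately have "(\<Sum>q\<in>{q}. F q X) \<le> C' * (X\<^sup>2 / ln X powr \<eta>)"
            using q2 X2 by (intro small) auto
          then show ?thesis by simp
        qed
      qed
      moreover have "C * (X\<^sup>2 / ln X powr \<eta>) \<ge> 0" "C' * (X\<^sup>2 / ln X powr \<eta>) \<ge> 0"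
        using C(1) C' nonneg[of X] by (auto intro: mult_nonneg_nonneg)
      ultimately show "F q X \<le> (C + C') * (X\<^sup>2 / ln X powr \<eta>)"
        unfolding distrib_right by linarith
    qed
  qed
  show "\<exists>C. \<forall>Q\<ge>2. \<forall>X::real.
            {q. Q \<le> real q \<and> real q \<le> 2 * Q} \<subseteq> S \<and>
            X \<ge> Q powr (2 + \<epsilon>) \<and> a * ln Q \<le> ln X \<and> ln X \<le> b * ln Q \<longrightarrow>
            (\<Sum>q | Q \<le> real q \<and> real q \<le> 2 * Q.
               \<Sum>chi\<in>Fam q. (cmod (\<Sum>n | 1 \<le> n \<and> real n \<le> X. lam n * chi (int n)))\<^sup>2)
              \<le> C * (X\<^sup>2 / ln X powr \<eta>)"
    unfolding F_def[symmetric]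
  proof -
    have "\<exists>C\<ge>0. \<exists>Q0\<ge>2. \<forall>Q\<ge>Q0. \<forall>\<Q> D X. finite \<Q> \<and> \<Q> \<subseteq> S \<and>
        (\<forall>q\<in>\<Q>. Q \<le> real q \<and> real q \<le> 2 * Q \<and> finite (Fam q)) \<and>
        (\<forall>q\<in>\<Q>. \<forall>q'\<in>\<Q>. lcm q q' \<le> D) \<and> real D * Q powr (\<epsilon> / 2) \<le> X \<and> ln X \<le> b * ln Q \<longrightarrow>
        (\<Sum>q\<in>\<Q>. F q X) \<le> C * (X\<^sup>2 / ln X powr \<eta>)"
      unfolding F_def by (rule large_moduli_estimate[OF A1 A2 A3 A4 beta family _ \<eta> b]) (use \<epsilon> in simp_all)
    then obtain C Q0 where C: "C \<ge> 0" "Q0 \<ge> 2" and "\<forall>Q\<ge>Q0. \<forall>\<Q> D X. finite \<Q> \<and> \<Q> \<subseteq> S \<and>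
        (\<forall>q\<in>\<Q>. Q \<le> real q \<and> real q \<le> 2 * Q \<and> finite (Fam q)) \<and>
        (\<forall>q\<in>\<Q>. \<forall>q'\<in>\<Q>. lcm q q' \<le> D) \<and> real D * Q powr (\<epsilon> / 2) \<le> X \<and> ln X \<le> b * ln Q \<longrightarrow>
        (\<Sum>q\<in>\<Q>. F q X) \<le> C * (X\<^sup>2 / ln X powr \<eta>)"
      by (elim exE conjE) (rule that)
    note large = this(3)[rule_format]
    \<comment> \<open>Beyond 4^(2 / \<epsilon>) one has Q^(\<epsilon> / 2) \<ge> 4. So one half of
      \<epsilon> absorbs the constant in D = 4 Q^2, and the other half goes into the
      estimate.\<close>
    define Q1 where "Q1 = max Q0 (4 powr (2 / \<epsilon>))"
    have Q1: "Q1 \<ge> Q0" "Q1 \<ge> 2" using C by (auto simp: Q1_def)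
    have "\<exists>C\<ge>0. \<forall>\<Q> X. \<Q> \<subseteq> {2..nat \<lceil>2 * Q1\<rceil>} \<and> 2 \<le> X \<and> X \<le> exp (b * ln Q1) + 2 \<longrightarrow>
        (\<Sum>q\<in>\<Q>. F q X) \<le> C * (X\<^sup>2 / ln X powr \<eta>)"
      unfolding F_def by (rule small_moduli_estimate[OF family]) simp_all
    then obtain C' where C': "C' \<ge> 0" and "\<forall>\<Q> X. \<Q> \<subseteq> {2..nat \<lceil>2 * Q1\<rceil>} \<and> 2 \<le> X \<and> X \<le> exp (b * ln Q1) + 2 \<longrightarrow>
        (\<Sum>q\<in>\<Q>. F q X) \<le> C' * (X\<^sup>2 / ln X powr \<eta>)"
      by (elim exE conjE) (rule that)
    note small = this(2)[rule_format]
    show "\<exists>C. \<forall>Q\<ge>2. \<forall>X::real.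
            {q. Q \<le> real q \<and> real q \<le> 2 * Q} \<subseteq> S \<and>
            X \<ge> Q powr (2 + \<epsilon>) \<and> a * ln Q \<le> ln X \<and> ln X \<le> b * ln Q \<longrightarrow>
            (\<Sum>q | Q \<le> real q \<and> real q \<le> 2 * Q. F q X) \<le> C * (X\<^sup>2 / ln X powr \<eta>)"
    proof (intro exI[of _ "C + C'"] allI impI)
      fix Q X :: real
      assume Q: "2 \<le> Q" and X: "{q. Q \<le> real q \<and> real q \<le> 2 * Q} \<subseteq> S \<and>
            X \<ge> Q powr (2 + \<epsilon>) \<and> a * ln Q \<le> ln X \<and> ln X \<le> b * ln Q"
      define \<Q> where "\<Q> = {q. Q \<le> real q \<and> real q \<le> 2 * Q}"
      have fin: "finite \<Q>"
        by (rule finite_subset[of _ "{..nat \<lfloor>2 * Q\<rfloor>}"]) (auto simp: \<Q>_def intro!: le_nat_floor)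
      have "(\<Sum>q\<in>\<Q>. F q X) \<le> C * (X\<^sup>2 / ln X powr \<eta>) \<or> (\<Sum>q\<in>\<Q>. F q X) \<le> C' * (X\<^sup>2 / ln X powr \<eta>)"
      proof (cases "Q \<ge> Q1")
        case True
        \<comment> \<open>Moduli with an infinite family contribute 0 and are dropped.\<close>
        define \<Q>' where "\<Q>' = {q\<in>\<Q>. finite (Fam q)}"
        have "(\<Sum>q\<in>\<Q>. F q X) = (\<Sum>q\<in>\<Q>'. F q X)"
          using fin by (intro sum.mono_neutral_right) (auto simp: \<Q>'_def F_def)
        also have "\<dots> \<le> C * (X\<^sup>2 / ln X powr \<eta>)"
        proof (rule large[of Q _ "nat \<lfloor>4 * Q\<^sup>2\<rfloor>"])
          show "Q \<ge> Q0" using True Q1 by linarith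
          have lcm: "lcm q q' \<le> nat \<lfloor>4 * Q\<^sup>2\<rfloor>" if "q \<in> \<Q>'" "q' \<in> \<Q>'" for q q'
          proof (rule le_nat_floor)
            have qq: "real q \<le> 2 * Q" "real q' \<le> 2 * Q" "real q \<ge> 2" "real q' \<ge> 2"
              using that Q by (auto simp: \<Q>'_def \<Q>_def)
            then have pos: "q * q' > 0" by (intro mult_pos_pos) auto
            have "lcm q q' dvd q * q'" by (intro lcm_least) auto
            then have "lcm q q' \<le> q * q'" using pos by (rule dvd_imp_le)
            then have "real (lcm q q') \<le> real q * real q'" by (simp flip: of_nat_mult)
            also have "\<dots> \<le> (2 * Q) * (2 * Q)" using qq Q by (intro mult_mono) auto
            finally show "real (lcm q q') \<le> 4 * Q\<^sup>2" by (simp add: power2_eq_square)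
          qed
          have "4 \<le> Q powr (\<epsilon> / 2)"
          proof -
            have "4 = (4 powr (2 / \<epsilon>)) powr (\<epsilon> / 2)" using \<epsilon> by (simp add: powr_powr)
            also have "\<dots> \<le> Q powr (\<epsilon> / 2)" using True \<epsilon> by (intro powr_mono2) (auto simp: Q1_def)
            finally show ?thesis .
          qed
          have "real (nat \<lfloor>4 * Q\<^sup>2\<rfloor>) * Q powr (\<epsilon> / 2) \<le> 4 * Q\<^sup>2 * Q powr (\<epsilon> / 2)"
            by (intro mult_right_mono) auto
          also have "\<dots> \<le> Q powr (\<epsilon> / 2) * Q\<^sup>2 * Q powr (\<epsilon> / 2)"
            using \<open>4 \<le> Q powr (\<epsilon> / 2)\<close> by (intro mult_right_mono) auto
          also have "\<dots> = Q powr (\<epsilon> / 2) * Q powr 2 * Q powr (\<epsilon> / 2)" using Q by simp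
          also have "\<dots> = Q powr (2 + \<epsilon>)" by (simp only: powr_add[symmetric]) (simp add: add.commute)
          finally have "real (nat \<lfloor>4 * Q\<^sup>2\<rfloor>) * Q powr (\<epsilon> / 2) \<le> X" using X by linarith
          moreover have "\<Q>' \<subseteq> S" using X by (auto simp: \<Q>'_def \<Q>_def)
          moreover have "finite \<Q>'" using fin by (simp add: \<Q>'_def)
          moreover have "\<forall>q\<in>\<Q>'. Q \<le> real q \<and> real q \<le> 2 * Q \<and> finite (Fam q)" by (auto simp: \<Q>'_def \<Q>_def)
          ultimately show "finite \<Q>' \<and> \<Q>' \<subseteq> S \<and>
            (\<forall>q\<in>\<Q>'. Q \<le> real q \<and> real q \<le> 2 * Q \<and> finite (Fam q)) \<and>
            (\<forall>q\<in>\<Q>'. \<forall>q'\<in>\<Q>'. lcm q q' \<le> nat \<lfloor>4 * Q\<^sup>2\<rfloor>) \<and>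
            real (nat \<lfloor>4 * Q\<^sup>2\<rfloor>) * Q powr (\<epsilon> / 2) \<le> X \<and> ln X \<le> b * ln Q"
            using lcm X by blast
        qed
        finally show ?thesis by blast
      next
        case False
        have "Q powr 1 \<le> Q powr (2 + \<epsilon>)" using Q \<epsilon> by (intro powr_mono) auto
        then have X2: "2 \<le> X" using X Q by simp
        have "X \<le> exp (b * ln Q1) + 2"
          using X Q False X2 by (intro small_X[of X Q]) auto
        moreover have "\<Q> \<subseteq> {2..nat \<lceil>2 * Q1\<rceil>}"
        proof
          fix q assume "q \<in> \<Q>"
          then have "real q \<ge> 2" "real q \<le> 2 * Q1" using Q False by (auto simp: \<Q>_def)
          then show "q \<in> {2..nat \<lceil>2 * Q1\<rceil>}" unfolding atLeastAtMost_iff by linarith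
        qed
        ultimately have "(\<Sum>q\<in>\<Q>. F q X) \<le> C' * (X\<^sup>2 / ln X powr \<eta>)"
          using X2 by (intro small) auto
        then show ?thesis by simp
      qed
      moreover have "C * (X\<^sup>2 / ln X powr \<eta>) \<ge> 0" "C' * (X\<^sup>2 / ln X powr \<eta>) \<ge> 0"
        using C(1) C' nonneg[of X] by (auto intro: mult_nonneg_nonneg)
      ultimately show "(\<Sum>q | Q \<le> real q \<and> real q \<le> 2 * Q. F q X) \<le> (C + C') * (X\<^sup>2 / ln X powr \<eta>)"
        unfolding \<Q>_def[symmetric] distrib_right by linarith
    qed
  qed
qed

end
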